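(* Let $L\colon\mathbb R^{2\times 2}\to\mathbb R$ be the function \[ L(A)=\begin{cases}\det A & \text{if } |A|\le 1,\\ 2|a_+|-1 & \text{if } |A|>1,\end{cases} \] where $A\equiv(a_+,a_-)$ in complex coordinates and $|A|=|a_+|+|a_-|$. Then for every $A\in\mathbb R^{2\times 2}$ and every real-valued $u\in C_c^\infty(\mathbb R^2)$, \[ \int_{\mathbb R^2}\bigl[L(A+\mathrm D^2u(x))-L(A)\bigr]\,\mathrm dx\ge 0 . \]
   Context: Identify $\mathbb R^2$ with $\mathbb C$. Every $A\in\mathbb R^{2\times2}$ can be written uniquely as $Az=a_+z+a_-\overline z$ with $a_+,a_-\in\mathbb C$, and one writes $A\equiv(a_+,a_-)$. Explicitly, \[ A=\begin{pmatrix}\Re a_++\Re a_-&-\Im a_++\Im a_-\\ \Im a_++\Im a_-&\Re a_+-\Re a_-\end{pmatrix}. \] One has $\det A=|a_+|^2-|a_-|^2$, and $|A|=|a_+|+|a_-|$ is the operator norm of $A$. $\mathrm D^2u$ denotes the Hessian matrix of $u$. The matrix $A$ is not assumed to be symmetric. *)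

theory Defs
  imports "HOL-Analysis.Analysis"
begin

definition to_complex :: "real^2 \<Rightarrow> complex" where
  "to_complex v = Complex (v $ 1) (v $ 2)"

text \<open>The coordinates \<open>(a\<^sub>+, a\<^sub>-)\<close> of \<open>A\<close>, obtained by inverting the formula for the entries of
  \<open>z \<mapsto> a\<^sub>+ z + a\<^sub>- cnj z\<close>; \<open>complex_coordinates_iff\<close> below shows that they are the unique
  complex numbers representing \<open>A\<close> in this way.\<close>

definition cplus :: "real^2^2 \<Rightarrow> complex" where
  "cplus A = Complex ((A$1$1 + A$2$2) / 2) ((A$2$1 - A$1$2) / 2)"

definition cminus :: "real^2^2 \<Rightarrow> complex" where
  "cminus A = Complex ((A$1$1 - A$2$2) / 2) ((A$2$1 + A$1$2) / 2)"

lemma complex_coordinates_iff: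
  "(\<forall>v. to_complex (A *v v) = p * to_complex v + m * cnj (to_complex v))
     \<longleftrightarrow> p = cplus A \<and> m = cminus A"
proof
  assume H: "\<forall>v. to_complex (A *v v) = p * to_complex v + m * cnj (to_complex v)"
  have "to_complex (A *v axis 1 1) = p + m" "to_complex (A *v axis 2 1) = (p - m) * \<i>"
    using H by (auto simp: to_complex_def axis_def complex_eq_iff)
  then show "p = cplus A \<and> m = cminus A"
    by (auto simp: to_complex_def cplus_def cminus_def complex_eq_iff
        matrix_vector_mult_def sum_2 axis_def)
next
  assume pm: "p = cplus A \<and> m = cminus A"
  show "\<forall>v. to_complex (A *v v) = p * to_complex v + m * cnj (to_complex v)"
    unfolding pm[THEN conjunct1] pm[THEN conjunct2]
    by (auto simp: to_complex_def cplus_def cminus_def complex_eq_iff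
        matrix_vector_mult_def sum_2 algebra_simps add_divide_distrib diff_divide_distrib)
qed

lemma det_complex_coordinates: "det A = (cmod (cplus A))\<^sup>2 - (cmod (cminus A))\<^sup>2"
  unfolding cmod_power2 det_2 cplus_def cminus_def complex.sel
  by (simp add: power2_eq_square field_simps)

text \<open>In complex coordinates the operator norm of \<open>A\<close> for the Euclidean norm is
  \<open>\<bar>a\<^sub>+\<bar> + \<bar>a\<^sub>-\<bar>\<close>; this expression is taken as the definition. It is not the
  library's \<^const>\<open>norm\<close> on \<^typ>\<open>real^2^2\<close>, which is the Frobenius norm.\<close>

definition mnorm :: "real^2^2 \<Rightarrow> real" where
  "mnorm A = cmod (cplus A) + cmod (cminus A)"

definition L_fun :: "real^2^2 \<Rightarrow> real" where
  "L_fun A = (if mnorm A \<le> 1 then det A else 2 * cmod (cplus A) - 1)"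

definition partial_deriv :: "'n::finite \<Rightarrow> (real^'n \<Rightarrow> real) \<Rightarrow> real^'n \<Rightarrow> real" where
  "partial_deriv i f x = frechet_derivative f (at x) (axis i 1)"

text \<open>\<open>C_times k f\<close>: all partial derivatives of \<open>f\<close> of order at most \<open>k\<close> exist and are
  continuous. Differentiability is required before passing to the next order, so the values of
  \<^const>\<open>frechet_derivative\<close> used are never arbitrary.\<close>

fun C_times :: "nat \<Rightarrow> (real^'n::finite \<Rightarrow> real) \<Rightarrow> bool" where
  "C_times 0 f \<longleftrightarrow> continuous_on UNIV f"
| "C_times (Suc k) f \<longleftrightarrow> f differentiable_on UNIV \<and> (\<forall>i. C_times k (partial_deriv i f))"

definition smooth :: "(real^'n::finite \<Rightarrow> real) \<Rightarrow> bool" where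
  "smooth f \<longleftrightarrow> (\<forall>k. C_times k f)"

definition Cc_infinity :: "(real^'n::finite \<Rightarrow> real) set" where
  "Cc_infinity = {u. smooth u \<and> compact (closure {x. u x \<noteq> 0})}"

definition hessian :: "(real^'n::finite \<Rightarrow> real) \<Rightarrow> real^'n \<Rightarrow> real^'n^'n" where
  "hessian u x = (\<chi> i j. partial_deriv i (partial_deriv j u) x)"

lemma partial_deriv_zero_on_open:
  assumes "open S" "\<And>x. x \<in> S \<Longrightarrow> f x = 0" "x \<in> S"
  shows "partial_deriv i f x = 0"
proof -
  have "(f has_derivative (\<lambda>_. 0)) (at x)"
    by (rule has_derivative_transform_within_open[OF has_derivative_const[of 0] assms(1,3)])
       (simp add: assms(2))
  then show ?thesis
    by (simp add: partial_deriv_def frechet_derivative_at[symmetric])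
qed

lemma continuous_on_L_fun: "continuous_on UNIV L_fun"
proof -
  have p: "continuous_on S cplus" for S
    unfolding cplus_def Complex_eq by (intro continuous_intros) auto
  have m: "continuous_on S cminus" for S
    unfolding cminus_def Complex_eq by (intro continuous_intros) auto
  have "det A = 2 * cmod (cplus A) - 1" if "mnorm A = 1" for A
  proof -
    have "det A = (cmod (cplus A) + cmod (cminus A)) * (cmod (cplus A) - cmod (cminus A))"
      by (simp add: det_complex_coordinates power2_eq_square algebra_simps)
    then show ?thesis using that by (simp add: mnorm_def)
  qed
  then show ?thesis
    unfolding L_fun_def
    by (intro continuous_on_cases_le)
       (auto simp: mnorm_def det_complex_coordinates intro!: continuous_intros p m)
qed

text \<open>The integrand in question is always Lebesgue integrable, so its Bochner integral is never
  the default value for non-integrable functions.\<close>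

lemma integrable_L_fun_hessian:
  assumes "u \<in> Cc_infinity"
  shows "integrable lborel (\<lambda>x. L_fun (A + hessian u x) - L_fun A)"
proof -
  define K where "K = closure {x. u x \<noteq> 0}"
  have K: "compact K" and C: "C_times (Suc (Suc 0)) u"
    using assms unfolding K_def Cc_infinity_def smooth_def by blast+
  have "continuous_on S (hessian u)" for S
    unfolding hessian_def using C
    by (intro continuous_on_vec_lambda) (auto intro: continuous_on_subset)
  then have cont: "continuous_on K (\<lambda>x. L_fun (A + hessian u x) - L_fun A)"
    by (intro continuous_intros continuous_on_compose2[OF continuous_on_L_fun]) auto
  have op: "open (- K)" by (simp add: K_def open_Compl)
  have u0: "u x = 0" if "x \<in> - K" for x
    using that closure_subset[of "{x. u x \<noteq> 0}"] by (auto simp: K_def)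
  have "partial_deriv i (partial_deriv j u) x = 0" if "x \<in> - K" for i j x
    by (rule partial_deriv_zero_on_open[OF op partial_deriv_zero_on_open[OF op u0] that])
  then have "hessian u x = 0" if "x \<in> - K" for x
    using that by (simp add: hessian_def vec_eq_iff)
  then have "(\<lambda>x. L_fun (A + hessian u x) - L_fun A)
      = (\<lambda>x. indicator K x *\<^sub>R (L_fun (A + hessian u x) - L_fun A))"
    by (auto simp: fun_eq_iff indicator_def)
  then show ?thesis using borel_integrable_compact[OF K cont] by simp
qed

end

theory Submission imports Defs begin

text \<open>Why the inequality holds. Always \<open>L(B) \<ge> 2\<bar>b\<^sub>+\<bar> - 1\<close>, with equality at \<open>B = A\<close> when \<open>\<bar>A\<bar> \<ge> 1\<close>. In
  that case \<open>\<bar>b\<^sub>+\<bar>\<close> lies above the linear function \<open>Re (cnj \<omega> b\<^sub>+)\<close>, where \<open>\<omega> = a\<^sub>+ / \<bar>a\<^sub>+\<bar>\<close>, with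
  equality at \<open>A\<close>, and linear functions of \<open>D\<^sup>2u\<close> integrate to zero.

  Let \<open>\<bar>A\<bar> < 1\<close>, \<open>a\<^sub>+ = \<alpha> + i\<beta>\<close> and \<open>s = sqrt (1 - \<beta>\<^sup>2)\<close>. Adding a Hessian does not change \<open>\<beta>\<close>. For
  matrices \<open>B\<close> with this \<open>\<beta>\<close> and symmetric part \<open>s M\<close> one has \<open>L(B) \<ge> \<beta>\<^sup>2 + s\<^sup>2 f(M)\<close>, with equality at
  \<open>A\<close>, where \<open>f(M)\<close> is \<open>det M\<close> if the eigenvalues of \<open>M\<close> lie in \<open>[-1, 1]\<close> and \<open>\<bar>tr M\<bar> - 1\<close> otherwise.
  So it suffices to bound the integral of \<open>f(D\<^sup>2v)\<close> from below by that of \<open>det A\<close>, when \<open>A\<close> is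
  symmetric with eigenvalues inside \<open>(-1, 1)\<close> and \<open>v\<close> is the quadratic function with Hessian \<open>A\<close> plus
  a function of compact support (lemma \<open>det_le_integral\<close>).

  For this, \<open>v\<close> is compared with a function \<open>w\<close> that equals \<open>v\<close> far away and solves a double obstacle
  problem (\<open>double_obstacle_solution\<close>): the eigenvalues of \<open>D\<^sup>2w\<close> lie in \<open>[-1, 1]\<close>, the smaller one is
  \<open>-1\<close> where \<open>w < v\<close>, and the larger one is \<open>1\<close> where \<open>w > v\<close>. The determinant is a null Lagrangian,
  so \<open>det D\<^sup>2w\<close> has the same integral as \<open>det A\<close>. Almost everywhere on the contact set \<open>D\<^sup>2w = D\<^sup>2v\<close>,
  so there \<open>f(D\<^sup>2v) = det D\<^sup>2w\<close>. Where \<open>w < v\<close>, the identity \<open>(1 + \<lambda>) (1 + \<mu>) = 0\<close> for the eigenvalues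
  of \<open>D\<^sup>2w\<close> reads \<open>det D\<^sup>2w = - tr D\<^sup>2w - 1\<close>, while \<open>f(D\<^sup>2v) \<ge> - tr D\<^sup>2v - 1\<close>; moreover the integral of
  \<open>tr D\<^sup>2v\<close> over \<open>{w < v}\<close> is at most that of \<open>tr D\<^sup>2w\<close>, because \<open>v - w\<close> is positive inside and zero on
  the boundary. The region \<open>{w > v}\<close> is symmetric.

  The function \<open>w\<close> is only \<open>C\<^sup>1\<close> with a 1-Lipschitz gradient \<open>G\<close>, so its second derivatives are
  replaced by areas. For \<open>\<bar>t\<bar> < 1\<close> the map \<open>T\<^sub>t x = x + t G x\<close> is a bijection of the plane, and the
  area of \<open>T\<^sub>t(U)\<close> is a quadratic polynomial in \<open>t\<close> (\<open>displace_area_quadratic\<close>), whose coefficients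
  play the roles of the integrals of \<open>1\<close>, \<open>tr D\<^sup>2w\<close> and \<open>det D\<^sup>2w\<close>. The eigenvalue condition on
  \<open>{w < v}\<close> becomes the statement that \<open>T\<^sub>1\<close> maps this set to a null set
  (\<open>negligible_unliftable_image\<close>), and the comparison of traces becomes the inclusion of the image of
  \<open>{w < v}\<close> under \<open>x + t \<nabla>v\<close> in its image under \<open>T\<^sub>t\<close> for small \<open>t > 0\<close>
  (\<open>displace_sublevel_subset\<close>).\<close>

section \<open>Semiconvex functions\<close>

text \<open>The point \<open>(x, f x)\<close> is separated by a hyperplane from the strict epigraph of \<open>f\<close>. The hyperplane is
  not vertical, because the epigraph projects onto the whole space.\<close>

lemma convex_on_support:
  fixes f :: "'a::euclidean_space \<Rightarrow> real"
  assumes "convex_on UNIV f"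
  obtains p where "\<And>y. f x + p \<bullet> (y - x) \<le> f y"
proof -
  let ?T = "{(y, s). f y < s}"
  have "convex ?T"
  proof (rule convexI, clarsimp)
    fix y z :: 'a and s r a b :: real
    assume *: "f y < s" "f z < r" "0 \<le> a" "0 \<le> b" "a + b = 1"
    have "f (a *\<^sub>R y + b *\<^sub>R z) \<le> a * f y + b * f z"
      using assms * by (simp add: convex_on_def)
    also have "a * f y + b * f z < a * s + b * r"
    proof (cases "a = 0")
      case True then show ?thesis using * by simp
    next
      case False
      then have "a * f y < a * s" "b * f z \<le> b * r" using * by (auto intro: mult_left_mono)
      then show ?thesis by linarith
    qed
    finally show "f (a *\<^sub>R y + b *\<^sub>R z) < a * s + b * r" .
  qed
  moreover have "(x, f x + 1) \<in> ?T" by simp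
  moreover have "{(x, f x)} \<inter> ?T = {}" by simp
  ultimately obtain ab c where ab: "ab \<noteq> 0" "ab \<bullet> (x, f x) \<le> c" "\<forall>z\<in>?T. c \<le> ab \<bullet> z"
    using separating_hyperplane_sets[of "{(x, f x)}" ?T] by (metis convex_singleton empty_iff insert_not_empty singletonI)
  obtain a b where "ab = (a, b)" by (cases ab)
  with ab have nz: "a \<noteq> 0 \<or> b \<noteq> 0" by (simp add: zero_prod_def)
  have le: "a \<bullet> x + b * f x \<le> a \<bullet> y + b * s" if "f y < s" for y s
    using ab \<open>ab = (a, b)\<close> that by force
  have "b \<ge> 0"
    using le[of x "f x + 1"] by (simp add: algebra_simps)
  moreover have "b \<noteq> 0"
  proof
    assume "b = 0"
    then have "0 \<le> a \<bullet> (y - x)" for y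
      using le[of y "f y + 1"] by (simp add: inner_diff_right)
    from this[of "x - a"] have "a \<bullet> a \<le> 0" by simp
    then have "a = 0" by (metis inner_gt_zero_iff not_less)
    with nz \<open>b = 0\<close> show False by simp
  qed
  ultimately have "b > 0" by simp
  have "f x + (- (1 / b) *\<^sub>R a) \<bullet> (y - x) \<le> s" if "f y < s" for y s
    using le[OF that] \<open>b > 0\<close> by (simp add: inner_diff_right field_simps)
  then have "f x + (- (1 / b) *\<^sub>R a) \<bullet> (y - x) \<le> f y" for y
    by (meson dense_ge)
  then show thesis using that by blast
qed

text \<open>In terms of second derivatives: \<open>D\<^sup>2w \<ge> -I\<close>.\<close>

definition semiconvex :: "('a::real_inner \<Rightarrow> real) \<Rightarrow> bool" where
  "semiconvex w \<longleftrightarrow> convex_on UNIV (\<lambda>x. w x + (norm x)\<^sup>2 / 2)"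

lemma norm_convex_comb_sq:
  fixes x y :: "'a::real_inner"
  assumes "a + b = 1"
  shows "a * (norm x)\<^sup>2 + b * (norm y)\<^sup>2 - (norm (a *\<^sub>R x + b *\<^sub>R y))\<^sup>2 = a * b * (norm (x - y))\<^sup>2"
proof -
  have b: "b = 1 - a" using assms by simp
  show ?thesis
    unfolding b power2_norm_eq_inner
    by (simp add: inner_simps inner_commute[of y x] algebra_simps power2_eq_square)
qed

lemma semiconvex_iff:
  "semiconvex w \<longleftrightarrow> (\<forall>a b x y. 0 \<le> a \<longrightarrow> 0 \<le> b \<longrightarrow> a + b = 1 \<longrightarrow>
     w (a *\<^sub>R x + b *\<^sub>R y) \<le> a * w x + b * w y + a * b * (norm (x - y))\<^sup>2 / 2)"
proof -
  have "(w (a *\<^sub>R x + b *\<^sub>R y) \<le> a * w x + b * w y + a * b * (norm (x - y))\<^sup>2 / 2) \<longleftrightarrow>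
     w (a *\<^sub>R x + b *\<^sub>R y) + (norm (a *\<^sub>R x + b *\<^sub>R y))\<^sup>2 / 2
       \<le> a * (w x + (norm x)\<^sup>2 / 2) + b * (w y + (norm y)\<^sup>2 / 2)" if "a + b = 1" for a b x y
    using norm_convex_comb_sq[OF that, of x y] by (simp add: algebra_simps) argo
  then show ?thesis
    unfolding semiconvex_def convex_on_def by auto
qed

lemma semiconvexI:
  assumes "\<And>a b x y. 0 \<le> a \<Longrightarrow> 0 \<le> b \<Longrightarrow> a + b = 1 \<Longrightarrow>
     w (a *\<^sub>R x + b *\<^sub>R y) \<le> a * w x + b * w y + a * b * (norm (x - y))\<^sup>2 / 2"
  shows "semiconvex w"
  using assms by (simp add: semiconvex_iff)

lemma semiconvexD:
  assumes "semiconvex w" "0 \<le> a" "0 \<le> b" "a + b = 1"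
  shows "w (a *\<^sub>R x + b *\<^sub>R y) \<le> a * w x + b * w y + a * b * (norm (x - y))\<^sup>2 / 2"
  using assms by (simp add: semiconvex_iff)

lemma semiconvex_max:
  assumes "semiconvex w" "semiconvex k"
  shows "semiconvex (\<lambda>x. max (w x) (k x))"
proof (rule semiconvexI)
  fix a b :: real and x y
  assume ab: "0 \<le> a" "0 \<le> b" "a + b = 1"
  have "a * w x \<le> a * max (w x) (k x)" "a * k x \<le> a * max (w x) (k x)"
    "b * w y \<le> b * max (w y) (k y)" "b * k y \<le> b * max (w y) (k y)"
    using ab by (auto intro: mult_left_mono)
  with semiconvexD[OF assms(1) ab, of x y] semiconvexD[OF assms(2) ab, of x y]
  show "max (w (a *\<^sub>R x + b *\<^sub>R y)) (k (a *\<^sub>R x + b *\<^sub>R y))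
    \<le> a * max (w x) (k x) + b * max (w y) (k y) + a * b * (norm (x - y))\<^sup>2 / 2"
    by linarith
qed

lemma semiconvex_SUP:
  assumes "S \<noteq> {}" "\<And>k. k \<in> S \<Longrightarrow> semiconvex k" "\<And>x. bdd_above ((\<lambda>k. k x) ` S)"
  shows "semiconvex (\<lambda>x. SUP k\<in>S. k x)"
proof (rule semiconvexI, rule cSUP_least[OF assms(1)])
  fix a b :: real and x y k
  assume ab: "0 \<le> a" "0 \<le> b" "a + b = 1" and k: "k \<in> S"
  have "a * k x \<le> a * (SUP k\<in>S. k x)" "b * k y \<le> b * (SUP k\<in>S. k y)"
    using ab k by (auto intro!: mult_left_mono cSUP_upper assms)
  with semiconvexD[OF assms(2)[OF k] ab, of x y]
  show "k (a *\<^sub>R x + b *\<^sub>R y) \<le> a * (SUP k\<in>S. k x) + b * (SUP k\<in>S. k y)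
     + a * b * (norm (x - y))\<^sup>2 / 2"
    by linarith
qed

lemma semiconvex_add_const: "semiconvex w \<Longrightarrow> semiconvex (\<lambda>x. w x + c)"
proof (rule semiconvexI)
  fix a b :: real and x y
  assume w: "semiconvex w" and ab: "0 \<le> a" "0 \<le> b" "a + b = 1"
  have "a * c + b * c = c" using ab by (simp flip: distrib_right)
  with semiconvexD[OF w ab, of x y]
  show "w (a *\<^sub>R x + b *\<^sub>R y) + c \<le> a * (w x + c) + b * (w y + c) + a * b * (norm (x - y))\<^sup>2 / 2"
    by (simp add: algebra_simps)
qed

section \<open>The double obstacle problem\<close>

text \<open>For semiconvex \<open>w\<close> this says that \<open>w\<close> is the largest semiconvex function below \<open>max w v\<close>: where
  \<open>w < v\<close>, only semiconvexity prevents \<open>w\<close> from being raised, so the smallest eigenvalue of \<open>D\<^sup>2w\<close> is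
  \<open>-1\<close> there. In this form the condition passes to infima of functions \<open>w\<close>.\<close>

definition unliftable :: "('a::real_inner \<Rightarrow> real) \<Rightarrow> ('a \<Rightarrow> real) \<Rightarrow> bool" where
  "unliftable w v \<longleftrightarrow> (\<forall>k. semiconvex k \<longrightarrow> (\<forall>x. k x \<le> max (w x) (v x)) \<longrightarrow> (\<forall>x. k x \<le> w x))"

text \<open>Taking the largest semiconvex minorant \<open>m\<close> preserves the upper bound \<open>D\<^sup>2w \<le> I\<close>. Indeed, the average
  \<open>k(c) = a m(c + b e) + b m(c - a e) - a b \<bar>e\<bar>\<^sup>2 / 2\<close> of translates of \<open>m\<close> is again semiconvex, and by the
  upper bound on \<open>w\<close> it lies below \<open>w\<close>; so \<open>k \<le> m\<close> by maximality, which is the upper bound for \<open>m\<close>.\<close>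

lemma semiconvex_minorant:
  fixes w :: "'a::euclidean_space \<Rightarrow> real"
  assumes conc: "semiconvex (\<lambda>x. - w x)" and k0: "semiconvex k0" "\<And>x. k0 x \<le> w x"
  obtains m where "semiconvex m" "semiconvex (\<lambda>x. - m x)" "\<And>x. m x \<le> w x"
    "\<And>k x. semiconvex k \<Longrightarrow> (\<And>y. k y \<le> w y) \<Longrightarrow> k x \<le> m x"
proof -
  define S where "S = {k. semiconvex k \<and> (\<forall>x. k x \<le> w x)}"
  define m where "m = (\<lambda>x. SUP k\<in>S. k x)"
  have S: "S \<noteq> {}" "bdd_above ((\<lambda>k. k x) ` S)" for x
    using k0 by (auto simp: S_def bdd_above_def)
  have sm: "semiconvex m"
    unfolding m_def using S by (intro semiconvex_SUP) (auto simp: S_def)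
  have m_le: "m x \<le> w x" for x
    unfolding m_def using S(1) by (intro cSUP_least) (auto simp: S_def)
  have max: "k x \<le> m x" if "semiconvex k" "\<And>y. k y \<le> w y" for k x
    unfolding m_def by (rule cSUP_upper2[OF S(2), of k]) (use that in \<open>auto simp: S_def\<close>)
  have "semiconvex (\<lambda>x. - m x)"
  proof (rule semiconvexI)
    fix a b :: real and x y :: 'a
    assume ab: "0 \<le> a" "0 \<le> b" "a + b = 1"
    have ba: "b = 1 - a" using ab by simp
    define z e where "z = a *\<^sub>R x + b *\<^sub>R y" and "e = x - y"
    \<comment> \<open>the average of translates, in which m x and m y occur at c = z\<close>
    define k where "k = (\<lambda>c. a * m (c + b *\<^sub>R e) + b * m (c - a *\<^sub>R e) - a * b * (norm e)\<^sup>2 / 2)"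
    have sk: "semiconvex k"
    proof (rule semiconvexI)
      fix p q :: real and c d :: 'a
      assume pq: "0 \<le> p" "0 \<le> q" "p + q = 1"
      define Q where "Q = p * q * (norm (c - d))\<^sup>2 / 2"
      have qp: "q = 1 - p" using pq by simp
      have m: "m (p *\<^sub>R c + q *\<^sub>R d + r) \<le> p * m (c + r) + q * m (d + r) + Q" for r
      proof -
        have eq: "p *\<^sub>R (c + r) + q *\<^sub>R (d + r) = p *\<^sub>R c + q *\<^sub>R d + r"
          by (simp add: qp scaleR_add_right scaleR_left_diff_distrib)
        show ?thesis
          using semiconvexD[OF sm pq, of "c + r" "d + r"] unfolding eq Q_def by simp
      qed
      have 3: "a * m (p *\<^sub>R c + q *\<^sub>R d + b *\<^sub>R e) \<le> a * (p * m (c + b *\<^sub>R e) + q * m (d + b *\<^sub>R e) + Q)"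
        "b * m (p *\<^sub>R c + q *\<^sub>R d + - a *\<^sub>R e) \<le> b * (p * m (c + - a *\<^sub>R e) + q * m (d + - a *\<^sub>R e) + Q)"
        using ab by (intro mult_left_mono m; simp)+
      have 4: "a * Q + b * Q = Q" "p * R + q * R = R" for R
        unfolding ba qp by (simp_all add: algebra_simps)
      show "k (p *\<^sub>R c + q *\<^sub>R d) \<le> p * k c + q * k d + p * q * (norm (c - d))\<^sup>2 / 2"
        using 3 4(1) 4(2)[of "a * b * (norm e)\<^sup>2 / 2"] unfolding k_def Q_def[symmetric]
        by (simp add: distrib_left right_diff_distrib mult.left_commute)
    qed
    have "k c \<le> w c" for c
    proof -
      have eq: "a *\<^sub>R (c + b *\<^sub>R e) + b *\<^sub>R (c - a *\<^sub>R e) = c"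
        "(c + b *\<^sub>R e) - (c - a *\<^sub>R e) = e"
        by (simp_all add: ba scaleR_add_right scaleR_diff_right scaleR_left_diff_distrib left_diff_distrib)
      have "- w c \<le> a * (- w (c + b *\<^sub>R e)) + b * (- w (c - a *\<^sub>R e)) + a * b * (norm e)\<^sup>2 / 2"
        using semiconvexD[OF conc ab, of "c + b *\<^sub>R e" "c - a *\<^sub>R e"] unfolding eq .
      moreover have "a * m (c + b *\<^sub>R e) \<le> a * w (c + b *\<^sub>R e)" "b * m (c - a *\<^sub>R e) \<le> b * w (c - a *\<^sub>R e)"
        using ab m_le by (auto intro: mult_left_mono)
      ultimately show ?thesis unfolding k_def by simp
    qed
    from max[OF sk this] have "k z \<le> m z" .
    moreover have "z + b *\<^sub>R e = x" "z - a *\<^sub>R e = y"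
      by (simp_all add: z_def e_def ba scaleR_add_right scaleR_diff_right scaleR_left_diff_distrib left_diff_distrib)
    ultimately show "- m (a *\<^sub>R x + b *\<^sub>R y) \<le> a * - m x + b * - m y + a * b * (norm (x - y))\<^sup>2 / 2"
      unfolding k_def z_def[symmetric] e_def[symmetric] by simp
  qed
  with sm m_le max that show thesis by blast
qed

text \<open>The solution is the smallest function \<open>w\<close> near \<open>q\<close> with \<open>D\<^sup>2w \<le> I\<close> that is unliftable towards \<open>v\<close>, in
  the manner of the Knaster--Tarski theorem: the class is closed under infima. It is also closed under
  passing to the largest semiconvex minorant, so the smallest member is semiconvex, and under taking
  the minimum with a function \<open>k\<close> that satisfies \<open>D\<^sup>2k \<le> I\<close> and \<open>k \<ge> min w v\<close>, so the smallest member
  cannot be lowered towards \<open>v\<close> either. The functions \<open>q - M\<close> and \<open>q + M\<close> keep the infimum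
  finite and the class nonempty.\<close>

lemma double_obstacle_solution:
  fixes v q :: "'a::euclidean_space \<Rightarrow> real"
  assumes q: "semiconvex q" "semiconvex (\<lambda>x. - q x)" and bd: "\<And>x. \<bar>v x - q x\<bar> \<le> M"
  obtains w where "semiconvex w" "semiconvex (\<lambda>x. - w x)"
    "unliftable w v" "unliftable (\<lambda>x. - w x) (\<lambda>x. - v x)"
proof -
  define S where "S = {w. (\<forall>x. q x - M \<le> w x) \<and> semiconvex (\<lambda>x. - w x) \<and> unliftable w v}"
  define w where "w = (\<lambda>x. INF k\<in>S. k x)"
  have "(\<lambda>x. q x + M) \<in> S"
  proof -
    have "M \<ge> 0" using bd[of 0] by linarith
    moreover have "semiconvex (\<lambda>x. - (q x + M))"
      using semiconvex_add_const[OF q(2), of "-M"] by (simp add: algebra_simps)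
    moreover have "max (q x + M) (v x) = q x + M" for x
      by (rule max_absorb1) (use bd[of x] in linarith)
    then have "unliftable (\<lambda>x. q x + M) v" unfolding unliftable_def by simp
    ultimately show ?thesis unfolding S_def by simp
  qed
  then have S: "S \<noteq> {}" by blast
  have S2: "bdd_below ((\<lambda>k. k x) ` S)" for x
    by (rule bdd_belowI2[of _ "q x - M"]) (simp add: S_def)
  have w_le: "w x \<le> k x" if "k \<in> S" for k x
    unfolding w_def by (rule cINF_lower[OF S2 that])
  have w_ge: "q x - M \<le> w x" for x
    unfolding w_def using S by (intro cINF_greatest) (auto simp: S_def)
  have sw: "semiconvex (\<lambda>x. - w x)"
  proof -
    have "- w x = (SUP k\<in>(\<lambda>k x. - k x) ` S. k x)" for x
      unfolding w_def Inf_real_def by (simp only: image_image minus_minus)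
    moreover have "bdd_above ((\<lambda>k. k x) ` (\<lambda>k x. - k x) ` S)" for x
      unfolding image_image by (rule bdd_aboveI2[of _ _ "M - q x"]) (simp add: S_def algebra_simps)
    then have "semiconvex (\<lambda>x. SUP k\<in>(\<lambda>k x. - k x) ` S. k x)"
      using S by (intro semiconvex_SUP) (auto simp: S_def)
    ultimately show ?thesis by simp
  qed
  have uw: "unliftable w v"
    unfolding unliftable_def
  proof (intro allI impI)
    fix k x
    assume k: "semiconvex k" "\<forall>x. k x \<le> max (w x) (v x)"
    have "k x \<le> j x" if "j \<in> S" for j
    proof -
      have "k x \<le> max (j x) (v x)" for x
        using k(2)[rule_format, of x] w_le[OF that, of x] by linarith
      then show ?thesis using that k(1) by (auto simp: S_def unliftable_def)
    qed
    then show "k x \<le> w x" unfolding w_def using S by (intro cINF_greatest)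
  qed
  have wS: "w \<in> S" using w_ge sw uw by (simp add: S_def)
  have s0: "semiconvex (\<lambda>x. q x - M)" using semiconvex_add_const[OF q(1), of "- M"] by simp
  obtain m where m: "semiconvex m" "semiconvex (\<lambda>x. - m x)" "\<And>x. m x \<le> w x"
    "\<And>k x. semiconvex k \<Longrightarrow> (\<And>y. k y \<le> w y) \<Longrightarrow> k x \<le> m x"
    using semiconvex_minorant[OF sw s0 w_ge] by metis
  have "unliftable m v"
    unfolding unliftable_def
  proof (intro allI impI)
    fix k x
    assume k: "semiconvex k" "\<forall>x. k x \<le> max (m x) (v x)"
    have "k x \<le> max (w x) (v x)" for x
      using k(2)[rule_format, of x] m(3)[of x] by linarith
    then have "k y \<le> w y" for y using uw k(1) by (auto simp: unliftable_def)
    then show "k x \<le> m x" using m(4) k(1) by blast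
  qed
  then have "m \<in> S" using m(2) m(4)[OF s0 w_ge] by (simp add: S_def)
  then have "w = m" using w_le m(3) by (auto simp: fun_eq_iff intro: antisym)
  then have sw': "semiconvex w" using m(1) by simp
  have "unliftable (\<lambda>x. - w x) (\<lambda>x. - v x)"
    unfolding unliftable_def
  proof (intro allI impI)
    fix j x
    assume j: "semiconvex j" "\<forall>x. j x \<le> max (- w x) (- v x)"
    \<comment> \<open>a competitor for w, smaller wherever - j lies below w\<close>
    define w1 where "w1 = (\<lambda>x. min (w x) (- j x))"
    have "(\<lambda>x. - w1 x) = (\<lambda>x. max (- w x) (j x))" by (auto simp: w1_def fun_eq_iff)
    then have "semiconvex (\<lambda>x. - w1 x)" using semiconvex_max[OF sw j(1)] by simp
    moreover have w1: "min (w x) (v x) \<le> w1 x" "w1 x \<le> w x" for x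
      using j(2)[rule_format, of x] unfolding w1_def by linarith+
    have "q x - M \<le> w1 x" for x
      using w1(1)[of x] w_ge[of x] bd[of x] by linarith
    moreover have "unliftable w1 v"
      unfolding unliftable_def
    proof (intro allI impI)
      fix k x
      assume k: "semiconvex k" "\<forall>x. k x \<le> max (w1 x) (v x)"
      have "k x \<le> max (w x) (v x)" for x
        using k(2)[rule_format, of x] w1(2)[of x] by linarith
      then have "k y \<le> w y" for y using uw k(1) by (auto simp: unliftable_def)
      then show "k x \<le> w1 x" using k(2)[rule_format, of x] w1[of x]
        by (smt (verit) max_def min_def)
    qed
    ultimately have "w1 \<in> S" by (simp add: S_def)
    then have "w x \<le> w1 x" by (rule w_le)
    then show "j x \<le> - w x" unfolding w1_def by linarith
  qed
  with sw sw' uw that show thesis by blast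
qed

section \<open>Displacement along a nonexpansive field\<close>

definition nonexpansive :: "('a::real_normed_vector \<Rightarrow> 'a) \<Rightarrow> bool" where
  "nonexpansive G \<longleftrightarrow> (\<forall>x y. norm (G y - G x) \<le> norm (y - x))"

definition displace :: "real \<Rightarrow> ('a::real_normed_vector \<Rightarrow> 'a) \<Rightarrow> 'a \<Rightarrow> 'a" where
  "displace t G x = x + t *\<^sub>R G x"

lemma nonexpansiveD: "nonexpansive G \<Longrightarrow> norm (G y - G x) \<le> norm (y - x)"
  by (simp add: nonexpansive_def)

lemma nonexpansive_continuous_on: "nonexpansive G \<Longrightarrow> continuous_on S G"
  by (rule lipschitz_on_continuous_on[of 1], rule lipschitz_onI) (auto simp: nonexpansive_def dist_norm)

lemma displace_continuous_on: "nonexpansive G \<Longrightarrow> continuous_on S (displace t G)"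
  unfolding displace_def by (intro continuous_intros nonexpansive_continuous_on)

lemma displace_lower_bound:
  assumes "nonexpansive G"
  shows "(1 - \<bar>t\<bar>) * norm (y - x) \<le> norm (displace t G y - displace t G x)"
proof -
  have "norm (t *\<^sub>R (G y - G x)) \<le> \<bar>t\<bar> * norm (y - x)"
    using nonexpansiveD[OF assms] by (simp add: mult_left_mono)
  moreover have eq: "displace t G y - displace t G x = (y - x) + t *\<^sub>R (G y - G x)"
    by (simp add: displace_def scaleR_diff_right)
  ultimately show ?thesis
    unfolding eq left_diff_distrib using norm_diff_ineq[of "y - x" "t *\<^sub>R (G y - G x)"] by linarith
qed

lemma displace_inj:
  assumes "nonexpansive G" "\<bar>t\<bar> < 1"
  shows "inj_on (displace t G) S"
proof (rule inj_onI)
  fix x y assume "displace t G x = displace t G y"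
  then have "(1 - \<bar>t\<bar>) * norm (y - x) \<le> 0"
    using displace_lower_bound[OF assms(1), of t y x] by simp
  then have "norm (y - x) \<le> 0" using assms(2) by (simp add: mult_le_0_iff)
  then show "x = y" by simp
qed

text \<open>A preimage of \<open>y\<close> is a fixed point of the contraction \<open>x \<mapsto> y - t G x\<close>.\<close>

lemma displace_surj:
  fixes G :: "'a::banach \<Rightarrow> 'a"
  assumes "nonexpansive G" "\<bar>t\<bar> < 1"
  obtains x where "displace t G x = y"
proof -
  have "\<exists>!x. y - t *\<^sub>R G x = x"
  proof (rule banach_fix_type[of "\<bar>t\<bar>"])
    show "\<forall>x z. dist (y - t *\<^sub>R G x) (y - t *\<^sub>R G z) \<le> \<bar>t\<bar> * dist x z"
    proof (intro allI)
      fix x z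
      have "dist (y - t *\<^sub>R G x) (y - t *\<^sub>R G z) = norm (t *\<^sub>R (G z - G x))"
        by (simp add: dist_norm scaleR_diff_right)
      also have "\<dots> \<le> \<bar>t\<bar> * norm (z - x)"
        using nonexpansiveD[OF assms(1)] by (simp add: mult_left_mono)
      finally show "dist (y - t *\<^sub>R G x) (y - t *\<^sub>R G z) \<le> \<bar>t\<bar> * dist x z"
        by (simp add: dist_norm norm_minus_commute)
    qed
  qed (use assms in auto)
  then obtain x where "y - t *\<^sub>R G x = x" by blast
  then have "displace t G x = y" by (simp add: displace_def algebra_simps)
  then show thesis by (rule that)
qed

lemma displace_image_open:
  fixes G :: "'a::euclidean_space \<Rightarrow> 'a"
  assumes "nonexpansive G" "\<bar>t\<bar> < 1" "open U"
  shows "open (displace t G ` U)"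
  using assms by (intro invariance_of_domain displace_continuous_on displace_inj)

lemma displace_image_bounded:
  fixes G :: "'a::euclidean_space \<Rightarrow> 'a"
  assumes "nonexpansive G" "bounded U"
  shows "bounded (displace t G ` U)"
proof -
  have "compact (displace t G ` closure U)"
    using assms by (intro compact_continuous_image displace_continuous_on) auto
  then show ?thesis
    by (rule bounded_subset[OF compact_imp_bounded]) (use closure_subset in blast)
qed

text \<open>Both displacements are bijections of the whole space and agree outside \<open>S\<close>, so the remaining points
  are the same for both.\<close>

lemma displace_image_eq:
  fixes F G :: "'a::banach \<Rightarrow> 'a"
  assumes "nonexpansive F" "nonexpansive G" "\<bar>t\<bar> < 1" "\<And>x. x \<notin> S \<Longrightarrow> F x = G x"
  shows "displace t F ` S = displace t G ` S"
proof -
  have bij: "bij (displace t K)" if "nonexpansive K" for K :: "'a \<Rightarrow> 'a"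
    unfolding bij_def surj_def using displace_inj[OF that assms(3)] displace_surj[OF that assms(3)]
    by metis
  have "displace t F ` (- S) = displace t G ` (- S)"
    using assms(4) by (intro image_cong) (auto simp: displace_def)
  then have "- (displace t F ` S) = - (displace t G ` S)"
    using bij_image_Compl_eq[OF bij[OF assms(1)]] bij_image_Compl_eq[OF bij[OF assms(2)]] by simp
  then show ?thesis by simp
qed

lemma displace_negligible:
  fixes G :: "'a::euclidean_space \<Rightarrow> 'a"
  assumes ne: "nonexpansive G" and S: "negligible S"
  shows "negligible (displace t G ` S)"
proof (rule negligible_locally_Lipschitz_image[OF _ S])
  fix x
  have "norm (displace t G y - displace t G x) \<le> (1 + \<bar>t\<bar>) * norm (y - x)" for y
  proof -
    have "displace t G y - displace t G x = (y - x) + t *\<^sub>R (G y - G x)"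
      by (simp add: displace_def scaleR_diff_right)
    then have "norm (displace t G y - displace t G x) \<le> norm (y - x) + \<bar>t\<bar> * norm (G y - G x)"
      by (metis norm_scaleR norm_triangle_ineq)
    moreover have "\<bar>t\<bar> * norm (G y - G x) \<le> \<bar>t\<bar> * norm (y - x)"
      by (intro mult_left_mono nonexpansiveD[OF ne]) simp
    ultimately show ?thesis unfolding distrib_right by linarith
  qed
  then show "\<exists>T B. open T \<and> x \<in> T \<and>
      (\<forall>y\<in>S \<inter> T. norm (displace t G y - displace t G x) \<le> B * norm (y - x))"
    by (intro exI[of _ UNIV] exI[of _ "1 + \<bar>t\<bar>"]) auto
qed simp

section \<open>Two-sided semiconvexity is a Lipschitz condition on the gradient\<close>

text \<open>The first condition says that at each point the graph of \<open>w\<close> is touched from both sides by parabolas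
  of opening one whose common slope is \<open>G\<close>. It makes \<open>G\<close> the gradient of \<open>w\<close>.\<close>

definition parabolic_gradient :: "('a::real_inner \<Rightarrow> real) \<Rightarrow> ('a \<Rightarrow> 'a) \<Rightarrow> bool" where
  "parabolic_gradient w G \<longleftrightarrow>
     (\<forall>x y. \<bar>w y - w x - G x \<bullet> (y - x)\<bar> \<le> (norm (y - x))\<^sup>2 / 2) \<and> nonexpansive G"

lemma semiconvex_affine: "semiconvex (\<lambda>y. c + p \<bullet> y - (norm y)\<^sup>2 / 2)"
proof -
  have "a * c + b * c = c" if "a + b = 1" for a b :: real
    using that by (simp flip: distrib_right)
  then show ?thesis
    unfolding semiconvex_def convex_on_def by (auto simp: inner_simps algebra_simps)
qed

lemma semiconvex_support:
  fixes w :: "'a::euclidean_space \<Rightarrow> real"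
  assumes "semiconvex w"
  obtains p where "\<And>y. w x + p \<bullet> (y - x) - (norm (y - x))\<^sup>2 / 2 \<le> w y"
proof -
  obtain p where p: "\<And>y. w x + (norm x)\<^sup>2 / 2 + p \<bullet> (y - x) \<le> w y + (norm y)\<^sup>2 / 2"
    using convex_on_support[of "\<lambda>x. w x + (norm x)\<^sup>2 / 2" x] assms
    unfolding semiconvex_def by blast
  have "w x + (p - x) \<bullet> (y - x) - (norm (y - x))\<^sup>2 / 2 \<le> w y" for y
    using p[of y] unfolding power2_norm_eq_inner
    by (simp add: inner_simps inner_commute[of y x] field_simps)
  then show thesis using that by blast
qed

lemma zero_if_linear_le_square:
  fixes d :: "'a::real_inner"
  assumes "\<And>h. 0 \<le> d \<bullet> h + (norm h)\<^sup>2"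
  shows "d = 0"
proof -
  have "d \<bullet> d \<le> 0"
    using assms[of "- (1/2) *\<^sub>R d"] unfolding power2_norm_eq_inner by simp
  then show ?thesis by (metis inner_gt_zero_iff not_less)
qed

text \<open>The slopes of the touching parabolas from below and above agree, because the difference of the two
  parabolas is a linear plus a quadratic function of one sign. For the Lipschitz bound, the lower
  parabola at one of the points \<open>x\<close>, \<open>y\<close> and the upper parabola at the other one are compared at
  \<open>m + e\<close> and \<open>m - e\<close>, where \<open>m\<close> is the midpoint and \<open>e\<close> is half the difference of the slopes; this
  choice of \<open>e\<close> gives the constant one exactly.\<close>

lemma parabolic_gradient_exists:
  fixes w :: "'a::euclidean_space \<Rightarrow> real"
  assumes "semiconvex w" "semiconvex (\<lambda>x. - w x)"
  obtains G where "parabolic_gradient w G"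
proof -
  have "\<exists>p. \<forall>y. \<bar>w y - w x - p \<bullet> (y - x)\<bar> \<le> (norm (y - x))\<^sup>2 / 2" for x
  proof -
    obtain p where p: "\<And>y. w x + p \<bullet> (y - x) - (norm (y - x))\<^sup>2 / 2 \<le> w y"
      using semiconvex_support[OF assms(1)] by blast
    obtain q where q: "\<And>y. - w x + q \<bullet> (y - x) - (norm (y - x))\<^sup>2 / 2 \<le> - w y"
      using semiconvex_support[OF assms(2)] by blast
    have "- (p + q) = 0"
    proof (rule zero_if_linear_le_square)
      fix h show "0 \<le> - (p + q) \<bullet> h + (norm h)\<^sup>2"
        using p[of "x + h"] q[of "x + h"] by (simp add: inner_simps)
    qed
    then have "q = - p" by (simp add: eq_neg_iff_add_eq_0 add.commute)
    have "\<bar>w y - w x - p \<bullet> (y - x)\<bar> \<le> (norm (y - x))\<^sup>2 / 2" for y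
      using p[of y] q[of y] unfolding \<open>q = - p\<close> inner_minus_left by linarith
    then show ?thesis by blast
  qed
  then obtain G where G: "\<And>x y. \<bar>w y - w x - G x \<bullet> (y - x)\<bar> \<le> (norm (y - x))\<^sup>2 / 2"
    by metis
  have "norm (G y - G x) \<le> norm (y - x)" for x y
  proof -
    define m d e where "m = (1/2) *\<^sub>R (x + y)" and "d = (1/2) *\<^sub>R (y - x)"
      and "e = (1/2) *\<^sub>R (G y - G x)"
    have x: "x = m - d" and y: "y = m + d"
      unfolding m_def d_def by (simp_all add: algebra_simps flip: scaleR_left_distrib)
    define z z' where "z = m + e" and "z' = m - e"
    have G2: "G y = G x + 2 *\<^sub>R e" unfolding e_def by simp
    have "G x \<bullet> (z' - x) + w x - G y \<bullet> (z' - y) - w y \<le> (norm (z' - y))\<^sup>2 / 2 + (norm (z' - x))\<^sup>2 / 2"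
      using G[of z' x] G[of z' y] by linarith
    moreover have "G y \<bullet> (z - y) + w y - G x \<bullet> (z - x) - w x \<le> (norm (z - y))\<^sup>2 / 2 + (norm (z - x))\<^sup>2 / 2"
      using G[of z x] G[of z y] by linarith
    ultimately have "e \<bullet> e \<le> d \<bullet> d"
      unfolding G2 unfolding x y z_def z'_def power2_norm_eq_inner
      by (simp add: inner_simps inner_commute[of d e] field_simps)
    then have "(norm (G y - G x))\<^sup>2 \<le> (norm (y - x))\<^sup>2"
      unfolding e_def d_def power2_norm_eq_inner by simp
    then show ?thesis by simp
  qed
  with G that show thesis unfolding parabolic_gradient_def nonexpansive_def by blast
qed

lemma parabolic_gradientD:
  assumes "parabolic_gradient w G"
  shows "w x + G x \<bullet> (y - x) - (norm (y - x))\<^sup>2 / 2 \<le> w y"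
    and "w y \<le> w x + G x \<bullet> (y - x) + (norm (y - x))\<^sup>2 / 2"
    and "nonexpansive G"
  using assms unfolding parabolic_gradient_def abs_le_iff
  by (smt (verit))+

lemma parabolic_gradient_minus:
  assumes "parabolic_gradient w G"
  shows "parabolic_gradient (\<lambda>x. - w x) (\<lambda>x. - G x)"
proof -
  have "\<bar>- w y - - w x - - G x \<bullet> (y - x)\<bar> = \<bar>w y - w x - G x \<bullet> (y - x)\<bar>" for x y
    by (simp add: inner_simps abs_if)
  moreover have "norm (- G y - - G x) = norm (G y - G x)" for x y
    by (metis minus_diff_minus norm_minus_cancel)
  ultimately show ?thesis using assms unfolding parabolic_gradient_def nonexpansive_def by simp
qed

lemma parabolic_gradient_has_derivative:
  assumes "parabolic_gradient w G"
  shows "(w has_derivative (\<lambda>h. G x \<bullet> h)) (at x)"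
proof (rule has_derivativeI_sandwich[of 1])
  fix y assume "y \<noteq> x" "dist y x < 1"
  have "norm (w y - w x - G x \<bullet> (y - x)) \<le> (norm (y - x))\<^sup>2 / 2"
    using assms by (simp add: parabolic_gradient_def)
  then show "norm ((w y - w x) - G x \<bullet> (y - x)) / norm (y - x) \<le> norm (y - x) / 2"
    using \<open>y \<noteq> x\<close> by (simp add: field_simps power2_eq_square)
next
  have "((\<lambda>y. norm (y - x) / 2) \<longlongrightarrow> norm (x - x) / 2) (at x)"
    by (intro tendsto_intros) simp
  then show "((\<lambda>y. norm (y - x) / 2) \<longlongrightarrow> 0) (at x)" by simp
qed (auto intro: bounded_linear_intros)

lemma parabolic_gradient_continuous:
  assumes "parabolic_gradient w G"
  shows "continuous_on S w" "continuous_on S G"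
proof -
  show "continuous_on S w"
    using parabolic_gradient_has_derivative[OF assms] has_derivative_continuous
    by (metis continuous_at_imp_continuous_on)
  show "continuous_on S G"
    by (rule nonexpansive_continuous_on[OF parabolic_gradientD(3)[OF assms]])
qed

text \<open>The function \<open>D\<close> is \<open>w + \<bar>x\<bar>\<^sup>2 / 2\<close> minus its supporting affine function at \<open>x0\<close>, and the points where
  \<open>y + G y = x0 + G x0\<close> are its zeros. If \<open>x0\<close> were the only zero, then \<open>D\<close> would be bounded below by a
  positive constant outside every small ball around \<open>x0\<close>, so the supporting function could be raised
  a little and still stay below \<open>D\<close> outside the ball and, since \<open>w < v\<close>, below \<open>v\<close> inside it. The
  maximum with \<open>w\<close> would lift \<open>w\<close> at \<open>x0\<close>.\<close>

lemma unliftable_fibre_nontrivial: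
  fixes w v :: "'a::euclidean_space \<Rightarrow> real"
  assumes sc: "semiconvex w" and pg: "parabolic_gradient w G" and un: "unliftable w v"
    and cv: "continuous_on UNIV v" and lt: "w x0 < v x0"
  obtains x' where "x' \<noteq> x0" "x' + G x' = x0 + G x0"
proof (rule ccontr)
  assume "\<not> thesis"
  with that have no: "x' = x0" if "x' + G x' = x0 + G x0" for x' using that by blast
  define p where "p = x0 + G x0"
  define D where "D = (\<lambda>y. w y + (norm y)\<^sup>2 / 2 - (w x0 + (norm x0)\<^sup>2 / 2 + p \<bullet> (y - x0)))"
  have D0: "D y \<ge> 0" for y
    using parabolic_gradientD(1)[OF pg, of x0 y] unfolding D_def p_def power2_norm_eq_inner
    by (simp add: inner_simps inner_commute[of y x0] field_simps)
  have Dx0: "D x0 = 0" unfolding D_def by simp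
  have Dpos: "D y > 0" if "y \<noteq> x0" for y
  proof (rule ccontr)
    assume "\<not> 0 < D y"
    then have Dy: "D y = 0" using D0[of y] by simp
    have "y + G y - p = 0"
    proof (rule zero_if_linear_le_square)
      fix h
      show "0 \<le> (y + G y - p) \<bullet> h + (norm h)\<^sup>2"
        using D0[of "y + h"] Dy parabolic_gradientD(2)[OF pg, of "y + h" y]
        unfolding D_def power2_norm_eq_inner
        by (simp add: inner_simps inner_commute[of h y] field_simps)
    qed
    then show False using no[of y] that by (simp add: p_def)
  qed
  have cw: "continuous_on S w" for S by (rule parabolic_gradient_continuous[OF pg])
  have cD: "continuous_on S D" for S
    unfolding D_def by (intro continuous_intros cw) auto
  define \<eta> where "\<eta> = (v x0 - w x0) / 2"
  have "\<eta> > 0" using lt by (simp add: \<eta>_def)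
  have "open {y. w y + \<eta> < v y}"
    by (intro open_Collect_less continuous_intros cw cv)
  moreover have "x0 \<in> {y. w y + \<eta> < v y}"
    using lt by (simp add: \<eta>_def field_simps)
  ultimately obtain r where r: "r > 0" "cball x0 r \<subseteq> {y. w y + \<eta> < v y}"
    by (meson open_contains_cball)
  have "sphere x0 r \<noteq> {}" using r by simp
  then obtain z0 where z0: "z0 \<in> sphere x0 r" "\<And>z. z \<in> sphere x0 r \<Longrightarrow> D z0 \<le> D z"
    using continuous_attains_inf[OF compact_sphere _ cD, of x0 r] by blast
  have "D z0 > 0" using Dpos z0(1) r(1) by (metis dist_self mem_sphere order_less_irrefl)
  define c where "c = min \<eta> (D z0)"
  have c: "c > 0" "c \<le> \<eta>" "c \<le> D z0" using \<open>\<eta> > 0\<close> \<open>D z0 > 0\<close> by (auto simp: c_def)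
  have Dout: "D z0 \<le> D y" if "y \<notin> cball x0 r" for y
  proof -
    define l where "l = r / norm (y - x0)"
    have n: "norm (y - x0) > r" using that by (simp add: dist_norm norm_minus_commute)
    then have l: "0 \<le> l" "0 \<le> 1 - l" "l + (1 - l) = 1" using r
      by (auto simp: l_def divide_le_eq)
    define z where "z = l *\<^sub>R y + (1 - l) *\<^sub>R x0"
    have zx: "z - x0 = l *\<^sub>R (y - x0)" unfolding z_def by (simp add: algebra_simps)
    moreover have "norm (y - x0) \<noteq> 0" using n r by linarith
    ultimately have "z \<in> sphere x0 r"
      using r by (simp add: dist_norm norm_minus_commute[of x0] l_def)
    then have "D z0 \<le> D z" by (rule z0)
    also have "D z \<le> l * D y + (1 - l) * D x0"
    proof -
      have "w z + (norm z)\<^sup>2 / 2 \<le> l * (w y + (norm y)\<^sup>2 / 2) + (1 - l) * (w x0 + (norm x0)\<^sup>2 / 2)"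
        using sc l unfolding semiconvex_def convex_on_def z_def by blast
      moreover have "p \<bullet> (z - x0) = l * (p \<bullet> (y - x0))" unfolding zx by simp
      ultimately show ?thesis unfolding D_def by (simp add: field_simps)
    qed
    also have "\<dots> \<le> D y" using Dx0 l D0[of y] by (simp add: mult_left_le_one_le)
    finally show ?thesis .
  qed
  \<comment> \<open>the supporting function of D, raised by c, in terms of w itself\<close>
  define k where "k = (\<lambda>y. max (w y) ((w x0 + (norm x0)\<^sup>2 / 2 - p \<bullet> x0 + c) + p \<bullet> y - (norm y)\<^sup>2 / 2))"
  have "semiconvex k"
    unfolding k_def by (intro semiconvex_max sc semiconvex_affine)
  have keq: "k y = max (w y) (w y + c - D y)" for y
    unfolding k_def D_def by (simp add: inner_simps algebra_simps)
  have "k y \<le> max (w y) (v y)" for y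
  proof (cases "y \<in> cball x0 r")
    case True
    then have "w y + \<eta> < v y" using r by blast
    then show ?thesis using c D0[of y] unfolding keq by linarith
  next
    case False
    then show ?thesis using c Dout[OF False] unfolding keq by linarith
  qed
  with un \<open>semiconvex k\<close> have "k x0 \<le> w x0" unfolding unliftable_def by blast
  then show False using c Dx0 unfolding keq by simp
qed

text \<open>On a fibre of \<open>x + G x\<close> the map \<open>G\<close> is an isometry. The value at a point \<open>z\<close> of the segment is at
  most as far from the values at the endpoints as \<open>z\<close> is from the endpoints, and in a Euclidean space
  only one point has this property.\<close>

lemma nonexpansive_fibre_segment:
  fixes G :: "'a::real_inner \<Rightarrow> 'a"
  assumes G: "nonexpansive G"
    and p: "x + G x = p" "y + G y = p" and z: "z = a *\<^sub>R x + b *\<^sub>R y" "0 \<le> a" "0 \<le> b" "a + b = 1"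
  shows "z + G z = p"
proof -
  define q where "q = z + G z - p"
  define e where "e = x - y"
  have b: "b = 1 - a" using z by simp
  have Gx: "G x = p - x" "G y = p - y" using p by (auto simp: algebra_simps)
  have zx: "z - x = - b *\<^sub>R e" "z - y = a *\<^sub>R e"
    unfolding z(1) e_def b by (simp_all add: algebra_simps)
  have "G z - G x = q - (z - x)" "G z - G y = q - (z - y)"
    unfolding q_def Gx by (simp_all add: algebra_simps)
  with nonexpansiveD[OF G, of z x] nonexpansiveD[OF G, of z y] have le: "norm (q - (z - x)) \<le> norm (z - x)" "norm (q - (z - y)) \<le> norm (z - y)"
    by simp_all
  have 1: "q \<bullet> q + 2 * b * (q \<bullet> e) \<le> 0"
    using le(1) unfolding zx norm_le
    by (simp add: inner_simps inner_commute[of e q] algebra_simps)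
  have 2: "q \<bullet> q - 2 * a * (q \<bullet> e) \<le> 0"
    using le(2) unfolding zx norm_le
    by (simp add: inner_simps inner_commute[of e q] algebra_simps)
  have "q \<bullet> q = a * (q \<bullet> q + 2 * b * (q \<bullet> e)) + b * (q \<bullet> q - 2 * a * (q \<bullet> e))"
    unfolding b by (simp add: algebra_simps)
  also have "\<dots> \<le> 0" using mult_left_mono[OF 1 z(2)] mult_left_mono[OF 2 z(3)] by simp
  finally have "q = 0" by (metis inner_gt_zero_iff not_less)
  then show ?thesis by (simp add: q_def)
qed

text \<open>Every fibre over this image contains a nontrivial segment, which meets one of the countably many
  hyperplanes \<open>x\<^sub>i = c\<close> with rational \<open>c\<close>. So the image is covered by Lipschitz images of hyperplanes.\<close>

lemma negligible_unliftable_image: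
  fixes w v :: "'a::euclidean_space \<Rightarrow> real"
  assumes "semiconvex w" and pg: "parabolic_gradient w G" and "unliftable w v"
    and "continuous_on UNIV v"
  shows "negligible (displace 1 G ` {x. w x < v x})"
proof -
  let ?F = "displace 1 G"
  let ?U = "\<Union>i\<in>Basis. \<Union>c\<in>\<rat>. ?F ` {x. i \<bullet> x = c}"
  have "negligible (?F ` {x. i \<bullet> x = c})" if "i \<in> Basis" for i c
    by (rule displace_negligible[OF parabolic_gradientD(3)[OF pg]], rule negligible_hyperplane)
      (use that in auto)
  then have "negligible (\<Union>c\<in>\<rat>. ?F ` {x. i \<bullet> x = c})" if "i \<in> Basis" for i
    using that by (intro negligible_countable_Union countable_image countable_rat) auto
  then have "negligible ?U"
    by (intro negligible_Union) auto
  moreover have "?F ` {x. w x < v x} \<subseteq> ?U"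
  proof clarify
    fix x assume "w x < v x"
    then obtain x' where x': "x' \<noteq> x" "x' + G x' = x + G x"
      using unliftable_fibre_nontrivial[OF assms] by blast
    then obtain i where i: "i \<in> Basis" "x \<bullet> i \<noteq> x' \<bullet> i" using euclidean_eqI by blast
    obtain c where c: "c \<in> \<rat>" "min (x \<bullet> i) (x' \<bullet> i) < c" "c < max (x \<bullet> i) (x' \<bullet> i)"
      using Rats_dense_in_real[of "min (x \<bullet> i) (x' \<bullet> i)" "max (x \<bullet> i) (x' \<bullet> i)"] i by force
    define l where "l = (c - x' \<bullet> i) / (x \<bullet> i - x' \<bullet> i)"
    have l': "1 - l = (x \<bullet> i - c) / (x \<bullet> i - x' \<bullet> i)"
      using i(2) unfolding l_def by (simp add: diff_divide_distrib[symmetric] eq_divide_eq divide_eq_eq) (simp add: field_simps)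
    have l: "0 \<le> l" "0 \<le> 1 - l"
      unfolding l' unfolding l_def using c(2,3) i(2)
      by (auto simp: zero_le_divide_iff min_def max_def split: if_splits)
    define z where "z = l *\<^sub>R x + (1 - l) *\<^sub>R x'"
    have "?F z = ?F x"
      using nonexpansive_fibre_segment[OF parabolic_gradientD(3)[OF pg] refl x'(2) z_def l]
      by (simp add: displace_def)
    moreover have "i \<bullet> z = c"
    proof -
      have "i \<bullet> z = x' \<bullet> i + l * (x \<bullet> i - x' \<bullet> i)"
        unfolding z_def by (simp add: inner_simps inner_commute[of i] algebra_simps)
      then show ?thesis using i by (simp add: l_def)
    qed
    ultimately show "?F x \<in> ?U" using i(1) c(1) by (metis (mono_tags, lifting) UN_I image_eqI mem_Collect_eq)
  qed
  ultimately show ?thesis by (rule negligible_subset)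
qed

section \<open>Areas of displaced sets are quadratic in the displacement\<close>

lemma has_integral_one:
  "S \<in> lmeasurable \<Longrightarrow> ((\<lambda>x. 1 :: real) has_integral measure lebesgue S) S"
  by (simp add: has_integral_iff lmeasurable_iff_integrable_on lmeasure_integral)

lemma det_identity_plus:
  fixes B :: "real^2^2"
  shows "det (mat 1 + t *\<^sub>R B) = 1 + t * trace B + t\<^sup>2 * det B"
  by (simp add: det_2 trace_def sum_2 mat_def power2_eq_square algebra_simps)

lemma identity_plus_matrix_vector_mult:
  fixes B :: "real^2^2"
  shows "(mat 1 + t *\<^sub>R B) *v h = h + t *\<^sub>R (B *v h)"
  by (simp add: vec_eq_iff matrix_vector_mult_def sum_2 mat_def forall_2 algebra_simps)

lemma contraction_entry_le:
  fixes B :: "real^2^2"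
  assumes B: "\<And>h. norm (B *v h) \<le> norm h"
  shows "\<bar>B $ i $ j\<bar> \<le> 1"
proof -
  have "B $ i $ j = (B *v axis j 1) $ i"
    by (simp add: matrix_vector_mul_component axis_def inner_vec_def if_distrib cong: if_cong)
  also have "\<bar>\<dots>\<bar> \<le> norm (B *v axis j 1)" by (rule component_le_norm_cart)
  also have "\<dots> \<le> 1" using B[of "axis j 1"] by simp
  finally show ?thesis by simp
qed

lemma contraction_trace_det_le:
  fixes B :: "real^2^2"
  assumes B: "\<And>h. norm (B *v h) \<le> norm h"
  shows "\<bar>trace B\<bar> \<le> 2" "\<bar>det B\<bar> \<le> 2"
proof -
  note e = contraction_entry_le[OF B]
  show "\<bar>trace B\<bar> \<le> 2" using e[of 1 1] e[of 2 2] by (simp add: trace_def sum_2)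
  have "\<bar>B$1$1 * B$2$2\<bar> \<le> 1 * 1" "\<bar>B$1$2 * B$2$1\<bar> \<le> 1 * 1"
    unfolding abs_mult by (intro mult_mono e; simp)+
  then show "\<bar>det B\<bar> \<le> 2" unfolding det_2 by linarith
qed

text \<open>The determinant of \<open>I + s t B\<close> is \<open>1\<close> at \<open>s = 0\<close> and cannot vanish for \<open>s\<close> in \<open>[0, 1]\<close>, since
  \<open>\<bar>s t\<bar> < 1\<close> and \<open>B\<close> is a contraction.\<close>

lemma contraction_det_pos:
  fixes B :: "real^2^2"
  assumes B: "\<And>h. norm (B *v h) \<le> norm h" and t: "\<bar>t\<bar> < 1"
  shows "0 < 1 + t * trace B + t\<^sup>2 * det B"
proof (rule ccontr)
  define f where "f = (\<lambda>s. 1 + (s * t) * trace B + (s * t)\<^sup>2 * det B)"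
  assume "\<not> ?thesis"
  then have "f 1 \<le> 0" by (simp add: f_def)
  moreover have "f 0 \<ge> 0" by (simp add: f_def)
  moreover have "continuous_on {0..1} f" unfolding f_def by (intro continuous_intros)
  ultimately obtain s where s: "0 \<le> s" "s \<le> 1" "f s = 0"
    using IVT2'[of f 1 0 0] by auto
  then have "det (mat 1 + (s * t) *\<^sub>R B) = 0" by (simp add: det_identity_plus f_def)
  then have "\<not> invertible (mat 1 + (s * t) *\<^sub>R B)" by (simp add: invertible_det_nz)
  then obtain h where h: "h \<noteq> 0" "(mat 1 + (s * t) *\<^sub>R B) *v h = 0"
    by (metis invertible_left_inverse matrix_left_invertible_ker)
  then have "h = - ((s * t) *\<^sub>R (B *v h))"
    unfolding identity_plus_matrix_vector_mult by (simp add: eq_neg_iff_add_eq_0)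
  then have "norm h = \<bar>s * t\<bar> * norm (B *v h)" by (metis norm_minus_cancel norm_scaleR)
  also have "\<dots> \<le> \<bar>s * t\<bar> * norm h" by (simp add: B mult_left_mono)
  finally have "1 \<le> \<bar>s * t\<bar>" using h(1) by simp
  moreover have "\<bar>s * t\<bar> \<le> 1 * \<bar>t\<bar>" unfolding abs_mult using s by (intro mult_right_mono) auto
  ultimately show False using t by simp
qed

lemma nonexpansive_derivative_contraction:
  assumes "nonexpansive G" "(G has_derivative D) (at x)"
  shows "norm (D h) \<le> norm h"
proof -
  interpret D: bounded_linear D using assms(2) by (rule has_derivative_bounded_linear)
  have le: "norm (D h) \<le> norm h + e" if "e > 0" "h \<noteq> 0" for e
  proof -
    define e' where "e' = e / norm h"
    have "e' > 0" using that by (simp add: e'_def)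
    then obtain d where d: "d > 0"
      "\<And>y. norm (y - x) < d \<Longrightarrow> norm (G y - G x - D (y - x)) \<le> e' * norm (y - x)"
      using assms(2) unfolding has_derivative_at_alt by blast
    define s where "s = d / (2 * norm h)"
    have s: "s > 0" "norm (s *\<^sub>R h) < d" using d that by (simp_all add: s_def)
    have "norm (D (s *\<^sub>R h)) \<le> norm (G (x + s *\<^sub>R h) - G x) + norm (G (x + s *\<^sub>R h) - G x - D (s *\<^sub>R h))"
      using norm_triangle_ineq4[of "G (x + s *\<^sub>R h) - G x" "G (x + s *\<^sub>R h) - G x - D (s *\<^sub>R h)"] by simp
    also have "\<dots> \<le> norm (s *\<^sub>R h) + e' * norm (s *\<^sub>R h)"
      using nonexpansiveD[OF assms(1), of "x + s *\<^sub>R h" x] d(2)[of "x + s *\<^sub>R h"] s(2)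
      by (intro add_mono) simp_all
    finally have "s * norm (D h) \<le> s * (norm h + e)"
      using s(1) that by (simp add: D.scaleR e'_def algebra_simps)
    then show ?thesis using s(1) by simp
  qed
  show ?thesis
  proof (cases "h = 0")
    case False
    with le show ?thesis by (meson field_le_epsilon)
  qed (simp add: D.zero)
qed

lemma displace_has_derivative:
  fixes G :: "real^2 \<Rightarrow> real^2"
  assumes "(G has_derivative (\<lambda>h. B *v h)) F"
  shows "(displace t G has_derivative (\<lambda>h. (mat 1 + t *\<^sub>R B) *v h)) F"
  unfolding displace_def[abs_def] identity_plus_matrix_vector_mult
  by (rule derivative_eq_intros assms refl)+

text \<open>The change of variables formula, with the positive Jacobian \<open>det (I + t B) = 1 + t tr B + t\<^sup>2 det B\<close>.
  Integrability of the trace and of the determinant follows from that of the Jacobian at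
  \<open>t = 1/2\<close> and \<open>t = -1/2\<close>, which in turn holds because the images are bounded measurable sets.\<close>

lemma displace_area_differentiable:
  fixes G :: "real^2 \<Rightarrow> real^2"
  assumes ne: "nonexpansive G" and E: "E \<in> sets lebesgue" "bounded E"
    and der: "\<And>x. x \<in> E \<Longrightarrow> (G has_derivative (\<lambda>h. B x *v h)) (at x)"
  shows "(\<lambda>x. trace (B x)) integrable_on E" and "(\<lambda>x. det (B x)) integrable_on E"
    and "\<And>t. \<bar>t\<bar> < 1 \<Longrightarrow> displace t G ` E \<in> lmeasurable"
    and "\<And>t. \<bar>t\<bar> < 1 \<Longrightarrow> measure lebesgue (displace t G ` E) =
      measure lebesgue E + t * integral E (\<lambda>x. trace (B x)) + t\<^sup>2 * integral E (\<lambda>x. det (B x))"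
proof -
  have contr: "norm (B x *v h) \<le> norm h" if "x \<in> E" for x h
    using nonexpansive_derivative_contraction[OF ne der[OF that]] .
  have 1: "displace t G ` E \<in> lmeasurable \<and>
    ((\<lambda>x. 1 + t * trace (B x) + t\<^sup>2 * det (B x)) has_integral measure lebesgue (displace t G ` E)) E"
    if t: "\<bar>t\<bar> < 1" for t
  proof -
    have der': "(displace t G has_derivative (\<lambda>h. (mat 1 + t *\<^sub>R B x) *v h)) (at x within E)"
      if "x \<in> E" for x
      by (rule has_derivative_at_withinI[OF displace_has_derivative[OF der[OF that]]])
    then have "displace t G differentiable_on E"
      unfolding differentiable_on_def differentiable_def by blast
    then have "displace t G ` E \<in> sets lebesgue"
      using E by (intro differentiable_image_in_sets_lebesgue) auto
    then have lm: "displace t G ` E \<in> lmeasurable"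
      using displace_image_bounded[OF ne E(2)] by (intro bounded_set_imp_lmeasurable)
    then have "((\<lambda>x. \<bar>det (matrix (\<lambda>h. (mat 1 + t *\<^sub>R B x) *v h))\<bar>) has_integral
        measure lebesgue (displace t G ` E)) E"
      using has_measure_differentiable_image[OF E(1) der' displace_inj[OF ne t]] by blast
    then have "((\<lambda>x. 1 + t * trace (B x) + t\<^sup>2 * det (B x)) has_integral
        measure lebesgue (displace t G ` E)) E"
    proof (rule has_integral_eq[rotated])
      fix x assume "x \<in> E"
      show "\<bar>det (matrix (\<lambda>h. (mat 1 + t *\<^sub>R B x) *v h))\<bar> = 1 + t * trace (B x) + t\<^sup>2 * det (B x)"
        unfolding matrix_of_matrix_vector_mul det_identity_plus
        using contraction_det_pos[OF contr[OF \<open>x \<in> E\<close>] t] by simp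
    qed
    with lm show ?thesis by blast
  qed
  have Em: "((\<lambda>x. 1) has_integral measure lebesgue E) E"
    using bounded_set_imp_lmeasurable[OF E(2,1)] by (rule has_integral_one)
  define P M where "P = measure lebesgue (displace (1/2) G ` E)"
    and "M = measure lebesgue (displace (- (1/2)) G ` E)"
  have P: "((\<lambda>x. 1 + trace (B x) / 2 + det (B x) / 4) has_integral P) E"
    and M: "((\<lambda>x. 1 - trace (B x) / 2 + det (B x) / 4) has_integral M) E"
    using 1[of "1/2"] 1[of "- (1/2)"] by (simp_all add: P_def M_def power2_eq_square)
  have T: "((\<lambda>x. trace (B x)) has_integral (P - M)) E"
    using has_integral_diff[OF P M] by simp
  have "((\<lambda>x. 2 * ((1 + trace (B x) / 2 + det (B x) / 4) + (1 - trace (B x) / 2 + det (B x) / 4)) - 4 * 1)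
      has_integral (2 * (P + M) - 4 * measure lebesgue E)) E"
    by (intro has_integral_diff has_integral_mult_right has_integral_add P M Em)
  then have D: "((\<lambda>x. det (B x)) has_integral (2 * (P + M) - 4 * measure lebesgue E)) E"
    by (simp add: algebra_simps)
  show "(\<lambda>x. trace (B x)) integrable_on E" "(\<lambda>x. det (B x)) integrable_on E"
    using T D by blast+
  fix t :: real assume t: "\<bar>t\<bar> < 1"
  then show "displace t G ` E \<in> lmeasurable" using 1 by blast
  have "((\<lambda>x. 1 + t * trace (B x) + t\<^sup>2 * det (B x)) has_integral
     (measure lebesgue E + t * integral E (\<lambda>x. trace (B x)) + t\<^sup>2 * integral E (\<lambda>x. det (B x)))) E"
    using T D by (intro has_integral_add has_integral_mult_right Em) (simp_all add: integral_unique)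
  then show "measure lebesgue (displace t G ` E) =
      measure lebesgue E + t * integral E (\<lambda>x. trace (B x)) + t\<^sup>2 * integral E (\<lambda>x. det (B x))"
    using 1[OF t] has_integral_unique by blast
qed

section \<open>Smoothing a nonexpansive field\<close>

lemma square_of_positive_part_has_derivative:
  "((\<lambda>r. (max 0 r)\<^sup>2) has_real_derivative 2 * max 0 r) (at r)"
proof (cases "r = 0")
  case True
  have "((\<lambda>h. ((max 0 (0 + h))\<^sup>2 - (max 0 0)\<^sup>2) / h) \<longlongrightarrow> 0) (at (0::real))"
  proof (rule Lim_null_comparison)
    show "\<forall>\<^sub>F h in at (0::real). norm (((max 0 (0 + h))\<^sup>2 - (max 0 0)\<^sup>2) / h) \<le> \<bar>h\<bar>"
      by (intro always_eventually allI) (auto simp: max_def power2_eq_square)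
    show "((\<lambda>h. \<bar>h\<bar>) \<longlongrightarrow> 0) (at (0::real))"
      by (rule tendsto_rabs_zero[OF tendsto_ident_at])
  qed
  then show ?thesis using True by (simp add: DERIV_def)
next
  case False
  show ?thesis
  proof (cases "r > 0")
    case True
    have "((\<lambda>r. r\<^sup>2) has_real_derivative 2 * max 0 r) (at r)"
      using True by (auto intro!: derivative_eq_intros)
    then show ?thesis
      by (rule has_field_derivative_transform_within_open[of _ _ _ "{0<..}"]) (use True in auto)
  next
    case neg: False
    have "((\<lambda>r. 0) has_real_derivative 2 * max 0 r) (at r)"
      using neg by (auto intro!: derivative_eq_intros)
    then show ?thesis
      by (rule has_field_derivative_transform_within_open[of _ _ _ "{..<0}"]) (use neg False in auto)
  qed
qed

lemma integrable_continuous_cball_support: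
  fixes f :: "'a::euclidean_space \<Rightarrow> 'b::euclidean_space"
  assumes "continuous_on UNIV f" "\<And>x. x \<notin> cball c r \<Longrightarrow> f x = 0"
  shows "integrable lborel f"
proof -
  have "integrable lborel (\<lambda>x. indicator (cball c r) x *\<^sub>R f x)"
    using assms(1) by (intro borel_integrable_compact) (auto intro: continuous_on_subset)
  moreover have "(\<lambda>x. indicator (cball c r) x *\<^sub>R f x) = f"
    using assms(2) by (auto simp: fun_eq_iff indicator_def)
  ultimately show ?thesis by simp
qed

lemma lborel_integral_shift:
  fixes f :: "'a::euclidean_space \<Rightarrow> 'b::euclidean_space"
  assumes "f \<in> borel_measurable borel"
  shows "(\<integral>z. f (x + z) \<partial>lborel) = (\<integral>z. f z \<partial>lborel)"
proof -
  have "(\<integral>z. f z \<partial>lborel) = (\<integral>z. f z \<partial>distr lborel borel ((+) x))"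
    by (simp add: lborel_distr_plus)
  also have "\<dots> = (\<integral>z. f (x + z) \<partial>lborel)"
    using assms by (subst integral_distr) auto
  finally show ?thesis by simp
qed

text \<open>Convolution with a continuously differentiable kernel of support in the ball of radius \<open>e\<close>, here
  \<open>(max 0 (e\<^sup>2 - \<bar>z\<bar>\<^sup>2))\<^sup>2\<close>. Averages of translates of \<open>G\<close> inherit the Lipschitz constant.\<close>

lemma nonexpansive_smoothing:
  fixes G :: "'a::euclidean_space \<Rightarrow> 'a"
  assumes ne: "nonexpansive G" and e: "e > 0"
  obtains F where "nonexpansive F" "\<And>x. norm (F x - G x) \<le> e" "\<And>x. F differentiable (at x)"
proof -
  define m k where "m = (\<lambda>z::'a. max 0 (e\<^sup>2 - z \<bullet> z))" and "k = (\<lambda>z. (m z)\<^sup>2)"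
  have contm: "continuous_on S (\<lambda>z. m (f z))" if "continuous_on S f" for f :: "'b::t2_space \<Rightarrow> 'a" and S
    unfolding m_def by (intro continuous_intros that)
  have contk: "continuous_on S (\<lambda>z. k (f z))" if "continuous_on S f" for f :: "'b::t2_space \<Rightarrow> 'a" and S
    unfolding k_def by (intro continuous_intros contm that)
  have contG: "continuous_on S (\<lambda>z. G (f z))" if "continuous_on S f" for f :: "'b::t2_space \<Rightarrow> 'a" and S
    using continuous_on_compose2[OF nonexpansive_continuous_on[OF ne] that, of UNIV] by simp
  have m0: "m z = 0" if "z \<notin> cball 0 e" for z
  proof -
    have "e\<^sup>2 \<le> (norm z)\<^sup>2" using that e by (intro power_mono) auto
    then show ?thesis by (simp add: m_def power2_norm_eq_inner)
  qed
  have k0: "k z = 0" if "z \<notin> cball 0 e" for z using m0[OF that] by (simp add: k_def)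
  have k_nonneg: "k z \<ge> 0" for z by (simp add: k_def)
  have ik: "integrable lborel k"
    by (rule integrable_continuous_cball_support[of _ 0 e]) (use contk[of UNIV "\<lambda>z. z"] k0 in auto)
  define c where "c = (\<integral>z. k z \<partial>lborel)"
  have ikH: "integrable lborel (\<lambda>z. k z *\<^sub>R H z)" if "continuous_on UNIV H" for H :: "'a \<Rightarrow> 'a"
    by (rule integrable_continuous_cball_support[of _ 0 e])
      (use contk[of UNIV "\<lambda>z. z"] k0 that in \<open>auto intro!: continuous_intros\<close>)
  have kbound: "norm (\<integral>z. k z *\<^sub>R H z \<partial>lborel) \<le> c * M"
    if H: "continuous_on UNIV H" "\<And>z. z \<in> cball 0 e \<Longrightarrow> norm (H z) \<le> M" for H :: "'a \<Rightarrow> 'a" and M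
  proof -
    have "norm (\<integral>z. k z *\<^sub>R H z \<partial>lborel) \<le> (\<integral>z. norm (k z *\<^sub>R H z) \<partial>lborel)"
      by (rule integral_norm_bound)
    also have "\<dots> \<le> (\<integral>z. k z * M \<partial>lborel)"
    proof (rule integral_mono)
      show "integrable lborel (\<lambda>z. norm (k z *\<^sub>R H z))" using ikH[OF H(1)] by (rule integrable_norm)
      show "integrable lborel (\<lambda>z. k z * M)" using ik by simp
      show "norm (k z *\<^sub>R H z) \<le> k z * M" for z
        using H(2)[of z] k0[of z] k_nonneg[of z] by (cases "z \<in> cball 0 e") (auto intro: mult_left_mono)
    qed
    also have "\<dots> = c * M" by (simp add: c_def)
    finally show ?thesis .
  qed
  have "c > 0"
  proof -
    have "(\<integral>z. indicator (ball (0::'a) (e/2)) z * (3 * e\<^sup>2 / 4)\<^sup>2 \<partial>lborel) \<le> c"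
      unfolding c_def
    proof (rule integral_mono[OF _ ik])
      show "integrable lborel (\<lambda>z::'a. indicator (ball 0 (e/2)) z * (3 * e\<^sup>2 / 4)\<^sup>2)"
        by (intro integrable_mult_left integrable_real_indicator) (use emeasure_lborel_ball_finite[of "0::'a" "e/2"] in \<open>simp_all\<close>)
      fix z :: 'a
      show "indicator (ball 0 (e/2)) z * (3 * e\<^sup>2 / 4)\<^sup>2 \<le> k z"
      proof (cases "z \<in> ball 0 (e/2)")
        case True
        then have "(norm z)\<^sup>2 \<le> (e/2)\<^sup>2" by (intro power_mono) auto
        then have "3 * e\<^sup>2 / 4 \<le> e\<^sup>2 - z \<bullet> z" by (simp add: power2_norm_eq_inner power_divide)
        then have "3 * e\<^sup>2 / 4 \<le> m z" unfolding m_def by linarith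
        then have "(3 * e\<^sup>2 / 4)\<^sup>2 \<le> (m z)\<^sup>2" by (intro power_mono) auto
        then show ?thesis using True by (simp add: k_def)
      qed (simp add: k_def)
    qed
    moreover have "(\<integral>z. indicator (ball (0::'a) (e/2)) z * (3 * e\<^sup>2 / 4)\<^sup>2 \<partial>lborel) =
        measure lborel (ball (0::'a) (e/2)) * (3 * e\<^sup>2 / 4)\<^sup>2"
      by simp
    moreover have "measure lborel (ball (0::'a) (e/2)) > 0" using e by (simp add: content_ball_pos)
    ultimately show ?thesis using e by (smt (verit) mult_pos_pos zero_less_power divide_pos_pos zero_less_power2)
  qed
  define F where "F = (\<lambda>x. (1 / c) *\<^sub>R (\<integral>z. k z *\<^sub>R G (x + z) \<partial>lborel))"
  have iG: "integrable lborel (\<lambda>z. k z *\<^sub>R G (x + z))" for x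
    by (intro ikH contG continuous_intros)
  have F_bound: "norm (F x - y) \<le> M"
    if "\<And>z. z \<in> cball 0 e \<Longrightarrow> norm (G (x + z) - y) \<le> M" for x y M
  proof -
    have "F x - y = (1 / c) *\<^sub>R (\<integral>z. k z *\<^sub>R (G (x + z) - y) \<partial>lborel)"
      unfolding F_def scaleR_diff_right using iG[of x] ik \<open>c > 0\<close>
      by (subst Bochner_Integration.integral_diff) (auto simp: c_def[symmetric] scaleR_diff_right)
    also have "norm \<dots> \<le> (1 / c) * (c * M)"
      unfolding norm_scaleR using \<open>c > 0\<close> that
      by (intro mult_mono kbound continuous_intros contG) auto
    finally show ?thesis using \<open>c > 0\<close> by simp
  qed
  have F_ne: "nonexpansive F"
    unfolding nonexpansive_def
  proof (intro allI)
    fix x y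
    have "F y - F x = (1 / c) *\<^sub>R (\<integral>z. k z *\<^sub>R (G (y + z) - G (x + z)) \<partial>lborel)"
      unfolding F_def scaleR_diff_right using iG
      by (subst Bochner_Integration.integral_diff) (auto simp: scaleR_diff_right)
    also have "norm \<dots> \<le> (1 / c) * (c * norm (y - x))"
      unfolding norm_scaleR using \<open>c > 0\<close> nonexpansiveD[OF ne]
      by (intro mult_mono kbound continuous_intros contG)
        (auto intro: order_trans[OF nonexpansiveD[OF ne]])
    finally show "norm (F y - F x) \<le> norm (y - x)" using \<open>c > 0\<close> by simp
  qed
  have F_near: "norm (F x - G x) \<le> e" for x
  proof (rule F_bound)
    fix z :: 'a assume "z \<in> cball 0 e"
    then show "norm (G (x + z) - G x) \<le> e" using nonexpansiveD[OF ne, of "x + z" x] by simp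
  qed
  have F_diff: "F differentiable (at x0)" for x0
  proof -
    \<comment> \<open>for x near x0 the kernel lives in one fixed box, so one can differentiate under the integral\<close>
    obtain a where a: "cball x0 (1 + e) \<subseteq> cbox (-a) a"
      using bounded_subset_cbox_symmetric[OF bounded_cball] by blast
    define f where "f = (\<lambda>x s. k (s - x) *\<^sub>R G s)"
    define fx where "fx = (\<lambda>x s. (4 * m (s - x)) *\<^sub>R (blinfun_scaleR_left (G s) o\<^sub>L blinfun_inner_left (s - x)))"
    have F_eq: "F x = (1 / c) *\<^sub>R integral (cbox (-a) a) (f x)" if x: "x \<in> ball x0 1" for x
    proof -
      have cf: "continuous_on UNIV (f x)"
        unfolding f_def by (intro continuous_intros contk contG)
      have supp: "f x s = 0" if "s \<notin> cball x e" for s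
      proof -
        have "s - x \<notin> cball 0 e" using that by (simp add: dist_norm norm_minus_commute)
        then show ?thesis by (simp add: f_def k0)
      qed
      have "(\<integral>z. k z *\<^sub>R G (x + z) \<partial>lborel) = (\<integral>z. f x (x + z) \<partial>lborel)"
        by (simp add: f_def)
      also have "\<dots> = (\<integral>s. f x s \<partial>lborel)"
        using cf by (intro lborel_integral_shift borel_measurable_continuous_onI)
      also have "\<dots> = integral UNIV (f x)"
        using integrable_continuous_cball_support[OF cf supp] by (simp add: integral_lborel)
      also have "\<dots> = integral UNIV (\<lambda>s. if s \<in> cbox (-a) a then f x s else 0)"
      proof -
        have "f x s = 0" if "s \<notin> cbox (-a) a" for s
        proof (rule supp)
          have "s \<notin> cball x0 (1 + e)" using that a by blast
          then show "s \<notin> cball x e" using x dist_triangle[of x0 s x] by auto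
        qed
        then show ?thesis by (intro arg_cong[where f="integral UNIV"]) (auto simp: fun_eq_iff)
      qed
      finally show ?thesis unfolding F_def by (simp add: integral_restrict_UNIV)
    qed
    have "((\<lambda>x. integral (cbox (-a) a) (f x)) has_derivative
        blinfun_apply (integral (cbox (-a) a) (fx x0))) (at x0 within ball x0 1)"
    proof (rule leibniz_rule)
      fix x s :: 'a
      have "((\<lambda>x. e\<^sup>2 - (s - x) \<bullet> (s - x)) has_derivative (\<lambda>h. 2 * ((s - x) \<bullet> h))) (at x within ball x0 1)"
        by (auto intro!: derivative_eq_intros simp: inner_commute)
      from has_derivative_compose[OF this square_of_positive_part_has_derivative[unfolded has_field_derivative_def]]
      have "((\<lambda>x. k (s - x)) has_derivative (\<lambda>h. 4 * m (s - x) * ((s - x) \<bullet> h))) (at x within ball x0 1)"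
        unfolding k_def m_def by (simp add: mult.assoc mult.left_commute)
      from has_derivative_scaleR_left[OF this, of "G s"]
      show "((\<lambda>x. f x s) has_derivative blinfun_apply (fx x s)) (at x within ball x0 1)"
        unfolding f_def fx_def
        by (rule has_derivative_eq_rhs) (auto simp: fun_eq_iff blinfun.scaleR_left inner_commute)
    next
      fix x show "f x integrable_on cbox (-a) a"
        unfolding f_def by (intro integrable_continuous continuous_intros contk contG)
    next
      show "continuous_on (ball x0 1 \<times> cbox (- a) a) (\<lambda>(x, s). fx x s)"
        unfolding fx_def split_beta
        by (intro continuous_intros contm contG bounded_linear.continuous_on[OF bounded_linear_blinfun_scaleR_left]
            bounded_linear.continuous_on[OF bounded_linear_blinfun_inner_left]
            bounded_bilinear.continuous_on[OF bounded_bilinear_blinfun_compose])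
    qed auto
    then have "((\<lambda>x. integral (cbox (-a) a) (f x)) has_derivative
        blinfun_apply (integral (cbox (-a) a) (fx x0))) (at x0)"
      by (simp add: at_within_open[OF _ open_ball])
    then have "((\<lambda>x. (1 / c) *\<^sub>R integral (cbox (-a) a) (f x)) has_derivative
        (\<lambda>h. (1 / c) *\<^sub>R blinfun_apply (integral (cbox (-a) a) (fx x0)) h)) (at x0)"
      by (rule has_derivative_scaleR_right)
    then have "(F has_derivative
        (\<lambda>h. (1 / c) *\<^sub>R blinfun_apply (integral (cbox (-a) a) (fx x0)) h)) (at x0)"
      by (rule has_derivative_transform_within_open[of _ _ _ _ "ball x0 1"]) (auto simp: F_eq)
    then show ?thesis unfolding differentiable_def by blast
  qed
  show thesis by (rule that[OF F_ne F_near F_diff])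
qed

section \<open>The quadratic area polynomial of a nonexpansive field\<close>

text \<open>An open set of slightly larger measure around the compact image \<open>f ` K\<close> contains the images of \<open>K\<close>
  under all maps uniformly close to \<open>f\<close>.\<close>

lemma measure_image_upper_semicontinuous:
  fixes f :: "'a::euclidean_space \<Rightarrow> 'b::euclidean_space"
  assumes K: "compact K" and f: "continuous_on K f" and e: "e > 0"
  obtains d where "d > 0"
    "\<And>g. g ` K \<in> lmeasurable \<Longrightarrow> (\<And>x. x \<in> K \<Longrightarrow> norm (g x - f x) \<le> d) \<Longrightarrow>
        measure lebesgue (g ` K) \<le> measure lebesgue (f ` K) + e"
proof -
  have cfK: "compact (f ` K)" using K f by (rule compact_continuous_image[rotated])
  then have fK: "f ` K \<in> lmeasurable" by (rule lmeasurable_compact)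
  obtain V where V: "open V" "f ` K \<subseteq> V" "V - f ` K \<in> lmeasurable"
    "emeasure lebesgue (V - f ` K) < ennreal e"
    using sets_lebesgue_outer_open[OF fmeasurableD[OF fK] e] by blast
  then have mV: "measure lebesgue (V - f ` K) \<le> e"
    using e by (simp add: emeasure_eq_measure2 ennreal_less_iff)
  obtain d where d: "d > 0" "(\<Union>y\<in>f ` K. cball y d) \<subseteq> V"
    using compact_subset_open_imp_cball_epsilon_subset[OF cfK V(1,2)] by blast
  show thesis
  proof (rule that[OF d(1)])
    fix g assume g: "g ` K \<in> lmeasurable" "\<And>x. x \<in> K \<Longrightarrow> norm (g x - f x) \<le> d"
    have "g ` K \<subseteq> V"
    proof
      fix y assume "y \<in> g ` K"
      then obtain x where "x \<in> K" "y = g x" by blast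
      then have "y \<in> cball (f x) d" using g(2)[of x] by (simp add: dist_norm norm_minus_commute)
      then show "y \<in> V" using d(2) \<open>x \<in> K\<close> by blast
    qed
    then have sub: "g ` K \<subseteq> f ` K \<union> (V - f ` K)" by blast
    have "measure lebesgue (g ` K) \<le> measure lebesgue (f ` K \<union> (V - f ` K))"
      by (rule measure_mono_fmeasurable[OF sub fmeasurableD[OF g(1)] fmeasurable.Un[OF fK V(3)]])
    also have "\<dots> \<le> measure lebesgue (f ` K) + measure lebesgue (V - f ` K)"
      by (rule measure_Un_le) (use fK V(3) in auto)
    finally show "measure lebesgue (g ` K) \<le> measure lebesgue (f ` K) + e" using mV by linarith
  qed
qed

lemma inner_compact:
  fixes U :: "'a::euclidean_space set"
  assumes "bounded U" "U \<in> sets lebesgue" "e > 0"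
  obtains K where "compact K" "K \<subseteq> U" "measure lebesgue (U - K) < e"
    "measure lebesgue U = measure lebesgue K + measure lebesgue (U - K)"
proof -
  obtain K where K: "closed K" "K \<subseteq> U" "U - K \<in> lmeasurable" "emeasure lebesgue (U - K) < ennreal e"
    using sets_lebesgue_inner_closed[OF assms(2,3)] by blast
  then have "compact K" using assms(1) bounded_subset compact_eq_bounded_closed by blast
  have U: "U \<in> lmeasurable" using assms bounded_set_imp_lmeasurable by blast
  show thesis
  proof (rule that[OF \<open>compact K\<close> K(2)])
    show "measure lebesgue (U - K) < e"
      using K assms by (simp add: emeasure_eq_measure2 ennreal_less_iff)
    show "measure lebesgue U = measure lebesgue K + measure lebesgue (U - K)"
      using measurable_measure_Diff[OF U, of K] K(2) lmeasurable_compact[OF \<open>compact K\<close>] by simp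
  qed
qed

text \<open>A compact part \<open>L\<close> of the image, of almost full measure, has a compact preimage inside the open set
  \<open>U\<close>. The points that a nearby displacement maps onto \<open>L\<close> are close to this preimage, hence in \<open>U\<close>.\<close>

lemma displace_area_lower_semicontinuous:
  fixes G :: "'a::euclidean_space \<Rightarrow> 'a"
  assumes ne: "nonexpansive G" and U: "open U" "bounded U" and t: "\<bar>t\<bar> < 1" and e: "e > 0"
  obtains d where "d > 0"
    "\<And>F. nonexpansive F \<Longrightarrow> (\<And>x. norm (F x - G x) \<le> d) \<Longrightarrow>
        measure lebesgue (displace t G ` U) \<le> measure lebesgue (displace t F ` U) + e"
proof -
  have o: "open (displace t F ` U)" and b: "bounded (displace t F ` U)" if "nonexpansive F" for F
    using displace_image_open[OF that t U(1)] displace_image_bounded[OF that U(2)] by auto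
  obtain L where L: "compact L" "L \<subseteq> displace t G ` U"
    "measure lebesgue (displace t G ` U - L) < e"
    "measure lebesgue (displace t G ` U) = measure lebesgue L + measure lebesgue (displace t G ` U - L)"
    using inner_compact[OF b[OF ne] _ e] o[OF ne] by (metis borel_open sets_completionI_sets sets_lborel)
  define L' where "L' = closure U \<inter> displace t G -` L"
  have "closed L'"
    unfolding L'_def using continuous_closed_vimage[of L "displace t G"] compact_imp_closed[OF L(1)]
      displace_continuous_on[OF ne, of UNIV t] by (metis closed_Int closed_closure continuous_on_eq_continuous_at open_UNIV UNIV_I)
  then have "compact L'"
    using U(2) by (metis L'_def Int_lower1 bounded_closure bounded_subset compact_eq_bounded_closed)
  moreover have "L' \<subseteq> U"
  proof
    fix x assume "x \<in> L'"
    then have "displace t G x \<in> displace t G ` U" using L(2) by (auto simp: L'_def)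
    then show "x \<in> U" using displace_inj[OF ne t, of UNIV] by (auto dest: injD)
  qed
  ultimately obtain r where r: "r > 0" "(\<Union>x\<in>L'. cball x r) \<subseteq> U"
    using compact_subset_open_imp_cball_epsilon_subset[of L' U] U(1) by blast
  \<comment> \<open>preimages under the two displacements then differ by at most r\<close>
  define d where "d = (1 - \<bar>t\<bar>) * r"
  show thesis
  proof (rule that[of d])
    show "d > 0" using t r by (simp add: d_def)
    fix F :: "'a \<Rightarrow> 'a" assume F: "nonexpansive F" "\<And>x. norm (F x - G x) \<le> d"
    have "L \<subseteq> displace t F ` U"
    proof
      fix y assume y: "y \<in> L"
      then obtain x where x: "x \<in> U" "y = displace t G x" using L(2) by blast
      then have "x \<in> L'" using y closure_subset[of U] by (auto simp: L'_def)
      obtain x' where x': "displace t F x' = y" using displace_surj[OF F(1) t] by blast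
      have "(1 - \<bar>t\<bar>) * norm (x' - x) \<le> norm (displace t F x' - displace t F x)"
        by (rule displace_lower_bound[OF F(1)])
      also have "displace t F x' - displace t F x = t *\<^sub>R (G x - F x)"
        unfolding x' x(2) by (simp add: displace_def scaleR_diff_right)
      also have "norm \<dots> \<le> 1 * d"
        unfolding norm_scaleR using t F(2)[of x] by (intro mult_mono) (auto simp: norm_minus_commute)
      finally have "norm (x' - x) \<le> r" using t by (simp add: d_def)
      then have "x' \<in> cball x r" by (simp add: dist_norm norm_minus_commute)
      then have "x' \<in> U" using r(2) \<open>x \<in> L'\<close> by blast
      then show "y \<in> displace t F ` U" using x' by blast
    qed
    then have "measure lebesgue L \<le> measure lebesgue (displace t F ` U)"
      using o[OF F(1)] b[OF F(1)] lmeasurable_compact[OF L(1)]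
      by (intro measure_mono_fmeasurable lmeasurable_open) auto
    then show "measure lebesgue (displace t G ` U) \<le> measure lebesgue (displace t F ` U) + e"
      using L(3,4) by linarith
  qed
qed

lemma displace_area_le_differentiable:
  fixes G :: "real^2 \<Rightarrow> real^2"
  assumes ne: "nonexpansive G" and E: "E \<in> sets lebesgue" "bounded E"
    and der: "\<And>x. G differentiable (at x)" and t: "\<bar>t\<bar> < 1"
  shows "displace t G ` E \<in> lmeasurable" "measure lebesgue (displace t G ` E) \<le> 5 * measure lebesgue E"
proof -
  define B where "B = (\<lambda>x. jacobian G (at x))"
  have B: "(G has_derivative (\<lambda>h. B x *v h)) (at x)" for x
    using der[of x] unfolding B_def jacobian_works .
  note A = displace_area_differentiable[OF ne E B]
  show "displace t G ` E \<in> lmeasurable" using A(3) t .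
  have contr: "norm (B x *v h) \<le> norm h" for x h
    using nonexpansive_derivative_contraction[OF ne B] .
  have Em: "E \<in> lmeasurable" using E bounded_set_imp_lmeasurable by blast
  have one: "((\<lambda>x. 1) has_integral measure lebesgue E) E"
    using Em by (rule has_integral_one)
  have "((\<lambda>x. 1 + t * trace (B x) + t\<^sup>2 * det (B x)) has_integral measure lebesgue (displace t G ` E)) E"
    unfolding A(4)[OF t]
    by (intro has_integral_add has_integral_mult_right one integrable_integral A(1,2))
  moreover have "((\<lambda>x. 5 * 1) has_integral 5 * measure lebesgue E) E"
    by (intro has_integral_mult_right one)
  moreover have "1 + t * trace (B x) + t\<^sup>2 * det (B x) \<le> 5 * 1" for x
  proof -
    have "\<bar>t * trace (B x)\<bar> \<le> 1 * 2" "\<bar>t\<^sup>2 * det (B x)\<bar> \<le> 1 * 2"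
      unfolding abs_mult using contraction_trace_det_le[OF contr, of x] t
      by (intro mult_mono; simp add: abs_square_le_1)+
    then show ?thesis by linarith
  qed
  ultimately show "measure lebesgue (displace t G ` E) \<le> 5 * measure lebesgue E"
    by (rule has_integral_le)
qed

lemma displace_area_quadratic_differentiable:
  fixes G :: "real^2 \<Rightarrow> real^2"
  assumes ne: "nonexpansive G" and E: "E \<in> sets lebesgue" "bounded E"
    and der: "\<And>x. G differentiable (at x)" and t: "\<bar>t\<bar> < 1"
  shows "measure lebesgue (displace t G ` E) = measure lebesgue E
    + t * (measure lebesgue (displace (1/2) G ` E) - measure lebesgue (displace (-1/2) G ` E))
    + t\<^sup>2 * (2 * measure lebesgue (displace (1/2) G ` E) + 2 * measure lebesgue (displace (-1/2) G ` E)
        - 4 * measure lebesgue E)"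
proof -
  define B where "B = (\<lambda>x. jacobian G (at x))"
  have B: "(G has_derivative (\<lambda>h. B x *v h)) (at x)" for x
    using der[of x] unfolding B_def jacobian_works .
  note A = displace_area_differentiable(4)[OF ne E B]
  have P: "measure lebesgue (displace (1/2) G ` E) =
      measure lebesgue E + integral E (\<lambda>x. trace (B x)) / 2 + integral E (\<lambda>x. det (B x)) / 4"
    and M: "measure lebesgue (displace (-1/2) G ` E) =
      measure lebesgue E - integral E (\<lambda>x. trace (B x)) / 2 + integral E (\<lambda>x. det (B x)) / 4"
    using A[of "1/2"] A[of "-1/2"] by (simp_all add: power2_eq_square)
  show ?thesis
    unfolding A[OF t] P M by (simp add: algebra_simps)
qed

text \<open>Areas of the images of an open set converge along the smoothed fields. The lower bound is direct;
  the upper bound holds for a compact subset \<open>K\<close> of almost full measure, and the images of \<open>U - K\<close> have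
  area at most \<open>5\<close> times that of \<open>U - K\<close>, uniformly along the approximation.\<close>

lemma displace_area_approximation:
  fixes G :: "real^2 \<Rightarrow> real^2"
  assumes ne: "nonexpansive G" and U: "open U" "bounded U"
  obtains F where "\<And>n. nonexpansive (F n)" "\<And>n x. F n differentiable (at x)"
    "\<And>t. \<bar>t\<bar> < 1 \<Longrightarrow> (\<lambda>n. measure lebesgue (displace t (F n) ` U)) \<longlonglongrightarrow> measure lebesgue (displace t G ` U)"
proof -
  have Us: "U \<in> sets lebesgue" using U(1) by (simp add: borel_open)
  have "\<exists>F. \<forall>n. nonexpansive (F n) \<and> (\<forall>x. norm (F n x - G x) \<le> 1 / Suc n) \<and> (\<forall>x. F n differentiable (at x))"
    using nonexpansive_smoothing[OF ne] by (intro choice allI) (metis of_nat_0_less_iff zero_less_Suc zero_less_divide_1_iff)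
  then obtain F where F: "\<And>n. nonexpansive (F n)" "\<And>n x. norm (F n x - G x) \<le> 1 / Suc n"
    "\<And>n x. F n differentiable (at x)" by blast
  have ev: "\<forall>\<^sub>F n in sequentially. \<forall>x. norm (F n x - G x) \<le> d" if "d > 0" for d
  proof -
    have "(\<lambda>n. 1 / real (Suc n)) \<longlonglongrightarrow> 0" by (rule LIMSEQ_Suc[OF lim_1_over_n])
    then have "\<forall>\<^sub>F n in sequentially. 1 / real (Suc n) < d" using that by (rule order_tendstoD)
    then show ?thesis by eventually_elim (meson F(2) less_imp_le order_trans)
  qed
  have "(\<lambda>n. measure lebesgue (displace t (F n) ` U)) \<longlonglongrightarrow> measure lebesgue (displace t G ` U)"
    if t: "\<bar>t\<bar> < 1" for t
  proof (unfold tendsto_iff dist_real_def, intro allI impI)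
    fix e :: real assume e: "e > 0"
    then have e7: "e / 7 > 0" by simp
    obtain d where d: "d > 0" "\<And>F. nonexpansive F \<Longrightarrow> (\<And>x. norm (F x - G x) \<le> d) \<Longrightarrow>
        measure lebesgue (displace t G ` U) \<le> measure lebesgue (displace t F ` U) + e / 7"
      using displace_area_lower_semicontinuous[OF ne U t e7] by blast
    obtain K where K: "compact K" "K \<subseteq> U" "measure lebesgue (U - K) < e / 7"
      using inner_compact[OF U(2) Us e7] by metis
    obtain d' where d': "d' > 0"
      "\<And>g. g ` K \<in> lmeasurable \<Longrightarrow> (\<And>x. x \<in> K \<Longrightarrow> norm (g x - displace t G x) \<le> d') \<Longrightarrow>
        measure lebesgue (g ` K) \<le> measure lebesgue (displace t G ` K) + e / 7"
      using measure_image_upper_semicontinuous[OF K(1) displace_continuous_on[OF ne, of K t] e7] by blast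
    have Ks: "K \<in> sets lebesgue" "bounded K" "U - K \<in> sets lebesgue" "bounded (U - K)"
      using K(1) Us U(2) fmeasurableD[OF lmeasurable_compact[OF K(1)]] compact_imp_bounded bounded_diff by auto
    from ev[OF d(1)] ev[OF d'(1)]
    show "\<forall>\<^sub>F n in sequentially. \<bar>measure lebesgue (displace t (F n) ` U) - measure lebesgue (displace t G ` U)\<bar> < e"
    proof eventually_elim
      fix n assume n: "\<forall>x. norm (F n x - G x) \<le> d" "\<forall>x. norm (F n x - G x) \<le> d'"
      note A = displace_area_le_differentiable[OF F(1) _ _ F(3) t]
      have "measure lebesgue (displace t (F n) ` K) \<le> measure lebesgue (displace t G ` K) + e / 7"
      proof (rule d'(2)[OF A(1)[OF Ks(1,2)]])
        fix x
        have "norm (displace t (F n) x - displace t G x) = \<bar>t\<bar> * norm (F n x - G x)"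
          by (simp add: displace_def flip: scaleR_diff_right)
        also have "\<dots> \<le> 1 * d'" using t n by (intro mult_mono) auto
        finally show "norm (displace t (F n) x - displace t G x) \<le> d'" by simp
      qed
      moreover have "measure lebesgue (displace t G ` K) \<le> measure lebesgue (displace t G ` U)"
        using K displace_image_open[OF ne t U(1)] displace_image_bounded[OF ne U(2)]
        by (intro measure_mono_fmeasurable image_mono lmeasurable_open fmeasurableD[OF lmeasurable_compact]
            compact_continuous_image displace_continuous_on ne)
      moreover have "measure lebesgue (displace t (F n) ` (U - K)) \<le> 5 * measure lebesgue (U - K)"
        by (rule A(2)[OF Ks(3,4)])
      moreover have "displace t (F n) ` U = displace t (F n) ` K \<union> displace t (F n) ` (U - K)"
        using K(2) by blast
      then have "measure lebesgue (displace t (F n) ` U) \<le>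
          measure lebesgue (displace t (F n) ` K) + measure lebesgue (displace t (F n) ` (U - K))"
        using measure_Un_le[OF fmeasurableD[OF A(1)[OF Ks(1,2)]] fmeasurableD[OF A(1)[OF Ks(3,4)]]] by metis
      ultimately have "measure lebesgue (displace t (F n) ` U) < measure lebesgue (displace t G ` U) + e"
        using K(3) e by linarith
      moreover have "measure lebesgue (displace t G ` U) \<le> measure lebesgue (displace t (F n) ` U) + e / 7"
        using d(2)[OF F(1)] n(1) by blast
      ultimately show "\<bar>measure lebesgue (displace t (F n) ` U) - measure lebesgue (displace t G ` U)\<bar> < e"
        using e by linarith
    qed
  qed
  then show thesis using that F by blast
qed

lemma displace_area_le:
  fixes G :: "real^2 \<Rightarrow> real^2"
  assumes ne: "nonexpansive G" and U: "open U" "bounded U" and t: "\<bar>t\<bar> < 1"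
  shows "measure lebesgue (displace t G ` U) \<le> 5 * measure lebesgue U"
proof -
  obtain F where F: "\<And>n. nonexpansive (F n)" "\<And>n x. F n differentiable (at x)"
    "\<And>t. \<bar>t\<bar> < 1 \<Longrightarrow> (\<lambda>n. measure lebesgue (displace t (F n) ` U)) \<longlonglongrightarrow> measure lebesgue (displace t G ` U)"
    using displace_area_approximation[OF ne U] by blast
  have "U \<in> sets lebesgue" using U(1) by (simp add: borel_open)
  then have "measure lebesgue (displace t (F n) ` U) \<le> 5 * measure lebesgue U" for n
    using displace_area_le_differentiable(2)[OF F(1) _ U(2) F(2) t] by blast
  then show ?thesis by (intro LIMSEQ_le_const2[OF F(3)[OF t]]) blast
qed

text \<open>For differentiable fields this is the area formula. A quadratic polynomial is determined by its
  values at \<open>0\<close>, \<open>1/2\<close> and \<open>-1/2\<close>, so the property passes to limits of the areas alone, which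
  is all that smoothing provides.\<close>

theorem displace_area_quadratic:
  fixes G :: "real^2 \<Rightarrow> real^2"
  assumes ne: "nonexpansive G" and U: "open U" "bounded U"
  obtains a b where
    "\<And>t. \<bar>t\<bar> < 1 \<Longrightarrow> measure lebesgue (displace t G ` U) = measure lebesgue U + t * a + t\<^sup>2 * b"
proof -
  obtain F where F: "\<And>n. nonexpansive (F n)" "\<And>n x. F n differentiable (at x)"
    "\<And>t. \<bar>t\<bar> < 1 \<Longrightarrow> (\<lambda>n. measure lebesgue (displace t (F n) ` U)) \<longlonglongrightarrow> measure lebesgue (displace t G ` U)"
    using displace_area_approximation[OF ne U] by blast
  have Us: "U \<in> sets lebesgue" using U(1) by (simp add: borel_open)
  define P M where "P = measure lebesgue (displace (1/2) G ` U)"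
    and "M = measure lebesgue (displace (-1/2) G ` U)"
  have lim: "(\<lambda>n. measure lebesgue (displace (1/2) (F n) ` U)) \<longlonglongrightarrow> P"
    "(\<lambda>n. measure lebesgue (displace (-1/2) (F n) ` U)) \<longlonglongrightarrow> M"
    unfolding P_def M_def by (rule F(3); simp)+
  show thesis
  proof (rule that)
    fix t :: real assume t: "\<bar>t\<bar> < 1"
    have "(\<lambda>n. measure lebesgue (displace t (F n) ` U)) \<longlonglongrightarrow>
        measure lebesgue U + t * (P - M) + t\<^sup>2 * (2 * P + 2 * M - 4 * measure lebesgue U)"
      unfolding displace_area_quadratic_differentiable[OF F(1) Us U(2) F(2) t]
      by (intro tendsto_intros lim)
    with F(3)[OF t]
    show "measure lebesgue (displace t G ` U) =
        measure lebesgue U + t * (P - M) + t\<^sup>2 * (2 * P + 2 * M - 4 * measure lebesgue U)"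
      by (rule LIMSEQ_unique)
  qed
qed

text \<open>The polynomial of \<open>displace_area_quadratic\<close> tends to the area of the image at \<open>t = 1\<close>, on compact
  sets by semicontinuity and on the small rest by the uniform bound for areas.\<close>

lemma displace_area_collapse:
  fixes G :: "real^2 \<Rightarrow> real^2"
  assumes ne: "nonexpansive G" and U: "open U" "bounded U"
    and neg: "negligible (displace 1 G ` U)"
    and q: "\<And>t. \<bar>t\<bar> < 1 \<Longrightarrow> measure lebesgue (displace t G ` U) = measure lebesgue U + t * a + t\<^sup>2 * b"
  shows "measure lebesgue U + a + b \<le> 0"
proof (rule field_le_epsilon)
  fix e :: real assume "e > 0"
  then have e: "e / 6 > 0" by simp
  have Us: "U \<in> sets lebesgue" using U(1) by (simp add: borel_open)
  obtain K where K: "compact K" "K \<subseteq> U" "measure lebesgue (U - K) < e / 6"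
    using inner_compact[OF U(2) Us e] by metis
  obtain d where d: "d > 0"
    "\<And>g. g ` K \<in> lmeasurable \<Longrightarrow> (\<And>x. x \<in> K \<Longrightarrow> norm (g x - displace 1 G x) \<le> d) \<Longrightarrow>
        measure lebesgue (g ` K) \<le> measure lebesgue (displace 1 G ` K) + e / 6"
    using measure_image_upper_semicontinuous[OF K(1) displace_continuous_on[OF ne] e] by blast
  have K0: "measure lebesgue (displace 1 G ` K) = 0"
    using negligible_subset[OF neg image_mono[OF K(2)]] negligible_imp_measure0 by blast
  obtain M where M: "M > 0" "\<And>x. x \<in> K \<Longrightarrow> norm (G x) \<le> M"
    using compact_imp_bounded[OF compact_continuous_image[OF nonexpansive_continuous_on[OF ne] K(1)]]
    unfolding bounded_pos by blast
  have UK: "open (U - K)" "bounded (U - K)"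
    using U K(1) by (auto intro: bounded_diff compact_imp_closed)
  have small: "measure lebesgue U + t * a + t\<^sup>2 * b \<le> e" if t: "\<bar>t\<bar> < 1" "(1 - t) * M \<le> d" for t
  proof -
    have Km: "displace t G ` K \<in> lmeasurable"
      using K(1) by (intro lmeasurable_compact compact_continuous_image displace_continuous_on ne)
    have "measure lebesgue (displace t G ` K) \<le> measure lebesgue (displace 1 G ` K) + e / 6"
    proof (rule d(2)[OF Km])
      fix x assume "x \<in> K"
      have "displace t G x - displace 1 G x = - ((1 - t) *\<^sub>R G x)"
        by (simp add: displace_def algebra_simps)
      then have "norm (displace t G x - displace 1 G x) = (1 - t) * norm (G x)"
        using t by simp
      also have "\<dots> \<le> (1 - t) * M" using t M(2)[OF \<open>x \<in> K\<close>] by (intro mult_left_mono) auto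
      finally show "norm (displace t G x - displace 1 G x) \<le> d" using t by linarith
    qed
    moreover have "measure lebesgue (displace t G ` (U - K)) \<le> 5 * measure lebesgue (U - K)"
      by (rule displace_area_le[OF ne UK t(1)])
    moreover have "displace t G ` U = displace t G ` K \<union> displace t G ` (U - K)"
      using K(2) by blast
    then have "measure lebesgue (displace t G ` U) \<le>
          measure lebesgue (displace t G ` K) + measure lebesgue (displace t G ` (U - K))"
      using measure_Un_le[of "displace t G ` K" lebesgue "displace t G ` (U - K)"] Km
        displace_image_open[OF ne t(1) UK(1)] by (simp add: borel_open fmeasurableD)
    ultimately show ?thesis using q[OF t(1)] K0 K(3) by linarith
  qed
  have "((\<lambda>t. measure lebesgue U + t * a + t\<^sup>2 * b) \<longlongrightarrow> measure lebesgue U + 1 * a + 1\<^sup>2 * b) (at_left 1)"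
    by (intro tendsto_intros)
  moreover have "\<forall>\<^sub>F t in at_left 1. measure lebesgue U + t * a + t\<^sup>2 * b \<le> e"
  proof -
    have "\<forall>\<^sub>F t in at_left 1. t \<in> {max 0 (1 - d / M)<..<1}"
      using d(1) M(1) by (intro eventually_at_leftI[of "max 0 (1 - d / M)"]) auto
    then show ?thesis
    proof eventually_elim
      fix t assume "t \<in> {max 0 (1 - d / M)<..<1}"
      then have "\<bar>t\<bar> < 1" "(1 - t) * M \<le> d" using M(1) by (auto simp: field_simps)
      then show "measure lebesgue U + t * a + t\<^sup>2 * b \<le> e" by (rule small)
    qed
  qed
  ultimately have "measure lebesgue U + 1 * a + 1\<^sup>2 * b \<le> e"
    by (intro tendsto_upperbound) auto
  then show "measure lebesgue U + a + b \<le> 0 + e" by simp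
qed

section \<open>The contact set\<close>

text \<open>Within a small neighbourhood, the translates of the set by distinct multiples of \<open>e\<close> are disjoint.
  Infinitely many of them fit into a bounded region, so their common measure is zero.\<close>

lemma negligible_if_locally_one_point_sections:
  fixes E :: "'a::euclidean_space set"
  assumes E: "E \<in> sets lebesgue"
    and loc: "\<And>x. x \<in> E \<Longrightarrow> \<exists>e U. e \<noteq> 0 \<and> open U \<and> x \<in> U \<and>
      (\<forall>y s. y \<in> E \<inter> U \<longrightarrow> y + s *\<^sub>R e \<in> E \<inter> U \<longrightarrow> s = 0)"
  shows "negligible E"
proof (subst locally_negligible_alt, intro ballI)
  fix x assume "x \<in> E"
  from loc[OF this] obtain e U where eU: "e \<noteq> 0 \<and> open U \<and> x \<in> U \<and>
      (\<forall>y s. y \<in> E \<inter> U \<longrightarrow> y + s *\<^sub>R e \<in> E \<inter> U \<longrightarrow> s = 0)" by (elim exE)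
  then have e: "e \<noteq> 0" "open U" "x \<in> U" by simp_all
  have U: "s = 0" if "y \<in> E \<inter> U" "y + s *\<^sub>R e \<in> E \<inter> U" for y s
    using eU that by simp
  define D where "D = E \<inter> (U \<inter> ball x 1)"
  have D: "D \<in> lmeasurable"
    unfolding D_def using E e(2)
    by (intro bounded_set_imp_lmeasurable) (auto intro!: sets.Int borel_open)
  define T where "T = (\<lambda>n::nat. (+) ((1 / Suc n) *\<^sub>R e) ` D)"
  have T: "T n \<in> lmeasurable" "measure lebesgue (T n) = measure lebesgue D" for n
    unfolding T_def using D by (auto intro: measurable_translation measure_translation)
  have disj: "disjnt (T i) (T j)" if "i \<noteq> j" for i j
  proof (rule ccontr)
    assume "\<not> disjnt (T i) (T j)"
    then obtain y z where yz: "y \<in> D" "z \<in> D" "(1 / Suc i) *\<^sub>R e + y = (1 / Suc j) *\<^sub>R e + z"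
      by (auto simp: T_def disjnt_def)
    then have "y + (1 / Suc i - 1 / Suc j) *\<^sub>R e = z"
      by (simp add: scaleR_diff_left algebra_simps)
    then have "1 / real (Suc i) - 1 / real (Suc j) = 0"
      using U[of y "1 / Suc i - 1 / Suc j"] yz by (auto simp: D_def)
    then have "inverse (real (Suc i)) = inverse (real (Suc j))" by (simp add: inverse_eq_divide)
    then show False using that by simp
  qed
  define V where "V = ball x (1 + norm e)"
  have TV: "T n \<subseteq> V" for n
  proof
    fix z assume "z \<in> T n"
    then obtain y where y: "y \<in> ball x 1" "z = (1 / Suc n) *\<^sub>R e + y" by (auto simp: T_def D_def)
    have "norm ((1 / Suc n) *\<^sub>R e) = (1 / Suc n) * norm e" by simp
    also have "\<dots> \<le> 1 * norm e" by (intro mult_right_mono) auto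
    finally have "norm ((1 / Suc n) *\<^sub>R e) \<le> norm e" by simp
    moreover have "dist x z \<le> dist x y + norm ((1 / Suc n) *\<^sub>R e)"
      using norm_triangle_ineq4[of "x - y" "(1 / Suc n) *\<^sub>R e"] by (simp add: y(2) dist_norm diff_diff_eq2 add.commute diff_diff_add)
    ultimately show "z \<in> V" using y(1) by (simp add: V_def)
  qed
  have "measure lebesgue D = 0"
  proof (rule ccontr)
    assume "measure lebesgue D \<noteq> 0"
    then have pos: "measure lebesgue D > 0" using measure_nonneg[of lebesgue D] by linarith
    obtain n :: nat where n: "measure lebesgue V < n * measure lebesgue D"
      using reals_Archimedean3[OF pos] by blast
    have "n * measure lebesgue D = (\<Sum>i<n. measure lebesgue (T i))" by (simp add: T)
    also have "\<dots> = measure lebesgue (\<Union>i<n. T i)"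
      using T disj by (intro measure_UNION'[symmetric]) (auto simp: pairwise_def)
    also have "\<dots> \<le> measure lebesgue V"
      using T TV by (intro measure_mono_fmeasurable) (auto simp: V_def fmeasurableD)
    finally show False using n by simp
  qed
  then have "negligible D" using D by (simp add: negligible_iff_measure)
  moreover have "openin (top_of_set E) D"
    unfolding D_def using e(2) by (intro openin_open_Int open_Int open_ball)
  moreover have "x \<in> D" using \<open>x \<in> E\<close> e by (simp add: D_def)
  ultimately show "\<exists>U. openin (top_of_set E) U \<and> x \<in> U \<and> negligible U" by blast
qed

lemma mvt_segment:
  fixes f :: "'a::real_normed_vector \<Rightarrow> real"
  assumes "\<And>x. (f has_derivative f' x) (at x)"
  obtains z where "z \<in> closed_segment x y" "f y - f x = f' z (y - x)"
proof -
  have "\<exists>s\<in>{0..1}. f (x + 1 *\<^sub>R (y - x)) - f (x + 0 *\<^sub>R (y - x)) = f' (x + s *\<^sub>R (y - x)) ((1 - 0) *\<^sub>R (y - x))"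
  proof (rule mvt_very_simple[of 0 1 "\<lambda>s. f (x + s *\<^sub>R (y - x))" "\<lambda>s d. f' (x + s *\<^sub>R (y - x)) (d *\<^sub>R (y - x))"])
    fix s :: real
    have "((\<lambda>s. x + s *\<^sub>R (y - x)) has_derivative (\<lambda>d. d *\<^sub>R (y - x))) (at s within {0..1})"
      by (auto intro!: derivative_eq_intros)
    from has_derivative_compose[OF this assms]
    show "((\<lambda>s. f (x + s *\<^sub>R (y - x))) has_derivative (\<lambda>d. f' (x + s *\<^sub>R (y - x)) (d *\<^sub>R (y - x)))) (at s within {0..1})" .
  qed simp
  then obtain s where s: "s \<in> {0..1}" "f y - f x = f' (x + s *\<^sub>R (y - x)) (y - x)" by auto
  moreover have "x + s *\<^sub>R (y - x) \<in> closed_segment x y"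
    using s(1) by (auto simp: closed_segment_def algebra_simps intro!: exI[of _ s])
  ultimately show thesis using that by blast
qed

lemma uminus_matrix_vector_mult: "(- M) *v h = - (M *v h)" for M :: "real^'n^'m"
  using matrix_vector_mult_diff_rdistrib[of 0 M h] by simp

locale bounded_hessian =
  fixes v :: "real^2 \<Rightarrow> real" and g :: "real^2 \<Rightarrow> real^2" and H :: "real^2 \<Rightarrow> real^2^2" and L :: real
  assumes gradient: "(v has_derivative (\<lambda>h. g x \<bullet> h)) (at x)"
    and hessian: "(g has_derivative (\<lambda>h. H x *v h)) (at x)"
    and continuous_H: "continuous_on UNIV H"
    and bound: "norm (H x *v h) \<le> L * norm h"
    and L_pos: "L > 0"
begin

lemma continuous_v: "continuous_on S v"
  using gradient has_derivative_continuous by (metis continuous_at_imp_continuous_on)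

lemma continuous_g: "continuous_on S g"
  using hessian has_derivative_continuous by (metis continuous_at_imp_continuous_on)

lemma g_lipschitz: "norm (g y - g x) \<le> L * norm (y - x)"
  using differentiable_bound[of UNIV g "\<lambda>x h. H x *v h" L y x] hessian bound
  by (simp add: onorm_le)

lemma taylor_lower: "v x + g x \<bullet> (y - x) - L * (norm (y - x))\<^sup>2 \<le> v y"
proof -
  obtain z where z: "z \<in> closed_segment x y" "v y - v x = g z \<bullet> (y - x)"
    using mvt_segment[OF gradient] by blast
  have "\<bar>(g z - g x) \<bullet> (y - x)\<bar> \<le> norm (g z - g x) * norm (y - x)"
    by (rule Cauchy_Schwarz_ineq2)
  also have "\<dots> \<le> (L * norm (z - x)) * norm (y - x)"
    by (intro mult_right_mono g_lipschitz) simp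
  also have "\<dots> \<le> (L * norm (y - x)) * norm (y - x)"
    using L_pos segment_bound(1)[OF z(1)] by (intro mult_right_mono mult_left_mono) auto
  finally show ?thesis using z(2) by (simp add: power2_eq_square inner_diff_left)
qed

lemma nonexpansive_scaled_gradient: "nonexpansive (\<lambda>x. (1 / L) *\<^sub>R g x)"
  unfolding nonexpansive_def
proof (intro allI)
  fix x y
  have "norm ((1 / L) *\<^sub>R g y - (1 / L) *\<^sub>R g x) = (1 / L) * norm (g y - g x)"
    unfolding scaleR_diff_right[symmetric] using L_pos by simp
  also have "\<dots> \<le> (1 / L) * (L * norm (y - x))"
    using L_pos by (intro mult_left_mono g_lipschitz) simp
  finally show "norm ((1 / L) *\<^sub>R g y - (1 / L) *\<^sub>R g x) \<le> norm (y - x)" using L_pos by simp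
qed

lemma displace_scaled_gradient: "displace (t * L) (\<lambda>x. (1 / L) *\<^sub>R g x) = displace t g"
  using L_pos by (simp add: displace_def fun_eq_iff)

text \<open>The area formula of \<open>displace_area_differentiable\<close> for the nonexpansive field \<open>g / L\<close>.\<close>

lemma displace_area:
  assumes E: "E \<in> sets lebesgue" "bounded E"
  shows "(\<lambda>x. trace (H x)) integrable_on E" and "(\<lambda>x. det (H x)) integrable_on E"
    and "\<And>t. \<bar>t\<bar> * L < 1 \<Longrightarrow> displace t g ` E \<in> lmeasurable"
    and "\<And>t. \<bar>t\<bar> * L < 1 \<Longrightarrow> measure lebesgue (displace t g ` E) =
      measure lebesgue E + t * integral E (\<lambda>x. trace (H x)) + t\<^sup>2 * integral E (\<lambda>x. det (H x))"
proof -
  define G B where "G = (\<lambda>x. (1 / L) *\<^sub>R g x)" and "B = (\<lambda>x. (1 / L) *\<^sub>R H x)"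
  have ne: "nonexpansive G" unfolding G_def by (rule nonexpansive_scaled_gradient)
  have der: "(G has_derivative (\<lambda>h. B x *v h)) (at x)" for x
    unfolding G_def B_def using has_derivative_scaleR_right[OF hessian, of "1 / L" x]
    by (simp add: scaleR_matrix_vector_assoc)
  have disp: "displace (t * L) G = displace t g" for t
    unfolding G_def by (rule displace_scaled_gradient)
  have tr: "trace (B x) = (1 / L) * trace (H x)" and dt: "det (B x) = (1 / L)\<^sup>2 * det (H x)" for x
    unfolding B_def by (simp_all add: trace_def sum_2 det_2 power2_eq_square algebra_simps)
  note A = displace_area_differentiable[OF ne E der]
  have "(\<lambda>x. L * trace (B x)) integrable_on E" "(\<lambda>x. L\<^sup>2 * det (B x)) integrable_on E"
    by (intro integrable_on_mult_right A(1,2))+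
  moreover have trH: "L * trace (B x) = trace (H x)" and dtH: "L\<^sup>2 * det (B x) = det (H x)" for x
    unfolding tr dt using L_pos by (simp_all add: power_divide)
  ultimately show "(\<lambda>x. trace (H x)) integrable_on E" "(\<lambda>x. det (H x)) integrable_on E" by simp_all
  have I: "integral E (\<lambda>x. trace (H x)) = L * integral E (\<lambda>x. trace (B x))"
    "integral E (\<lambda>x. det (H x)) = L\<^sup>2 * integral E (\<lambda>x. det (B x))"
    unfolding trH[symmetric] dtH[symmetric] by simp_all
  fix t assume "\<bar>t\<bar> * L < 1"
  then have t: "\<bar>t * L\<bar> < 1" using L_pos by (simp add: abs_mult)
  show "displace t g ` E \<in> lmeasurable" using A(3)[OF t] by (simp add: disp)
  show "measure lebesgue (displace t g ` E) =
      measure lebesgue E + t * integral E (\<lambda>x. trace (H x)) + t\<^sup>2 * integral E (\<lambda>x. det (H x))"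
    using A(4)[OF t] unfolding disp I by (simp add: power_mult_distrib algebra_simps)
qed

lemma bounded_hessian_uminus: "bounded_hessian (\<lambda>x. - v x) (\<lambda>x. - g x) (\<lambda>x. - H x) L"
proof
  fix x h
  show "((\<lambda>x. - v x) has_derivative (\<lambda>h. - g x \<bullet> h)) (at x)"
    using has_derivative_minus[OF gradient, of x] by simp
  show "((\<lambda>x. - g x) has_derivative (\<lambda>h. - H x *v h)) (at x)"
    unfolding uminus_matrix_vector_mult using has_derivative_minus[OF hessian, of x] by simp
  show "continuous_on UNIV (\<lambda>x. - H x)" using continuous_H by (intro continuous_intros)
  show "norm (- H x *v h) \<le> L * norm h" unfolding uminus_matrix_vector_mult using bound by simp
  show "L > 0" by (rule L_pos)
qed

text \<open>Near a contact point with different gradients, \<open>w - v\<close> is strictly increasing in the direction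
  \<open>e = G x - g x\<close>, so each line in this direction contains at most one contact point. Since \<open>w - v\<close> can
  change sign at the contact set, such points need not be absent.\<close>

lemma transversal_contact_negligible:
  assumes pg: "parabolic_gradient w G"
  shows "negligible {x. w x = v x \<and> G x \<noteq> g x}"
proof (rule negligible_if_locally_one_point_sections)
  let ?E = "{x. w x = v x \<and> G x \<noteq> g x}"
  note cont = parabolic_gradient_continuous[OF pg] continuous_v continuous_g
  have "closed {x. w x = v x}" "open {x. G x \<noteq> g x}"
    by (intro closed_Collect_eq open_Collect_neq cont)+
  then have "{x. w x = v x} \<in> sets lebesgue" "{x. G x \<noteq> g x} \<in> sets lebesgue"
    by (auto intro: borel_closed borel_open)
  then have "{x. w x = v x} \<inter> {x. G x \<noteq> g x} \<in> sets lebesgue" by (rule sets.Int)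
  then show "?E \<in> sets lebesgue" by (simp add: Collect_conj_eq)
  fix x assume x: "x \<in> ?E"
  define e where "e = G x - g x"
  have "e \<noteq> 0" using x by (simp add: e_def)
  have "open {y. 0 < (G y - g y) \<bullet> e}"
    by (intro open_Collect_less continuous_intros cont)
  moreover have "x \<in> {y. 0 < (G y - g y) \<bullet> e}" using \<open>e \<noteq> 0\<close> by (simp add: e_def)
  ultimately obtain r where r: "r > 0" "ball x r \<subseteq> {y. 0 < (G y - g y) \<bullet> e}"
    by (meson open_contains_ball)
  have "s = 0" if y: "y \<in> ?E \<inter> ball x r" "y + s *\<^sub>R e \<in> ?E \<inter> ball x r" for y s
  proof -
    have der: "((\<lambda>x. w x - v x) has_derivative (\<lambda>h. (G x - g x) \<bullet> h)) (at x)" for x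
      using has_derivative_diff[OF parabolic_gradient_has_derivative[OF pg] gradient]
      by (simp add: inner_diff_left)
    obtain z where z: "z \<in> closed_segment y (y + s *\<^sub>R e)"
      "(w (y + s *\<^sub>R e) - v (y + s *\<^sub>R e)) - (w y - v y) = (G z - g z) \<bullet> (y + s *\<^sub>R e - y)"
      using mvt_segment[OF der] by blast
    have "z \<in> ball x r" using z(1) y closed_segment_subset[of y "ball x r" "y + s *\<^sub>R e"] by auto
    then have "0 < (G z - g z) \<bullet> e" using r by blast
    moreover have "s * ((G z - g z) \<bullet> e) = 0" using z(2) y by simp
    ultimately show "s = 0" by simp
  qed
  then show "\<exists>e U. e \<noteq> 0 \<and> open U \<and> x \<in> U \<and> (\<forall>y s. y \<in> ?E \<inter> U \<longrightarrow> y + s *\<^sub>R e \<in> ?E \<inter> U \<longrightarrow> s = 0)"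
    using \<open>e \<noteq> 0\<close> r(1) by (intro exI[of _ e] exI[of _ "ball x r"]) auto
qed

text \<open>Along short segments in a direction \<open>e\<close> in which \<open>\<bar>e \<bullet> H e\<bar>\<close> exceeds \<open>e \<bullet> e\<close>, the component of \<open>g\<close>
  along \<open>e\<close> changes faster than a nonexpansive map can, so \<open>G = g\<close> holds at one point at most. On the
  contact set this yields the bounds on \<open>D\<^sup>2v\<close> that would follow from \<open>D\<^sup>2v = D\<^sup>2w\<close>.\<close>

lemma large_hessian_contact_negligible:
  assumes ne: "nonexpansive G"
  shows "negligible {x. G x = g x \<and> (\<exists>h. h \<bullet> h < \<bar>h \<bullet> (H x *v h)\<bar>)}"
proof (rule negligible_if_locally_one_point_sections)
  let ?E = "{x. G x = g x \<and> (\<exists>h. h \<bullet> h < \<bar>h \<bullet> (H x *v h)\<bar>)}"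
  have cH: "continuous_on S (\<lambda>x. \<bar>h \<bullet> (H x *v h)\<bar>)" for S h
    unfolding matrix_vector_mult_def using continuous_on_subset[OF continuous_H]
    by (intro continuous_intros) auto
  have op: "open {x. h \<bullet> h < \<bar>h \<bullet> (H x *v h)\<bar>}" for h
    by (intro open_Collect_less continuous_intros cH)
  have "closed {x. G x = g x}"
    by (intro closed_Collect_eq nonexpansive_continuous_on[OF ne] continuous_g)
  moreover have "open (\<Union>h. {x. h \<bullet> h < \<bar>h \<bullet> (H x *v h)\<bar>})" using op by blast
  ultimately have "{x. G x = g x} \<inter> (\<Union>h. {x. h \<bullet> h < \<bar>h \<bullet> (H x *v h)\<bar>}) \<in> sets lebesgue"
    by (intro sets.Int) (auto intro: borel_closed borel_open)
  moreover have "{x. G x = g x} \<inter> (\<Union>h. {x. h \<bullet> h < \<bar>h \<bullet> (H x *v h)\<bar>}) = ?E" by auto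
  ultimately show "?E \<in> sets lebesgue" by simp
  fix x assume "x \<in> ?E"
  then obtain e where e: "e \<bullet> e < \<bar>e \<bullet> (H x *v e)\<bar>" by blast
  then have "e \<noteq> 0" by auto
  obtain r where r: "r > 0" "ball x r \<subseteq> {y. e \<bullet> e < \<bar>e \<bullet> (H y *v e)\<bar>}"
    using op[of e] e open_contains_ball by blast
  have "s = 0" if y: "y \<in> ?E \<inter> ball x r" "y + s *\<^sub>R e \<in> ?E \<inter> ball x r" for y s
  proof (rule ccontr)
    assume "s \<noteq> 0"
    have der: "((\<lambda>x. e \<bullet> g x) has_derivative (\<lambda>h. e \<bullet> (H x *v h))) (at x)" for x
      by (rule has_derivative_inner_right[OF hessian])
    obtain z where z: "z \<in> closed_segment y (y + s *\<^sub>R e)"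
      "e \<bullet> g (y + s *\<^sub>R e) - e \<bullet> g y = e \<bullet> (H z *v (y + s *\<^sub>R e - y))"
      using mvt_segment[OF der] by blast
    have "z \<in> ball x r" using z(1) y closed_segment_subset[of y "ball x r" "y + s *\<^sub>R e"] by auto
    then have "e \<bullet> e < \<bar>e \<bullet> (H z *v e)\<bar>" using r by blast
    then have "\<bar>s\<bar> * (e \<bullet> e) < \<bar>s\<bar> * \<bar>e \<bullet> (H z *v e)\<bar>" using \<open>s \<noteq> 0\<close> by simp
    also have "\<dots> = \<bar>e \<bullet> (G (y + s *\<^sub>R e) - G y)\<bar>"
      using z(2) y by (simp add: inner_diff_right matrix_vector_mult_scaleR abs_mult)
    also have "\<dots> \<le> norm e * norm (G (y + s *\<^sub>R e) - G y)" by (rule Cauchy_Schwarz_ineq2)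
    also have "\<dots> \<le> norm e * norm (s *\<^sub>R e)"
      using nonexpansiveD[OF ne, of "y + s *\<^sub>R e" y] by (intro mult_left_mono) auto
    also have "\<dots> = \<bar>s\<bar> * (e \<bullet> e)" by (simp flip: power2_norm_eq_inner add: power2_eq_square)
    finally show False by simp
  qed
  then show "\<exists>e U. e \<noteq> 0 \<and> open U \<and> x \<in> U \<and> (\<forall>y s. y \<in> ?E \<inter> U \<longrightarrow> y + s *\<^sub>R e \<in> ?E \<inter> U \<longrightarrow> s = 0)"
    using \<open>e \<noteq> 0\<close> r(1) by (intro exI[of _ e] exI[of _ "ball x r"]) auto
qed

end

text \<open>A lower parabola of opening \<open>2 c\<close> at \<open>x\<close> makes \<open>x\<close> the minimum point of \<open>\<bar>z - y\<bar>\<^sup>2 / 2 + t f z\<close> when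
  \<open>y = x + t p\<close> and \<open>t\<close> is small.\<close>

lemma proximal_minimum:
  fixes p :: "'a::real_inner"
  assumes "\<And>z. f x + p \<bullet> (z - x) - c * (norm (z - x))\<^sup>2 \<le> f z" "0 \<le> t" "t * c \<le> 1 / 2"
    and y: "x + t *\<^sub>R p = y"
  shows "(norm (x - y))\<^sup>2 / 2 + t * f x \<le> (norm (z - y))\<^sup>2 / 2 + t * f z"
proof -
  have "t * (f x + p \<bullet> (z - x) - c * (norm (z - x))\<^sup>2) \<le> t * f z"
    using assms by (intro mult_left_mono) auto
  moreover have "(t * c) * (norm (z - x))\<^sup>2 \<le> 1 / 2 * (norm (z - x))\<^sup>2"
    using assms by (intro mult_right_mono) auto
  moreover have "(norm (z - y))\<^sup>2 = (norm (z - x))\<^sup>2 - 2 * t * (p \<bullet> (z - x)) + (norm (x - y))\<^sup>2"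
    unfolding y[symmetric] power2_norm_eq_inner
    by (simp add: inner_simps inner_commute[of z x] inner_commute[of p z] inner_commute[of p x] algebra_simps)
  ultimately show ?thesis by (simp add: algebra_simps)
qed

text \<open>Given \<open>y\<close> in the left-hand image, let \<open>x\<close> minimize \<open>\<bar>z - y\<bar>\<^sup>2 / 2 + t v z\<close> and let \<open>x'\<close> minimize
  \<open>\<bar>z - y\<bar>\<^sup>2 / 2 + t w z\<close>. Since \<open>w x < v x\<close>, the minimum for \<open>w\<close> is below the minimum for \<open>v\<close>, hence
  below the value of the functional of \<open>v\<close> at \<open>x'\<close>; so \<open>w x' < v x'\<close>. This takes the place of the
  divergence theorem on \<open>{w < v}\<close>, whose boundary may be irregular.\<close>

lemma (in bounded_hessian) displace_sublevel_subset:
  assumes pg: "parabolic_gradient w G" and t: "0 < t" "t < 1" "t * L \<le> 1 / 2"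
  shows "displace t g ` {x. w x < v x} \<subseteq> displace t G ` {x. w x < v x}"
proof clarify
  fix x assume x: "w x < v x"
  have ne: "nonexpansive G" by (rule parabolic_gradientD(3)[OF pg])
  define y where "y = displace t g x"
  obtain x' where x': "displace t G x' = y" using displace_surj[OF ne] t by (metis abs_of_pos)
  have "t * w x' < t * v x'"
  proof -
    have "(norm (x' - y))\<^sup>2 / 2 + t * w x' \<le> (norm (x - y))\<^sup>2 / 2 + t * w x"
      by (rule proximal_minimum[where p = "G x'" and c = "1/2"])
        (use parabolic_gradientD(1)[OF pg, of x'] t x' in \<open>auto simp: displace_def\<close>)
    also have "\<dots> < (norm (x - y))\<^sup>2 / 2 + t * v x" using x t by simp
    also have "\<dots> \<le> (norm (x' - y))\<^sup>2 / 2 + t * v x'"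
      by (rule proximal_minimum[where p = "g x" and c = L])
        (use taylor_lower[of x] t in \<open>auto simp: displace_def y_def\<close>)
    finally show ?thesis by simp
  qed
  then have "w x' < v x'" using t by simp
  then have "displace t G x' \<in> displace t G ` {x. w x < v x}" by blast
  then show "displace t g x \<in> displace t G ` {x. w x < v x}" unfolding x' y_def .
qed

text \<open>The number \<open>b\<close> plays the role of the integral of \<open>det D\<^sup>2w\<close> over \<open>N\<close>, and \<open>a\<close> that of \<open>tr D\<^sup>2w\<close>. The
  collapse at \<open>t = 1\<close> gives \<open>b \<le> - a - \<bar>N\<bar>\<close>, and the inclusion of images for small \<open>t > 0\<close>, divided by
  \<open>t\<close>, bounds the integral of the trace of \<open>H\<close> by \<open>a\<close>.\<close>

lemma (in bounded_hessian) noncontact_area: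
  assumes "semiconvex w" and pg: "parabolic_gradient w G" and "unliftable w v"
    and N: "N = {x. w x < v x}" "bounded N"
  obtains a b where
    "\<And>t. \<bar>t\<bar> < 1 \<Longrightarrow> measure lebesgue (displace t G ` N) = measure lebesgue N + t * a + t\<^sup>2 * b"
    "b \<le> - integral N (\<lambda>x. trace (H x)) - measure lebesgue N"
proof -
  have ne: "nonexpansive G" by (rule parabolic_gradientD(3)[OF pg])
  have oN: "open N"
    unfolding N by (intro open_Collect_less parabolic_gradient_continuous[OF pg] continuous_v)
  then have Ns: "N \<in> sets lebesgue" by (simp add: borel_open)
  obtain a b where ab:
    "\<And>t. \<bar>t\<bar> < 1 \<Longrightarrow> measure lebesgue (displace t G ` N) = measure lebesgue N + t * a + t\<^sup>2 * b"
    using displace_area_quadratic[OF ne oN N(2)] by blast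
  have "negligible (displace 1 G ` N)"
    using negligible_unliftable_image[OF assms(1-3) continuous_v] by (simp add: N(1))
  then have c: "measure lebesgue N + a + b \<le> 0"
    using displace_area_collapse[OF ne oN N(2) _ ab] by blast
  define T D where "T = integral N (\<lambda>x. trace (H x))" and "D = integral N (\<lambda>x. det (H x))"
  have le: "T + t * D \<le> a + t * b" if t: "0 < t" "t < min 1 (1 / (2 * L))" for t
  proof -
    have tL: "t * L \<le> 1 / 2" "\<bar>t\<bar> * L < 1" "\<bar>t\<bar> < 1"
      using t L_pos by (auto simp: field_simps)
    have "displace t g ` N \<subseteq> displace t G ` N"
      using displace_sublevel_subset[OF pg] t tL(1) by (simp add: N(1))
    moreover have "displace t g ` N \<in> sets lebesgue"
      using displace_area(3)[OF Ns N(2) tL(2)] by (rule fmeasurableD)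
    moreover have "displace t G ` N \<in> lmeasurable"
      using displace_image_open[OF ne tL(3) oN] displace_image_bounded[OF ne N(2)] by (intro lmeasurable_open)
    ultimately have "measure lebesgue (displace t g ` N) \<le> measure lebesgue (displace t G ` N)"
      by (rule measure_mono_fmeasurable)
    then have "t * T + t\<^sup>2 * D \<le> t * a + t\<^sup>2 * b"
      unfolding displace_area(4)[OF Ns N(2) tL(2)] ab[OF tL(3)] T_def D_def by simp
    then have "t * (T + t * D) \<le> t * (a + t * b)" by (simp add: algebra_simps power2_eq_square)
    then show ?thesis using t by simp
  qed
  have "T + 0 * D \<le> a + 0 * b"
  proof (rule tendsto_le[of "at_right 0"])
    show "((\<lambda>t. a + t * b) \<longlongrightarrow> a + 0 * b) (at_right 0)" "((\<lambda>t. T + t * D) \<longlongrightarrow> T + 0 * D) (at_right 0)"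
      by (intro tendsto_intros)+
    show "\<forall>\<^sub>F t in at_right 0. T + t * D \<le> a + t * b"
      using L_pos le by (intro eventually_at_rightI[of 0 "min 1 (1 / (2 * L))"]) auto
  qed simp
  then have "b \<le> - T - measure lebesgue N" using c by simp
  then show thesis using that ab unfolding T_def by blast
qed

section \<open>The integral inequality for symmetric Hessians\<close>

lemma semiconvex_quadratic:
  fixes A :: "real^'n^'n"
  assumes sym: "\<And>x y. x \<bullet> (A *v y) = y \<bullet> (A *v x)"
    and le: "\<And>x. - (x \<bullet> x) \<le> x \<bullet> (A *v x)"
  shows "semiconvex (\<lambda>x. x \<bullet> (A *v x) / 2)"
proof (rule semiconvexI)
  fix a b :: real and x y :: "real^'n"
  assume ab: "0 \<le> a" "0 \<le> b" "a + b = 1"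
  have b: "b = 1 - a" using ab by simp
  have "(a *\<^sub>R x + b *\<^sub>R y) \<bullet> (A *v (a *\<^sub>R x + b *\<^sub>R y)) =
      a * (x \<bullet> (A *v x)) + b * (y \<bullet> (A *v y)) - a * b * ((x - y) \<bullet> (A *v (x - y)))"
    unfolding b by (simp add: matrix_vector_right_distrib matrix_vector_mult_scaleR matrix_vector_mult_diff_distrib
        inner_simps sym[of y x] algebra_simps)
  moreover have "a * b * - ((x - y) \<bullet> (x - y)) \<le> a * b * ((x - y) \<bullet> (A *v (x - y)))"
    using ab by (intro mult_left_mono le) auto
  ultimately show "(a *\<^sub>R x + b *\<^sub>R y) \<bullet> (A *v (a *\<^sub>R x + b *\<^sub>R y)) / 2
      \<le> a * (x \<bullet> (A *v x) / 2) + b * (y \<bullet> (A *v y) / 2) + a * b * (norm (x - y))\<^sup>2 / 2"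
    by (simp add: power2_norm_eq_inner field_simps)
qed

text \<open>The parabola of opening \<open>-1\<close> that touches the quadratic function \<open>q\<close> at \<open>x0\<close> lies below \<open>q\<close> by a
  quadratic margin, since \<open>c < 1\<close>. If \<open>x0\<close> is far from the ball of radius \<open>R\<close>, the margin on that ball
  exceeds \<open>M\<close>, so the parabola lies below \<open>v\<close> and therefore below \<open>w\<close>.\<close>

lemma unliftable_barrier:
  fixes A :: "real^'n^'n" and v w :: "real^'n \<Rightarrow> real"
  assumes sym: "\<And>x y. x \<bullet> (A *v y) = y \<bullet> (A *v x)"
    and le: "\<And>x. - (c * (x \<bullet> x)) \<le> x \<bullet> (A *v x)" and c: "0 \<le> c" "c < 1"
    and out: "\<And>x. norm x \<ge> R \<Longrightarrow> v x = x \<bullet> (A *v x) / 2"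
    and bd: "\<And>x. x \<bullet> (A *v x) / 2 - M \<le> v x" and M: "0 \<le> M"
    and un: "unliftable w v"
    and x0: "norm x0 \<ge> R + sqrt (2 * M / (1 - c))"
  shows "v x0 \<le> w x0"
proof -
  define q where "q = (\<lambda>x. x \<bullet> (A *v x) / 2)"
  define k where "k = (\<lambda>y. q x0 + (A *v x0) \<bullet> (y - x0) - (norm (y - x0))\<^sup>2 / 2)"
  have "k y = (q x0 - (A *v x0) \<bullet> x0 - (norm x0)\<^sup>2 / 2) + (A *v x0 + x0) \<bullet> y - (norm y)\<^sup>2 / 2" for y
    unfolding k_def power2_norm_eq_inner
    by (simp add: inner_simps inner_commute[of y x0] field_simps)
  then have "k = (\<lambda>y. (q x0 - (A *v x0) \<bullet> x0 - (norm x0)\<^sup>2 / 2) + (A *v x0 + x0) \<bullet> y - (norm y)\<^sup>2 / 2)"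
    by (rule ext)
  then have "semiconvex k" using semiconvex_affine by simp
  have qk: "q y - k y \<ge> (1 - c) / 2 * (norm (y - x0))\<^sup>2" for y
  proof -
    have "q y = q x0 + (A *v x0) \<bullet> (y - x0) + (y - x0) \<bullet> (A *v (y - x0)) / 2"
      unfolding q_def by (simp add: matrix_vector_mult_diff_distrib inner_simps sym[of x0 y]
          inner_commute[of "A *v x0"] field_simps)
    then show ?thesis using le[of "y - x0"] unfolding k_def power2_norm_eq_inner
      by (simp add: field_simps)
  qed
  have "k y \<le> v y" for y
  proof (cases "norm y \<ge> R")
    case True
    have "0 \<le> (1 - c) / 2 * (norm (y - x0))\<^sup>2" using c by simp
    then show ?thesis using qk[of y] out[OF True] by (simp add: q_def)
  next
    case False
    have "sqrt (2 * M / (1 - c)) \<le> norm (y - x0)"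
      using False x0 norm_triangle_ineq3[of y x0] by linarith
    then have "2 * M / (1 - c) \<le> (norm (y - x0))\<^sup>2"
      using M c by (metis norm_ge_zero real_sqrt_le_iff real_sqrt_unique sqrt_le_D)
    then have "M \<le> (1 - c) / 2 * (norm (y - x0))\<^sup>2" using c by (simp add: field_simps)
    then show ?thesis using qk[of y] bd[of y] by (simp add: q_def)
  qed
  then have "k x0 \<le> w x0"
    using un \<open>semiconvex k\<close> unfolding unliftable_def by (metis max.coboundedI2)
  moreover have "norm x0 \<ge> R" using x0 M c by (smt (verit) divide_nonneg_pos real_sqrt_ge_zero)
  ultimately show ?thesis using out[of x0] by (simp add: k_def q_def)
qed

lemma measure_disjoint_triple:
  assumes m: "A \<in> lmeasurable" "B \<in> lmeasurable" "C \<in> lmeasurable"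
    and d: "A \<inter> B = {}" "A \<inter> C = {}" "B \<inter> C = {}"
    and Z: "negligible Z" and S: "S = A \<union> B \<union> C \<union> Z"
  shows "measure lebesgue S = measure lebesgue A + measure lebesgue B + measure lebesgue C"
proof -
  have "negligible ((A \<union> B \<union> C) - S \<union> (S - (A \<union> B \<union> C)))"
    by (rule negligible_subset[OF Z]) (auto simp: S)
  then have "measure lebesgue S = measure lebesgue (A \<union> B \<union> C)"
    using m by (intro measure_negligible_symdiff) auto
  also have "\<dots> = measure lebesgue A + measure lebesgue B + measure lebesgue C"
    using measure_Un3[OF m(1,2)] measure_Un3[OF fmeasurable.Un[OF m(1,2)] m(3)] d
    by (simp add: Int_Un_distrib2)
  finally show ?thesis .
qed

text \<open>The ball of radius \<open>R'\<close> splits into the contact set and the regions \<open>N\<close> and \<open>P\<close> where the solution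
  \<open>w\<close> of the double obstacle problem lies below or above \<open>v\<close>. The areas of their images under
  \<open>x + t G x\<close> are quadratic polynomials in \<open>t\<close> that add up to that of the ball, which is
  \<open>det (I + t A)\<close> times its area because \<open>w\<close> equals the quadratic function outside. Comparing the
  coefficients of \<open>t\<^sup>2\<close> expresses \<open>det A\<close> times the area of the ball as a sum of three terms, each of
  which is at most the integral of \<open>f\<close> over the respective part.\<close>

theorem (in bounded_hessian) det_le_integral:
  fixes A :: "real^2^2"
  assumes sym: "\<And>x y. x \<bullet> (A *v y) = y \<bullet> (A *v x)"
    and le: "\<And>x. \<bar>x \<bullet> (A *v x)\<bar> \<le> c * (x \<bullet> x)" and c: "0 \<le> c" "c < 1"
    and out: "\<And>x. norm x \<ge> R \<Longrightarrow> v x = x \<bullet> (A *v x) / 2"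
  obtains R' where "R \<le> R'"
    "\<And>f. \<lbrakk>f integrable_on cball 0 R'; \<And>x. \<bar>trace (H x)\<bar> - 1 \<le> f x;
       \<And>x. (\<And>h. \<bar>h \<bullet> (H x *v h)\<bar> \<le> h \<bullet> h) \<Longrightarrow> det (H x) \<le> f x\<rbrakk>
      \<Longrightarrow> det A * measure lebesgue (cball (0::real^2) R') \<le> integral (cball 0 R') f"
proof -
  define q where "q = (\<lambda>x. x \<bullet> (A *v x) / 2)"
  have symm: "x \<bullet> (- A *v y) = y \<bullet> (- A *v x)" for x y
    using sym[of x y] by (simp add: uminus_matrix_vector_mult)
  have "c * (x \<bullet> x) \<le> 1 * (x \<bullet> x)" for x :: "real^2"
    using c by (intro mult_right_mono) auto
  then have le1: "\<bar>x \<bullet> (A *v x)\<bar> \<le> x \<bullet> x" for x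
    using le[of x] by (smt (verit) mult_1)
  have sq: "semiconvex q" unfolding q_def
    using le1 by (intro semiconvex_quadratic sym) (smt (verit))
  have "semiconvex (\<lambda>x. x \<bullet> (- A *v x) / 2)"
    using le1 by (intro semiconvex_quadratic symm) (simp add: uminus_matrix_vector_mult, smt (verit))
  then have sq': "semiconvex (\<lambda>x. - q x)" by (simp add: q_def uminus_matrix_vector_mult)
  have cq: "continuous_on S q" for S
    unfolding q_def by (intro continuous_intros matrix_vector_mult_linear_continuous_on) auto
  obtain M where M: "M > 0" "\<And>x. \<bar>v x - q x\<bar> \<le> M"
  proof -
    have "compact ((\<lambda>x. v x - q x) ` cball 0 R)"
      by (intro compact_continuous_image continuous_intros continuous_v cq) auto
    then have "bounded ((\<lambda>x. v x - q x) ` cball 0 R)" by (rule compact_imp_bounded)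
    then obtain M where M: "M > 0" "\<And>x. x \<in> cball 0 R \<Longrightarrow> \<bar>v x - q x\<bar> \<le> M"
      unfolding bounded_pos by auto
    have "\<bar>v x - q x\<bar> \<le> M" for x
      using M out[of x] by (cases "norm x \<le> R") (auto simp: q_def)
    with M(1) show thesis using that by blast
  qed
  obtain w where w: "semiconvex w" "semiconvex (\<lambda>x. - w x)"
    "unliftable w v" "unliftable (\<lambda>x. - w x) (\<lambda>x. - v x)"
    using double_obstacle_solution[OF sq sq' M(2)] by blast
  obtain G where pg: "parabolic_gradient w G" using parabolic_gradient_exists[OF w(1,2)] by blast
  have ne: "nonexpansive G" by (rule parabolic_gradientD(3)[OF pg])
  interpret mi: bounded_hessian "\<lambda>x. - v x" "\<lambda>x. - g x" "\<lambda>x. - H x" L by (rule bounded_hessian_uminus)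
  define R' where "R' = max 0 R + sqrt (2 * M / (1 - c))"
  have sqrt0: "sqrt (2 * M / (1 - c)) > 0" using M c by simp
  have R': "R' > 0" "R' \<ge> R" using sqrt0 unfolding R'_def by linarith+
  \<comment> \<open>barriers from both sides pin w to the quadratic function far away\<close>
  have far: "w x = q x" if "norm x \<ge> R'" for x
  proof -
    have x: "norm x \<ge> R + sqrt (2 * M / (1 - c))" using that by (simp add: R'_def)
    have "v x \<le> w x"
    proof (rule unliftable_barrier[OF sym _ c out _ _ w(3) x])
      show "- (c * (y \<bullet> y)) \<le> y \<bullet> (A *v y)" for y using le[of y] by linarith
      show "y \<bullet> (A *v y) / 2 - M \<le> v y" for y using M(2)[of y] unfolding q_def by linarith
    qed (use M in auto)
    moreover have "- v x \<le> - w x"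
    proof (rule unliftable_barrier[OF symm _ c _ _ _ w(4) x])
      show "- (c * (y \<bullet> y)) \<le> y \<bullet> (- A *v y)" for y
        using le[of y] unfolding uminus_matrix_vector_mult inner_minus_right by linarith
      show "y \<bullet> (- A *v y) / 2 - M \<le> - v y" for y
        using M(2)[of y] unfolding q_def uminus_matrix_vector_mult inner_minus_right by linarith
      show "- v y = y \<bullet> (- A *v y) / 2" if "norm y \<ge> R" for y
        using out[OF that] by (simp add: uminus_matrix_vector_mult)
    qed (use M in auto)
    moreover have "v x = q x" using out[of x] that R' by (simp add: q_def)
    ultimately show ?thesis by simp
  qed
  have Gfar: "G x = A *v x" if "norm x > R'" for x
  proof -
    have "(q has_derivative (\<lambda>h. (A *v x) \<bullet> h)) (at x)"
    proof -
      have "((\<lambda>x. x \<bullet> (A *v x) / 2) has_derivative (\<lambda>h. (x \<bullet> (A *v h) + h \<bullet> (A *v x)) / 2)) (at x)"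
        by (auto intro!: derivative_eq_intros bounded_linear.has_derivative[OF matrix_vector_mul_bounded_linear])
      then show ?thesis unfolding q_def
        by (rule has_derivative_eq_rhs) (simp add: fun_eq_iff sym[of x] inner_commute)
    qed
    moreover have "(q has_derivative (\<lambda>h. G x \<bullet> h)) (at x)"
    proof (rule has_derivative_transform_within_open[OF parabolic_gradient_has_derivative[OF pg]])
      show "open (- cball 0 R')" "x \<in> - cball 0 R'" using that by auto
      show "w y = q y" if "y \<in> - cball 0 R'" for y using far that by auto
    qed
    ultimately have "(\<lambda>h. G x \<bullet> h) = (\<lambda>h. (A *v x) \<bullet> h)" using has_derivative_unique by blast
    then have "(G x - A *v x) \<bullet> (G x - A *v x) = 0"
      by (simp add: inner_diff_left fun_eq_iff)
    then show ?thesis by simp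
  qed
  define \<Omega> N P C where "\<Omega> = cball (0::real^2) R'" and "N = {x. w x < v x}" and "P = {x. v x < w x}"
    and "C = {x \<in> \<Omega>. w x = v x}"
  define C' where "C' = {x \<in> C. G x = g x}"
  have vq: "v x = q x" if "norm x \<ge> R'" for x using out[of x] that R' by (simp add: q_def)
  have "w x = v x" if "x \<notin> \<Omega>" for x using that far[of x] vq[of x] by (simp add: \<Omega>_def)
  then have sub: "N \<subseteq> \<Omega>" "P \<subseteq> \<Omega>" unfolding N_def P_def by (metis (no_types, lifting) less_irrefl mem_Collect_eq subsetI)+
  have "\<Omega> = C \<union> N \<union> P" using sub by (auto simp: C_def N_def P_def)
  note cont = continuous_v parabolic_gradient_continuous[OF pg] continuous_g
  have ops: "open N" "open P" unfolding N_def P_def by (intro open_Collect_less cont)+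
  have bdd: "bounded \<Omega>" "bounded N" "bounded P" "bounded C" "bounded C'"
  proof -
    show "bounded \<Omega>" by (simp add: \<Omega>_def)
    moreover have "C \<subseteq> \<Omega>" "C' \<subseteq> \<Omega>" by (auto simp: C_def C'_def)
    ultimately show "bounded N" "bounded P" "bounded C" "bounded C'"
      using sub bounded_subset by blast+
  qed
  have "closed C" "closed C'"
  proof -
    have "C = cball 0 R' \<inter> {x. w x = v x}" "C' = cball 0 R' \<inter> {x. w x = v x} \<inter> {x. G x = g x}"
      by (auto simp: C_def C'_def \<Omega>_def)
    then show "closed C" "closed C'" by (auto intro!: closed_Int closed_Collect_eq cont)
  qed
  have sets: "\<Omega> \<in> sets lebesgue" "N \<in> sets lebesgue" "P \<in> sets lebesgue" "C \<in> sets lebesgue" "C' \<in> sets lebesgue"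
    using ops \<open>closed C\<close> \<open>closed C'\<close> by (auto simp: \<Omega>_def intro: borel_open borel_closed)
  have negC: "negligible (C - C')"
    by (rule negligible_subset[OF transversal_contact_negligible[OF pg]]) (auto simp: C_def C'_def)
  have PG: "parabolic_gradient (\<lambda>x. - w x) (\<lambda>x. - G x)" by (rule parabolic_gradient_minus[OF pg])
  obtain a b where ab:
    "\<And>t. \<bar>t\<bar> < 1 \<Longrightarrow> measure lebesgue (displace t G ` N) = measure lebesgue N + t * a + t\<^sup>2 * b"
    "b \<le> - integral N (\<lambda>x. trace (H x)) - measure lebesgue N"
    using noncontact_area[OF w(1) pg w(3) N_def bdd(2)] by blast
  have P_eq: "P = {x. - w x < - v x}" by (simp add: P_def)
  \<comment> \<open>the region above v is the region below for the negated functions\<close>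
  obtain a' b' where ab':
    "\<And>t. \<bar>t\<bar> < 1 \<Longrightarrow> measure lebesgue (displace t (\<lambda>x. - G x) ` P) = measure lebesgue P + t * a' + t\<^sup>2 * b'"
    "b' \<le> - integral P (\<lambda>x. trace (- H x)) - measure lebesgue P"
    using mi.noncontact_area[OF w(2) PG w(4) P_eq bdd(3)] by blast
  define T D where "T = integral C' (\<lambda>x. trace (H x))" and "D = integral C' (\<lambda>x. det (H x))"
  define mu where "mu = (measure lebesgue :: (real^2) set \<Rightarrow> real)"
  have omega: "\<Omega> \<in> lmeasurable" by (simp add: \<Omega>_def)
  have split: "mu (displace t G ` \<Omega>) = mu (displace t G ` C') + mu (displace t G ` N) + mu (displace t G ` P)"
    if t: "\<bar>t\<bar> < 1" for t
    unfolding mu_def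
  proof (rule measure_disjoint_triple)
    have "compact C'" using \<open>closed C'\<close> bdd by (simp add: compact_eq_bounded_closed)
    then show "displace t G ` C' \<in> lmeasurable"
      by (intro lmeasurable_compact compact_continuous_image displace_continuous_on ne)
    show "displace t G ` N \<in> lmeasurable" "displace t G ` P \<in> lmeasurable"
      by (intro lmeasurable_open displace_image_open displace_image_bounded ne t ops bdd)+
    have "displace t G ` X \<inter> displace t G ` Y = {}" if "X \<inter> Y = {}" for X Y
      using that image_Int[OF displace_inj[OF ne t, of UNIV]] by (metis image_empty)
    moreover have "C' \<inter> N = {}" "C' \<inter> P = {}" "N \<inter> P = {}" by (auto simp: C'_def C_def N_def P_def)
    ultimately show "displace t G ` C' \<inter> displace t G ` N = {}" "displace t G ` C' \<inter> displace t G ` P = {}"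
      "displace t G ` N \<inter> displace t G ` P = {}" by blast+
    show "negligible (displace t G ` (C - C'))" by (rule displace_negligible[OF ne negC])
    have "\<Omega> = C' \<union> N \<union> P \<union> (C - C')" using \<open>\<Omega> = C \<union> N \<union> P\<close> by (auto simp: C'_def)
    then show "displace t G ` \<Omega> = displace t G ` C' \<union> displace t G ` N \<union> displace t G ` P \<union> displace t G ` (C - C')"
      by (metis image_Un)
  qed
  have total: "mu \<Omega> = mu C' + mu N + mu P"
    using split[of 0] by (simp add: displace_def)
  \<comment> \<open>linearity transfers the Lipschitz bound of G far away to all of the plane\<close>
  have neA: "nonexpansive (\<lambda>x. A *v x)"
    unfolding nonexpansive_def
  proof (intro allI)
    fix x y :: "real^2"
    show "norm (A *v y - A *v x) \<le> norm (y - x)"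
    proof (cases "y = x")
      case False
      define z s where "z = y - x" and "s = (R' + 1) / norm z"
      have s: "s > 0" "norm (s *\<^sub>R z) > R'" "norm ((2 * s) *\<^sub>R z) > R'"
        using False R' by (auto simp: s_def z_def)
      have d: "(2 * s) *\<^sub>R a - s *\<^sub>R a = s *\<^sub>R a" for a :: "real^2"
        by (simp flip: scaleR_left_diff_distrib)
      have "A *v (s *\<^sub>R z) = G ((2 * s) *\<^sub>R z) - G (s *\<^sub>R z)"
        unfolding Gfar[OF s(2)] Gfar[OF s(3)] by (simp only: matrix_vector_mult_scaleR d)
      then have "norm (A *v (s *\<^sub>R z)) \<le> norm ((2 * s) *\<^sub>R z - s *\<^sub>R z)"
        using nonexpansiveD[OF ne] by metis
      also have "(2 * s) *\<^sub>R z - s *\<^sub>R z = s *\<^sub>R z" by (rule d)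
      finally have "norm (A *v z) \<le> norm z" using s(1) by (simp add: matrix_vector_mult_scaleR)
      then show ?thesis by (simp add: z_def matrix_vector_mult_diff_distrib)
    qed simp
  qed
  have omega_area: "mu (displace t G ` \<Omega>) = mu \<Omega> + t * (trace A * mu \<Omega>) + t\<^sup>2 * (det A * mu \<Omega>)"
    if t: "\<bar>t\<bar> < 1" for t
  proof -
    have "displace t G ` \<Omega> = displace t (\<lambda>x. A *v x) ` \<Omega>"
      by (rule displace_image_eq[OF ne neA t]) (use Gfar in \<open>auto simp: \<Omega>_def\<close>)
    moreover have "((\<lambda>x. A *v x) has_derivative (\<lambda>h. A *v h)) (at x)" for x
      by (rule bounded_linear_imp_has_derivative) (rule matrix_vector_mul_bounded_linear)
    note displace_area_differentiable(4)[OF neA sets(1) bdd(1) this t]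
    moreover have "integral \<Omega> (\<lambda>x. k) = k * mu \<Omega>" for k :: real
      using lmeasure_integral[OF omega] integral_mult_right[of \<Omega> k "\<lambda>_. 1"] by (simp add: mu_def)
    ultimately show ?thesis by (simp add: mu_def)
  qed
  have C'_area: "mu (displace t G ` C') = mu C' + t * T + t\<^sup>2 * D" if t: "\<bar>t\<bar> * L < 1" for t
  proof -
    have "displace t G ` C' = displace t g ` C'"
      by (intro image_cong) (auto simp: C'_def displace_def)
    then show ?thesis using displace_area(4)[OF sets(5) bdd(5) t] by (simp add: mu_def T_def D_def)
  qed
  have P_area: "mu (displace t G ` P) = mu P - t * a' + t\<^sup>2 * b'" if t: "\<bar>t\<bar> < 1" for t
  proof -
    have "displace t G = displace (- t) (\<lambda>x. - G x)" by (simp add: displace_def fun_eq_iff)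
    then show ?thesis using ab'(1)[of "- t"] t by (simp add: mu_def)
  qed
  have lam: "det A * mu \<Omega> = D + b + b'"
  proof -
    \<comment> \<open>adding the identities for t and - t leaves only the even coefficients\<close>
    define t where "t = min 1 (1 / L) / 2"
    have t: "t > 0" "\<bar>t\<bar> < 1" "\<bar>- t\<bar> < 1" "\<bar>t\<bar> * L < 1" "\<bar>- t\<bar> * L < 1"
      using L_pos by (auto simp: t_def min_def field_simps)
    have "mu \<Omega> + s * (trace A * mu \<Omega>) + s\<^sup>2 * (det A * mu \<Omega>) =
        (mu C' + s * T + s\<^sup>2 * D) + (mu N + s * a + s\<^sup>2 * b) + (mu P - s * a' + s\<^sup>2 * b')"
      if "\<bar>s\<bar> < 1" "\<bar>s\<bar> * L < 1" for s
      using split[OF that(1)] omega_area[OF that(1)] C'_area[OF that(2)] P_area[OF that(1)] ab(1)[OF that(1)]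
      by (simp add: mu_def)
    from this[OF t(2,4)] this[OF t(3,5)]
    have "t\<^sup>2 * (det A * mu \<Omega>) = t\<^sup>2 * (D + b + b')"
      using total by (simp add: algebra_simps)
    then show ?thesis using t(1) by simp
  qed
  have key: "det A * mu \<Omega> \<le> integral \<Omega> f"
    if f: "f integrable_on \<Omega>" "\<And>x. \<bar>trace (H x)\<bar> - 1 \<le> f x"
       "\<And>x. (\<And>h. \<bar>h \<bullet> (H x *v h)\<bar> \<le> h \<bullet> h) \<Longrightarrow> det (H x) \<le> f x" for f
  proof -
    have one: "((\<lambda>x. 1) has_integral mu S) S" if "S \<in> sets lebesgue" "bounded S" for S
      using bounded_set_imp_lmeasurable[OF that(2,1)] unfolding mu_def by (rule has_integral_one)
    have fS: "f integrable_on S" if "S \<in> sets lebesgue" "S \<subseteq> \<Omega>" for S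
    proof -
      have bS: "bounded S" using that(2) bdd(1) bounded_subset by blast
      have "(\<lambda>x. f x + 1) integrable_on \<Omega>"
        using one[OF sets(1) bdd(1)] by (intro integrable_add f) blast
      moreover have "0 \<le> f x + 1" for x using f(2)[of x] by linarith
      ultimately have "(\<lambda>x. f x + 1) absolutely_integrable_on \<Omega>"
        by (intro nonnegative_absolutely_integrable_1)
      then have "(\<lambda>x. f x + 1) absolutely_integrable_on S"
        using that by (rule set_integrable_subset)
      then have "(\<lambda>x. f x + 1) integrable_on S" by (rule set_lebesgue_integral_eq_integral(1))
      moreover have "(\<lambda>x. 1 :: real) integrable_on S" using one[OF that(1) bS] by blast
      ultimately have "(\<lambda>x. (f x + 1) - 1) integrable_on S" by (rule integrable_diff)
      then show ?thesis by simp
    qed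
    have subs: "C' \<subseteq> \<Omega>" "N \<subseteq> \<Omega>" "P \<subseteq> \<Omega>" using sub by (auto simp: C'_def C_def)
    have fN: "- integral N (\<lambda>x. trace (H x)) - mu N \<le> integral N f"
    proof (rule has_integral_le)
      show "((\<lambda>x. - trace (H x) - 1) has_integral - integral N (\<lambda>x. trace (H x)) - mu N) N"
        by (intro has_integral_diff has_integral_neg integrable_integral one displace_area(1) sets bdd)
      show "(f has_integral integral N f) N" by (intro integrable_integral fS sets subs)
      show "- trace (H x) - 1 \<le> f x" for x using f(2)[of x] by linarith
    qed
    have fP: "integral P (\<lambda>x. trace (H x)) - mu P \<le> integral P f"
    proof (rule has_integral_le)
      show "((\<lambda>x. trace (H x) - 1) has_integral integral P (\<lambda>x. trace (H x)) - mu P) P"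
        by (intro has_integral_diff integrable_integral one displace_area(1) sets bdd)
      show "(f has_integral integral P f) P" by (intro integrable_integral fS sets subs)
      show "trace (H x) - 1 \<le> f x" for x using f(2)[of x] by linarith
    qed
    have fC: "D \<le> integral C' f"
    proof -
      \<comment> \<open>the points where det (H x) is not known to be below f x form a null set\<close>
      define Z where "Z = {x. G x = g x \<and> (\<exists>h. h \<bullet> h < \<bar>h \<bullet> (H x *v h)\<bar>)}"
      have Z: "negligible Z" unfolding Z_def by (rule large_hessian_contact_negligible[OF ne])
      have "(f has_integral integral C' f) C'" by (intro integrable_integral fS sets subs)
      then have "((\<lambda>x. if x \<in> Z then det (H x) else f x) has_integral integral C' f) C'"
        by (rule has_integral_spike[OF Z, rotated]) auto
      moreover have "((\<lambda>x. det (H x)) has_integral D) C'"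
        unfolding D_def by (intro integrable_integral displace_area(2) sets bdd)
      moreover have "det (H x) \<le> (if x \<in> Z then det (H x) else f x)" if "x \<in> C'" for x
        using that f(3)[of x] by (auto simp: Z_def C'_def not_less)
      ultimately show ?thesis by (intro has_integral_le[of _ D C' _ "integral C' f"])
    qed
    have "(f has_integral (integral C' f + integral N f) + integral P f) ((C' \<union> N) \<union> P)"
      by (intro has_integral_Un integrable_integral fS sets subs)
        (auto simp: C'_def C_def N_def P_def intro!: negligible_subset[OF negligible_empty])
    moreover have "negligible {x \<in> (C' \<union> N) \<union> P - \<Omega>. f x \<noteq> 0}"
      by (rule negligible_subset[OF negligible_empty]) (use subs in auto)
    moreover have "negligible {x \<in> \<Omega> - ((C' \<union> N) \<union> P). f x \<noteq> 0}"
      by (rule negligible_subset[OF negC]) (use \<open>\<Omega> = C \<union> N \<union> P\<close> in auto)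
    ultimately have "(f has_integral (integral C' f + integral N f) + integral P f) \<Omega>"
      using has_integral_spike_set_eq by blast
    then have "integral \<Omega> f = integral C' f + integral N f + integral P f" by (rule integral_unique)
    moreover have "trace (- H x) = - trace (H x)" for x by (simp add: trace_def sum_negf)
    then have "b' \<le> integral P (\<lambda>x. trace (H x)) - mu P" using ab'(2) by (simp add: mu_def)
    moreover have "b \<le> - integral N (\<lambda>x. trace (H x)) - mu N" using ab(2) by (simp add: mu_def)
    ultimately show ?thesis using lam fN fP fC by linarith
  qed
  show thesis
    by (rule that[of R']) (use R' key in \<open>auto simp: \<Omega>_def mu_def\<close>)
qed

section \<open>Smooth functions of compact support\<close>

lemma partial_deriv_gradient:
  assumes "f differentiable (at x)"
  shows "(f has_derivative (\<lambda>h. (\<chi> i. partial_deriv i f x) \<bullet> h)) (at x)"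
proof -
  have d: "(f has_derivative frechet_derivative f (at x)) (at x)"
    using assms by (simp add: frechet_derivative_works)
  then interpret D: bounded_linear "frechet_derivative f (at x)" by (rule has_derivative_bounded_linear)
  have "frechet_derivative f (at x) h = (\<chi> i. partial_deriv i f x) \<bullet> h" for h
  proof -
    have "frechet_derivative f (at x) h = frechet_derivative f (at x) (\<Sum>i\<in>UNIV. h $ i *\<^sub>R axis i 1)"
      by (simp add: basis_expansion scalar_mult_eq_scaleR[symmetric])
    also have "\<dots> = (\<Sum>i\<in>UNIV. h $ i * partial_deriv i f x)"
      by (simp add: D.sum D.scaleR partial_deriv_def)
    finally show ?thesis by (simp add: inner_vec_def mult.commute)
  qed
  with d show ?thesis by (metis (no_types, lifting) has_derivative_eq_rhs ext)
qed

text \<open>The mean value theorem twice: for \<open>u (a + y) - u y\<close> along \<open>b\<close>, and for \<open>b \<bullet> g\<close> along \<open>a\<close>.\<close>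

lemma second_difference:
  fixes u :: "real^'n \<Rightarrow> real" and g :: "real^'n \<Rightarrow> real^'n"
  assumes u: "\<And>x. (u has_derivative (\<lambda>h. g x \<bullet> h)) (at x)"
    and g: "\<And>x. (g has_derivative (\<lambda>h. K x *v h)) (at x)"
  obtains z where "norm (z - x) \<le> norm a + norm b"
    "u (x + a + b) - u (x + a) - u (x + b) + u x = b \<bullet> (K z *v a)"
proof -
  have "((\<lambda>y. u (a + y)) has_derivative (\<lambda>h. g (a + y) \<bullet> h)) (at y)" for y
    by (rule has_derivative_compose[OF _ u, of "\<lambda>y. a + y" "\<lambda>h. h", simplified])
      (auto intro!: derivative_eq_intros)
  then have 1: "((\<lambda>y. u (a + y) - u y) has_derivative (\<lambda>h. (g (a + y) - g y) \<bullet> h)) (at y)" for y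
    using has_derivative_diff[OF _ u] by (simp add: inner_diff_left)
  obtain y where y: "y \<in> closed_segment x (x + b)"
    "(u (a + (x + b)) - u (x + b)) - (u (a + x) - u x) = (g (a + y) - g y) \<bullet> (x + b - x)"
    using mvt_segment[OF 1] by blast
  have 2: "((\<lambda>y. b \<bullet> g y) has_derivative (\<lambda>h. b \<bullet> (K y *v h))) (at y)" for y
    by (rule has_derivative_inner_right[OF g])
  obtain z where z: "z \<in> closed_segment y (a + y)"
    "b \<bullet> g (a + y) - b \<bullet> g y = b \<bullet> (K z *v (a + y - y))"
    using mvt_segment[OF 2] by blast
  have "norm (z - x) \<le> norm (z - y) + norm (y - x)" using norm_triangle_ineq[of "z - y" "y - x"] by simp
  also have "\<dots> \<le> norm a + norm b"
    using segment_bound(1)[OF y(1)] segment_bound(1)[OF z(1)] by (intro add_mono) auto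
  finally show thesis
    using y(2) z(2) that[of z] by (simp add: inner_commute inner_diff_right inner_diff_left add.commute add.left_commute)
qed

text \<open>The second difference of \<open>u\<close> is symmetric in the two increments; at increments \<open>s a\<close>, \<open>s b\<close> with small
  \<open>s\<close> both sides approach \<open>s\<^sup>2\<close> times the mixed derivatives at \<open>x\<close>.\<close>

lemma hessian_symmetric:
  fixes u :: "real^'n \<Rightarrow> real" and g :: "real^'n \<Rightarrow> real^'n"
  assumes u: "\<And>x. (u has_derivative (\<lambda>h. g x \<bullet> h)) (at x)"
    and g: "\<And>x. (g has_derivative (\<lambda>h. K x *v h)) (at x)"
    and K: "continuous_on UNIV K"
  shows "a \<bullet> (K x *v b) = b \<bullet> (K x *v a)"
proof (rule ccontr)
  define f where "f = (\<lambda>a b y. b \<bullet> (K y *v a))"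
  assume "a \<bullet> (K x *v b) \<noteq> b \<bullet> (K x *v a)"
  then have ne: "f a b x \<noteq> f b a x" by (simp add: f_def)
  define e where "e = \<bar>f a b x - f b a x\<bar> / 2"
  have e: "e > 0" using ne by (simp add: e_def)
  have cf: "isCont (f a b) x" for a b
  proof -
    have "continuous_on UNIV (f a b)"
      unfolding f_def matrix_vector_mult_def using K by (intro continuous_intros) auto
    then show ?thesis by (simp add: continuous_on_eq_continuous_at)
  qed
  obtain d where d: "d > 0" "\<And>y. dist y x < d \<Longrightarrow> dist (f a b y) (f a b x) < e"
    using cf[of a b] e unfolding continuous_at_eps_delta by blast
  obtain d' where d': "d' > 0" "\<And>y. dist y x < d' \<Longrightarrow> dist (f b a y) (f b a x) < e"
    using cf[of b a] e unfolding continuous_at_eps_delta by blast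
  define n where "n = norm a + norm b + 1"
  define s where "s = min d d' / (2 * n)"
  have n: "0 < n" using norm_ge_zero[of a] norm_ge_zero[of b] unfolding n_def by linarith
  then have s: "s > 0" using d d' by (simp add: s_def)
  have "s * (norm a + norm b) \<le> s * n" using s by (simp add: n_def)
  also have "\<dots> = min d d' / 2" using n by (simp add: s_def)
  also have "\<dots> < min d d'" using d(1) d'(1) by linarith
  finally have sd: "norm (s *\<^sub>R a) + norm (s *\<^sub>R b) < min d d'" using s by (simp add: algebra_simps)
  obtain z where z: "norm (z - x) \<le> norm (s *\<^sub>R a) + norm (s *\<^sub>R b)"
    "u (x + s *\<^sub>R a + s *\<^sub>R b) - u (x + s *\<^sub>R a) - u (x + s *\<^sub>R b) + u x = (s *\<^sub>R b) \<bullet> (K z *v (s *\<^sub>R a))"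
    using second_difference[OF u g] by blast
  obtain z' where z': "norm (z' - x) \<le> norm (s *\<^sub>R b) + norm (s *\<^sub>R a)"
    "u (x + s *\<^sub>R b + s *\<^sub>R a) - u (x + s *\<^sub>R b) - u (x + s *\<^sub>R a) + u x = (s *\<^sub>R a) \<bullet> (K z' *v (s *\<^sub>R b))"
    using second_difference[OF u g] by blast
  have swap: "x + s *\<^sub>R b + s *\<^sub>R a = x + s *\<^sub>R a + s *\<^sub>R b" by simp
  have "(s *\<^sub>R b) \<bullet> (K z *v (s *\<^sub>R a)) = (s *\<^sub>R a) \<bullet> (K z' *v (s *\<^sub>R b))"
    using z(2) z'(2) unfolding swap by linarith
  then have "f a b z = f b a z'" using s by (simp add: f_def matrix_vector_mult_scaleR)
  moreover have "\<bar>f a b z - f a b x\<bar> < e" "\<bar>f b a z' - f b a x\<bar> < e"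
    using d(2)[of z] d'(2)[of z'] z(1) z'(1) sd by (simp_all add: dist_norm)
  moreover have "\<bar>f a b x - f b a x\<bar> = 2 * e" by (simp add: e_def)
  ultimately show False by linarith
qed

lemma Cc_infinity_gradient_hessian:
  fixes u :: "real^2 \<Rightarrow> real"
  assumes "u \<in> Cc_infinity"
  defines "g \<equiv> \<lambda>x. \<chi> i. partial_deriv i u x"
  shows "\<And>x. (u has_derivative (\<lambda>h. g x \<bullet> h)) (at x)"
    and "\<And>x. (g has_derivative (\<lambda>h. hessian u x *v h)) (at x)"
    and "continuous_on UNIV (hessian u)"
    and "\<And>x. transpose (hessian u x) = hessian u x"
proof -
  have C: "C_times (Suc (Suc 0)) u" using assms(1) unfolding Cc_infinity_def smooth_def by blast
  have d: "u differentiable (at x)" "partial_deriv i u differentiable (at x)" for i x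
    using C by (auto simp: differentiable_on_def)
  show u: "(u has_derivative (\<lambda>h. g x \<bullet> h)) (at x)" for x
    unfolding g_def by (rule partial_deriv_gradient[OF d(1)])
  define K where "K = (\<lambda>x. transpose (hessian u x))"
  have ch: "continuous_on UNIV (hessian u)"
    unfolding hessian_def using C by (intro continuous_on_vec_lambda) auto
  then show "continuous_on UNIV (hessian u)" .
  have cK: "continuous_on UNIV K"
    unfolding K_def hessian_def transpose_def using C by (intro continuous_on_vec_lambda) auto
  have gK: "(g has_derivative (\<lambda>h. K x *v h)) (at x)" for x
  proof -
    have "((\<lambda>x. g x $ i) has_derivative (\<lambda>h. (K x *v h) $ i)) (at x)" for i
      using partial_deriv_gradient[OF d(2)[of i x]]
      by (simp add: g_def K_def matrix_vector_mul_component transpose_def hessian_def)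
    note comp = this
    show ?thesis
      unfolding has_derivative_componentwise_within[of g]
    proof
      fix b :: "real^2" assume "b \<in> Basis"
      then obtain i where "b = axis i 1" by (auto simp: Basis_vec_def)
      then show "((\<lambda>x. g x \<bullet> b) has_derivative (\<lambda>h. (K x *v h) \<bullet> b)) (at x)"
        using comp[of i] by (simp add: inner_axis)
    qed
  qed
  have "transpose (K x) = K x" for x
  proof -
    have "K x $ i $ j = K x $ j $ i" for i j
      using hessian_symmetric[OF u gK cK, of "axis i 1" x "axis j 1"]
      by (simp add: inner_axis' matrix_vector_mul_component inner_axis)
    then show ?thesis by (simp add: transpose_def vec_eq_iff)
  qed
  then show "transpose (hessian u x) = hessian u x" for x by (metis K_def transpose_transpose)
  then show "(g has_derivative (\<lambda>h. hessian u x *v h)) (at x)" for x using gK[of x] by (simp add: K_def)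
qed

lemma Cc_infinity_support:
  fixes u :: "real^'n::finite \<Rightarrow> real"
  assumes "u \<in> Cc_infinity"
  shows "\<exists>R. \<forall>x. norm x \<ge> R \<longrightarrow> u x = 0 \<and> (\<forall>i. partial_deriv i u x = 0) \<and> hessian u x = 0"
proof -
  define K where "K = closure {x. u x \<noteq> 0}"
  have "bounded K" using assms by (simp add: K_def Cc_infinity_def compact_imp_bounded)
  then obtain R where R: "\<And>x. x \<in> K \<Longrightarrow> norm x < R" unfolding bounded_pos_less by blast
  have op: "open (- K)" by (simp add: K_def open_Compl)
  have u0: "u x = 0" if "x \<in> - K" for x
    using that closure_subset[of "{x. u x \<noteq> 0}"] by (auto simp: K_def)
  note d1 = partial_deriv_zero_on_open[OF op u0]
  have far: "x \<in> - K" if "norm x \<ge> R" for x using R[of x] that by force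
  show ?thesis
  proof (intro exI allI impI conjI)
    fix x :: "real^'n" and i :: 'n assume "norm x \<ge> R"
    then have x: "x \<in> - K" by (rule far)
    show "u x = 0" using u0[OF x] .
    show "partial_deriv i u x = 0" using d1[OF _ x] by simp
    show "hessian u x = 0"
      using partial_deriv_zero_on_open[OF op d1 x] by (simp add: hessian_def vec_eq_iff)
  qed
qed

lemma quadratic_plus_Cc_infinity_bounded_hessian:
  fixes u :: "real^2 \<Rightarrow> real" and B :: "real^2^2"
  assumes u: "u \<in> Cc_infinity" and B: "\<And>x y. x \<bullet> (B *v y) = y \<bullet> (B *v x)"
  obtains L where "bounded_hessian (\<lambda>x. x \<bullet> (B *v x) / 2 + k * u x)
    (\<lambda>x. B *v x + k *\<^sub>R (\<chi> i. partial_deriv i u x)) (\<lambda>x. B + k *\<^sub>R hessian u x) L"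
proof -
  define g where "g = (\<lambda>x. \<chi> i. partial_deriv i u x)"
  note d = Cc_infinity_gradient_hessian[OF u, folded g_def]
  obtain R where R: "\<And>x. norm x \<ge> R \<Longrightarrow> hessian u x = 0"
    using Cc_infinity_support[OF u] by metis
  define H where "H = (\<lambda>x. B + k *\<^sub>R hessian u x)"
  have cH: "continuous_on S H" for S
    unfolding H_def using d(3) by (intro continuous_intros) (auto intro: continuous_on_subset)
  have "bounded (H ` cball 0 R)"
    by (intro compact_imp_bounded compact_continuous_image cH) auto
  then obtain M where M: "M > 0" "\<And>x. x \<in> cball 0 R \<Longrightarrow> norm (H x) \<le> M"
    unfolding bounded_pos by auto
  define L where "L = 4 * (M + norm B)"
  have nH: "norm (H x) \<le> M + norm B" for x
  proof (cases "norm x \<le> R")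
    case True
    then have "norm (H x) \<le> M" using M(2)[of x] by simp
    then show ?thesis using norm_ge_zero[of B] by linarith
  next
    case False
    then have "H x = B" using R[of x] by (simp add: H_def)
    then show ?thesis using M(1) by simp
  qed
  have "bounded_hessian (\<lambda>x. x \<bullet> (B *v x) / 2 + k * u x) (\<lambda>x. B *v x + k *\<^sub>R g x) H L"
  proof
    fix x h :: "real^2"
    have "((\<lambda>x. x \<bullet> (B *v x) / 2 + k * u x) has_derivative
        (\<lambda>h. (x \<bullet> (B *v h) + h \<bullet> (B *v x)) / 2 + k * (g x \<bullet> h))) (at x)"
      by (auto intro!: derivative_eq_intros d(1) bounded_linear.has_derivative[OF matrix_vector_mul_bounded_linear]
          simp: fun_eq_iff g_def field_simps)
    then show "((\<lambda>x. x \<bullet> (B *v x) / 2 + k * u x) has_derivative (\<lambda>h. (B *v x + k *\<^sub>R g x) \<bullet> h)) (at x)"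
      by (rule has_derivative_eq_rhs) (simp add: fun_eq_iff B[of x] inner_simps inner_commute)
    have "((\<lambda>x. B *v x + k *\<^sub>R g x) has_derivative (\<lambda>h. B *v h + k *\<^sub>R (hessian u x *v h))) (at x)"
      by (intro has_derivative_add has_derivative_scaleR_right d(2)
          bounded_linear_imp_has_derivative matrix_vector_mul_bounded_linear)
    then show "((\<lambda>x. B *v x + k *\<^sub>R g x) has_derivative (\<lambda>h. H x *v h)) (at x)"
      by (rule has_derivative_eq_rhs)
        (simp add: fun_eq_iff H_def matrix_vector_mult_add_rdistrib scaleR_matrix_vector_assoc)
    have "onorm ((*v) (H x)) \<le> real CARD(2) * real CARD(2) * (M + norm B)"
    proof (rule onorm_le_matrix_component)
      fix i j
      have "\<bar>H x $ i $ j\<bar> \<le> norm (H x $ i)" by (rule component_le_norm_cart)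
      also have "\<dots> \<le> norm (H x)" by (rule Finite_Cartesian_Product.norm_nth_le)
      finally show "\<bar>H x $ i $ j\<bar> \<le> M + norm B" using nH[of x] by linarith
    qed
    then have "onorm ((*v) (H x)) * norm h \<le> L * norm h"
      by (intro mult_right_mono) (simp_all add: L_def)
    then show "norm (H x *v h) \<le> L * norm h"
      using onorm[OF matrix_vector_mul_bounded_linear, of "H x" h] by linarith
    show "L > 0" using M norm_ge_zero[of B] by (simp add: L_def add_pos_nonneg)
  qed (rule cH)
  then show thesis using that by (simp add: g_def H_def)
qed

text \<open>The displacement along \<open>g\<close> maps the ball onto itself, so the polynomial for the area of its image is
  constant.\<close>

lemma (in bounded_hessian) integral_trace_eq_0:
  assumes g0: "\<And>x. norm x \<ge> R \<Longrightarrow> g x = 0"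
  shows "integral (cball 0 R) (\<lambda>x. trace (H x)) = 0"
proof -
  define E where "E = cball (0::real^2) R"
  have E: "E \<in> sets lebesgue" "bounded E" by (auto simp: E_def)
  define G where "G = (\<lambda>x. (1 / L) *\<^sub>R g x)"
  have ne: "nonexpansive G" unfolding G_def by (rule nonexpansive_scaled_gradient)
  have ne0: "nonexpansive (\<lambda>x::real^2. 0::real^2)" by (simp add: nonexpansive_def)
  have "t * integral E (\<lambda>x. trace (H x)) + t\<^sup>2 * integral E (\<lambda>x. det (H x)) = 0" if t: "\<bar>t\<bar> * L < 1" for t
  proof -
    have tL: "\<bar>t * L\<bar> < 1" using t L_pos by (simp add: abs_mult)
    have "displace (t * L) G ` E = displace (t * L) (\<lambda>x. 0) ` E"
      by (rule displace_image_eq[OF ne ne0 tL]) (use g0 in \<open>auto simp: E_def G_def\<close>)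
    moreover have "displace (t * L) G = displace t g"
      unfolding G_def by (rule displace_scaled_gradient)
    ultimately have "displace t g ` E = E" by (simp add: displace_def)
    then show ?thesis using displace_area(4)[OF E t] by simp
  qed
  from this[of "1 / (2 * L)"] this[of "- (1 / (2 * L))"]
  show ?thesis using L_pos unfolding E_def by (simp add: field_simps)
qed

section \<open>Reduction to symmetric matrices\<close>

text \<open>For \<open>p > 0\<close> the discriminant appears as the value of the form at \<open>(-q, p)\<close>.\<close>

lemma psd_binary_form:
  fixes p q r :: real
  assumes "\<And>x y. 0 \<le> p * x\<^sup>2 + 2 * q * x * y + r * y\<^sup>2"
  shows "0 \<le> p" "0 \<le> r" "q\<^sup>2 \<le> p * r"
proof -
  show p: "0 \<le> p" and r: "0 \<le> r" using assms[of 1 0] assms[of 0 1] by simp_all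
  show "q\<^sup>2 \<le> p * r"
  proof (cases "p = 0")
    case True
    have "q = 0"
    proof (rule ccontr)
      assume "q \<noteq> 0"
      then show False using assms[of "- (r + 1) / (2 * q)" 1] True by (simp add: field_simps)
    qed
    then show ?thesis using p r by simp
  next
    case False
    have "0 \<le> p * (- q)\<^sup>2 + 2 * q * (- q) * p + r * p\<^sup>2" by (rule assms)
    also have "\<dots> = p * (p * r - q\<^sup>2)" by (simp add: power2_eq_square algebra_simps)
    finally show ?thesis using False p by (simp add: zero_le_mult_iff)
  qed
qed

lemma inner_matrix_2:
  fixes M :: "real^2^2"
  shows "h \<bullet> (M *v h) = M$1$1 * (h$1)\<^sup>2 + (M$1$2 + M$2$1) * (h$1) * (h$2) + M$2$2 * (h$2)\<^sup>2"
  by (simp add: inner_vec_def sum_2 matrix_vector_mult_def power2_eq_square algebra_simps)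

lemma cmod_cminus_sq: "(cmod (cminus M))\<^sup>2 = ((M$1$1 - M$2$2) / 2)\<^sup>2 + ((M$2$1 + M$1$2) / 2)\<^sup>2"
  by (simp add: cminus_def cmod_def)

text \<open>For a symmetric matrix \<open>\<bar>tr M\<bar> / 2 + \<bar>m\<^sub>-\<bar>\<close> is the largest absolute value of an eigenvalue. The bound
  follows from the semidefiniteness of \<open>I - M\<close> and \<open>I + M\<close>.\<close>

lemma quadratic_form_le_imp_norm_le:
  fixes M :: "real^2^2"
  assumes sym: "M$1$2 = M$2$1" and le: "\<And>h. \<bar>h \<bullet> (M *v h)\<bar> \<le> h \<bullet> h"
  shows "\<bar>trace M\<bar> / 2 + cmod (cminus M) \<le> 1"
proof -
  have "0 \<le> (1 - e * M$1$1) * x\<^sup>2 + 2 * (- e * M$1$2) * x * y + (1 - e * M$2$2) * y\<^sup>2" if "e = 1 \<or> e = -1" for e x y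
  proof -
    have "\<bar>(vector [x, y] :: real^2) \<bullet> (M *v vector [x, y])\<bar> \<le> (vector [x, y] :: real^2) \<bullet> vector [x, y]"
      by (rule le)
    then have "\<bar>M$1$1 * x\<^sup>2 + (M$1$2 + M$2$1) * x * y + M$2$2 * y\<^sup>2\<bar> \<le> x\<^sup>2 + y\<^sup>2"
      unfolding inner_matrix_2 by (simp add: vector_2 inner_vec_def sum_2 power2_eq_square)
    then show ?thesis using that sym by (auto simp: abs_le_iff algebra_simps)
  qed
  note psd = psd_binary_form[OF this]
  have "cmod (cminus M) \<le> 1 - e * (trace M / 2)" if e: "e = 1 \<or> e = -1" for e
  proof (rule power2_le_imp_le)
    show "(cmod (cminus M))\<^sup>2 \<le> (1 - e * (trace M / 2))\<^sup>2"
      using e psd(3)[OF e] unfolding cmod_cminus_sq sym[symmetric] trace_def sum_2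
      by (elim disjE) (simp_all add: power2_eq_square field_simps)
    show "0 \<le> 1 - e * (trace M / 2)"
      using psd(1,2)[OF e] by (simp add: trace_def sum_2 field_simps)
  qed
  from this[of 1] this[of "-1"] show ?thesis by (simp add: abs_if)
qed

text \<open>With \<open>z = h\<^sub>1 - i h\<^sub>2\<close>, the form is \<open>tr M / 2 \<bar>z\<bar>\<^sup>2 + Re (m\<^sub>- z\<^sup>2)\<close>.\<close>

lemma quadratic_form_le:
  fixes M :: "real^2^2"
  shows "\<bar>h \<bullet> (M *v h)\<bar> \<le> (\<bar>trace M\<bar> / 2 + cmod (cminus M)) * (h \<bullet> h)"
proof -
  define z where "z = Complex (h$1) (- (h$2))"
  have hh: "h \<bullet> h = (cmod z)\<^sup>2"
    by (simp add: z_def cmod_def inner_vec_def sum_2 power2_eq_square)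
  have "h \<bullet> (M *v h) = trace M / 2 * (h \<bullet> h) + Re (cminus M * z\<^sup>2)"
    unfolding inner_matrix_2
    by (simp add: z_def cminus_def trace_def sum_2 inner_vec_def power2_eq_square field_simps)
  moreover have "\<bar>Re (cminus M * z\<^sup>2)\<bar> \<le> cmod (cminus M) * (h \<bullet> h)"
    using abs_Re_le_cmod[of "cminus M * z\<^sup>2"] by (simp add: hh norm_mult norm_power)
  moreover have "\<bar>trace M / 2 * (h \<bullet> h)\<bar> = \<bar>trace M\<bar> / 2 * (h \<bullet> h)"
    by (simp add: abs_mult)
  ultimately show ?thesis unfolding distrib_right by linarith
qed

text \<open>For \<open>\<bar>B\<bar> \<le> 1\<close> one has \<open>\<bar>b\<^sub>-\<bar> \<le> 1 - \<bar>b\<^sub>+\<bar>\<close>, and \<open>\<bar>b\<^sub>+\<bar>\<^sup>2 - (1 - \<bar>b\<^sub>+\<bar>)\<^sup>2 = 2\<bar>b\<^sub>+\<bar> - 1\<close>.\<close>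

lemma L_fun_ge: "2 * cmod (cplus B) - 1 \<le> L_fun B"
proof (cases "mnorm B \<le> 1")
  case True
  have "(cmod (cminus B))\<^sup>2 \<le> (1 - cmod (cplus B))\<^sup>2"
    using True by (intro power_mono) (simp_all add: mnorm_def)
  then show ?thesis using True
    by (simp add: L_fun_def det_complex_coordinates power2_eq_square algebra_simps)
qed (simp add: L_fun_def)

lemma L_fun_ge_det:
  assumes "cmod (cplus B) \<le> 1"
  shows "det B \<le> L_fun B"
proof (cases "mnorm B \<le> 1")
  case False
  have "(1 - cmod (cplus B))\<^sup>2 \<le> (cmod (cminus B))\<^sup>2"
    using False assms by (intro power_mono) (simp_all add: mnorm_def)
  then show ?thesis using False
    by (simp add: L_fun_def det_complex_coordinates power2_eq_square algebra_simps)
qed (simp add: L_fun_def)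

lemma cplus_add: "cplus (A + B) = cplus A + cplus B"
  by (simp add: cplus_def complex_eq_iff add_divide_distrib[symmetric] diff_divide_distrib[symmetric])

text \<open>The slope \<open>k\<close> is the real part of \<open>a\<^sub>+ / \<bar>a\<^sub>+\<bar>\<close>, because \<open>b\<^sub>+\<close> is real for symmetric \<open>B\<close>; if \<open>a\<^sub>+ = 0\<close>,
  then the division by zero makes it \<open>0\<close>, which also works.\<close>

lemma L_fun_affine_minorant:
  assumes "1 \<le> mnorm A"
  shows "\<exists>k. \<forall>B. B$1$2 = B$2$1 \<longrightarrow> k * trace B \<le> L_fun (A + B) - L_fun A"
proof -
  define p where "p = cplus A"
  have LA: "L_fun A = 2 * cmod p - 1"
  proof (cases "mnorm A = 1")
    case True
    then have "cmod (cminus A) = 1 - cmod p" by (simp add: mnorm_def p_def)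
    then have "det A = (cmod p)\<^sup>2 - (1 - cmod p)\<^sup>2" by (simp add: det_complex_coordinates p_def)
    then show ?thesis using True by (simp add: L_fun_def power2_eq_square algebra_simps)
  next
    case False
    then show ?thesis using assms(1) by (simp add: L_fun_def p_def)
  qed
  define k where "k = Re p / cmod p"
  have "k * trace B \<le> L_fun (A + B) - L_fun A" if B: "B$1$2 = B$2$1" for B
  proof -
    have cB: "cplus B = of_real (trace B / 2)"
      using B by (simp add: cplus_def trace_def sum_2 complex_eq_iff)
    have "Re (cnj p * (p + cplus B)) \<le> cmod p * cmod (p + cplus B)"
      using complex_Re_le_cmod[of "cnj p * (p + cplus B)"] by (simp add: norm_mult)
    moreover have "Re (cnj p * (p + cplus B)) = (cmod p)\<^sup>2 + Re p * (trace B / 2)"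
      unfolding cB cmod_power2 by (simp add: power2_eq_square algebra_simps)
    ultimately have le: "(cmod p)\<^sup>2 + Re p * (trace B / 2) \<le> cmod p * cmod (p + cplus B)" by simp
    have "cmod p + k * (trace B / 2) \<le> cmod (p + cplus B)"
    proof (cases "p = 0")
      case False
      then have c: "cmod p > 0" by simp
      have "cmod p * (cmod p + k * (trace B / 2)) = (cmod p)\<^sup>2 + Re p * (trace B / 2)"
        using c by (simp add: k_def power2_eq_square algebra_simps)
      then have "cmod p * (cmod p + k * (trace B / 2)) \<le> cmod p * cmod (p + cplus B)" using le by simp
      then show ?thesis using c by simp
    qed (simp add: k_def)
    then show ?thesis using L_fun_ge[of "A + B"] LA by (simp add: cplus_add p_def)
  qed
  then show ?thesis by blast
qed

theorem theorem1p1: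
  fixes A :: "real^2^2" and u :: "real^2 \<Rightarrow> real"
  assumes "u \<in> Cc_infinity"
  shows "(LINT x|lborel. L_fun (A + hessian u x) - L_fun A) \<ge> 0"
proof -
  define F where "F = (\<lambda>x. L_fun (A + hessian u x) - L_fun A)"
  have hsym: "hessian u x $ 1 $ 2 = hessian u x $ 2 $ 1" for x
    using Cc_infinity_gradient_hessian(4)[OF assms, of x] by (metis (no_types, lifting) transpose_def vec_lambda_beta)
  obtain R where R: "\<And>x. norm x \<ge> R \<Longrightarrow> u x = 0" "\<And>x i. norm x \<ge> R \<Longrightarrow> partial_deriv i u x = 0"
    "\<And>x. norm x \<ge> R \<Longrightarrow> hessian u x = 0"
    using Cc_infinity_support[OF assms] by metis
  have Fint: "(F has_integral (LINT x|lborel. F x)) UNIV"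
    unfolding F_def by (intro has_integral_integral_lborel integrable_L_fun_hessian assms)
  have F_ball: "(F has_integral (LINT x|lborel. F x)) (cball 0 r)" if "R \<le> r" for r
  proof -
    have "F x = 0" if "x \<notin> cball 0 r" for x using R(3)[of x] that \<open>R \<le> r\<close> by (simp add: F_def)
    then have "(\<lambda>x. if x \<in> cball 0 r then F x else 0) = F" by (auto simp: fun_eq_iff)
    then show ?thesis using Fint has_integral_restrict_UNIV[of "cball 0 r" F] by metis
  qed
  have "(LINT x|lborel. F x) \<ge> 0"
  proof (cases "1 \<le> mnorm A")
    case True
    obtain k where k: "\<And>B. B$1$2 = B$2$1 \<Longrightarrow> k * trace B \<le> L_fun (A + B) - L_fun A"
      using L_fun_affine_minorant[OF True] by blast
    obtain L where L: "bounded_hessian (\<lambda>x. x \<bullet> (0 *v x) / 2 + 1 * u x)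
        (\<lambda>x. 0 *v x + 1 *\<^sub>R (\<chi> i. partial_deriv i u x)) (\<lambda>x. 0 + 1 *\<^sub>R hessian u x) L"
      using quadratic_plus_Cc_infinity_bounded_hessian[OF assms, of 0 1] by auto
    interpret bounded_hessian u "\<lambda>x. \<chi> i. partial_deriv i u x" "hessian u" L
      using L by simp
    have tr0: "integral (cball 0 R) (\<lambda>x. trace (hessian u x)) = 0"
      by (rule integral_trace_eq_0) (simp add: R vec_eq_iff)
    have "(\<lambda>x. trace (hessian u x)) integrable_on cball 0 R"
      by (rule displace_area(1)) auto
    then have "((\<lambda>x. k * trace (hessian u x)) has_integral k * 0) (cball 0 R)"
      unfolding tr0[symmetric] by (intro has_integral_mult_right integrable_integral)
    then have "k * 0 \<le> (LINT x|lborel. F x)"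
      by (rule has_integral_le[OF _ F_ball[OF order_refl]]) (simp add: F_def k hsym)
    then show ?thesis by simp
  next
    case False
    define a b where "a = Re (cplus A)" and "b = Im (cplus A)"
    have lt: "cmod (cplus A) + cmod (cminus A) < 1" using False by (simp add: mnorm_def)
    have pA: "(cmod (cplus A))\<^sup>2 = a\<^sup>2 + b\<^sup>2" by (simp add: cmod_power2 a_def b_def)
    have "a\<^sup>2 + b\<^sup>2 < 1"
    proof -
      have "cmod (cplus A) < 1" using lt norm_ge_zero[of "cminus A"] by linarith
      then show ?thesis unfolding pA[symmetric] by (simp add: power_less_one_iff)
    qed
    define s where "s = sqrt (1 - b\<^sup>2)"
    have "b\<^sup>2 < 1" using \<open>a\<^sup>2 + b\<^sup>2 < 1\<close> zero_le_power2[of a] by linarith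
    then have s: "s > 0" "s\<^sup>2 = 1 - b\<^sup>2" by (simp_all add: s_def)
    have "\<bar>a\<bar> \<le> s"
      by (rule power2_le_imp_le) (use \<open>a\<^sup>2 + b\<^sup>2 < 1\<close> s in auto)
    \<comment> \<open>triangle inequality for \<open>(s, b) = (\<bar>a\<bar>, b) + (s - \<bar>a\<bar>, 0)\<close>\<close>
    have tri: "1 \<le> cmod (cplus A) + (s - \<bar>a\<bar>)"
    proof -
      have "cmod (Complex s b) \<le> cmod (Complex \<bar>a\<bar> b) + cmod (Complex (s - \<bar>a\<bar>) 0)"
        using norm_triangle_ineq[of "Complex \<bar>a\<bar> b" "Complex (s - \<bar>a\<bar>) 0"] by (simp add: complex_add)
      moreover have "cmod (Complex s b) = 1" using s by (simp add: cmod_def)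
      moreover have "cmod (Complex \<bar>a\<bar> b) = cmod (cplus A)" by (simp add: cmod_def a_def b_def)
      moreover have "cmod (Complex (s - \<bar>a\<bar>) 0) = s - \<bar>a\<bar>" using \<open>\<bar>a\<bar> \<le> s\<close> by (simp add: cmod_def)
      ultimately show ?thesis by simp
    qed
    \<comment> \<open>the symmetric part of A, rescaled so that f takes the place of L\<close>
    define S :: "real^2^2" where "S = (1 / (2 * s)) *\<^sub>R (A + transpose A)"
    have S_entries: "S$1$1 = A$1$1 / s" "S$2$2 = A$2$2 / s" "S$1$2 = (A$1$2 + A$2$1) / (2 * s)"
      "S$2$1 = (A$1$2 + A$2$1) / (2 * s)"
      by (simp_all add: S_def transpose_def)
    have Ssym: "x \<bullet> (S *v y) = y \<bullet> (S *v x)" for x y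
      by (simp add: inner_vec_def sum_2 matrix_vector_mult_def S_entries algebra_simps)
    define v g H where "v = (\<lambda>x. x \<bullet> (S *v x) / 2 + (1 / s) * u x)"
      and "g = (\<lambda>x. S *v x + (1 / s) *\<^sub>R (\<chi> i. partial_deriv i u x))"
      and "H = (\<lambda>x. S + (1 / s) *\<^sub>R hessian u x)"
    obtain L where "bounded_hessian v g H L"
      using quadratic_plus_Cc_infinity_bounded_hessian[OF assms Ssym, of "1 / s"]
      unfolding v_def g_def H_def by blast
    then interpret bounded_hessian v g H L .
    define c where "c = \<bar>trace S\<bar> / 2 + cmod (cminus S)"
    have trS: "\<bar>trace S\<bar> / 2 = \<bar>a\<bar> / s"
      using s by (simp add: trace_def sum_2 S_entries a_def cplus_def field_simps abs_mult flip: add_divide_distrib)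
    have cmS: "cminus S = cminus A / of_real s"
      using s by (simp add: cminus_def S_entries complex_eq_iff field_simps)
    have c: "0 \<le> c" "c < 1"
    proof -
      show "0 \<le> c" by (simp add: c_def)
      have "c = (\<bar>a\<bar> + cmod (cminus A)) / s"
        unfolding c_def trS cmS using s by (simp add: norm_divide add_divide_distrib)
      then show "c < 1" using tri lt s by simp
    qed
    have Sle: "\<bar>x \<bullet> (S *v x)\<bar> \<le> c * (x \<bullet> x)" for x
      unfolding c_def by (rule quadratic_form_le)
    have vout: "v x = x \<bullet> (S *v x) / 2" if "norm x \<ge> R" for x
      using R(1)[OF that] by (simp add: v_def)
    obtain R' where R': "R \<le> R'"
      "\<And>f. \<lbrakk>f integrable_on cball 0 R'; \<And>x. \<bar>trace (H x)\<bar> - 1 \<le> f x;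
         \<And>x. (\<And>h. \<bar>h \<bullet> (H x *v h)\<bar> \<le> h \<bullet> h) \<Longrightarrow> det (H x) \<le> f x\<rbrakk>
        \<Longrightarrow> det S * measure lebesgue (cball (0::real^2) R') \<le> integral (cball 0 R') f"
      using det_le_integral[OF Ssym Sle c vout] by blast
    \<comment> \<open>the antisymmetric part contributes b^2 to the determinant; what is left scales like s^2\<close>
    define f where "f = (\<lambda>x. (L_fun (A + hessian u x) - b\<^sup>2) / s\<^sup>2)"
    have pB: "cplus (A + hessian u x) = Complex (s * (trace (H x) / 2)) b" for x
      using s hsym[of x]
      by (simp add: cplus_def H_def S_entries trace_def sum_2 complex_eq_iff b_def field_simps)
    have mB: "cmod (cminus (A + hessian u x)) = s * cmod (cminus (H x))" for x
    proof -
      have "cminus (A + hessian u x) = of_real s * cminus (H x)"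
        using s by (simp add: cminus_def H_def S_entries complex_eq_iff field_simps)
      then show ?thesis using s by (simp add: norm_mult)
    qed
    have Hsym: "H x $ 1 $ 2 = H x $ 2 $ 1" for x
      using hsym by (simp add: H_def S_entries)
    have detM: "det M = (trace M / 2)\<^sup>2 - (cmod (cminus M))\<^sup>2" if "M$1$2 = M$2$1" for M :: "real^2^2"
      unfolding cmod_cminus_sq using that by (simp add: det_2 trace_def sum_2 power2_eq_square field_simps)
    \<comment> \<open>Cauchy-Schwarz against the unit vector (s, b)\<close>
    have f1: "\<bar>trace (H x)\<bar> - 1 \<le> f x" for x
    proof -
      have "cmod (Complex \<bar>s * (trace (H x) / 2)\<bar> b) = cmod (cplus (A + hessian u x))"
        unfolding pB by (simp only: cmod_def complex.sel power2_abs)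
      moreover have "Re (Complex s (- b) * Complex \<bar>s * (trace (H x) / 2)\<bar> b)
          \<le> cmod (Complex s (- b)) * cmod (Complex \<bar>s * (trace (H x) / 2)\<bar> b)"
        using complex_Re_le_cmod[of "Complex s (- b) * Complex \<bar>s * (trace (H x) / 2)\<bar> b"]
        by (simp only: norm_mult)
      moreover have "cmod (Complex s (- b)) = 1" using s by (simp add: cmod_def)
      moreover have "Re (Complex s (- b) * Complex \<bar>s * (trace (H x) / 2)\<bar> b) = s\<^sup>2 * \<bar>trace (H x)\<bar> / 2 + b\<^sup>2"
        using s by (simp add: abs_mult power2_eq_square)
      ultimately have "s\<^sup>2 * \<bar>trace (H x)\<bar> / 2 + b\<^sup>2 \<le> cmod (cplus (A + hessian u x))" by simp
      then have "s\<^sup>2 * (\<bar>trace (H x)\<bar> - 1) \<le> L_fun (A + hessian u x) - b\<^sup>2"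
        using L_fun_ge[of "A + hessian u x"] s(2) unfolding right_diff_distrib by linarith
      then show ?thesis using s(1) by (simp add: f_def field_simps)
    qed
    have f2: "det (H x) \<le> f x" if "\<And>h. \<bar>h \<bullet> (H x *v h)\<bar> \<le> h \<bullet> h" for x
    proof -
      have le: "\<bar>trace (H x)\<bar> / 2 + cmod (cminus (H x)) \<le> 1"
        by (rule quadratic_form_le_imp_norm_le[OF Hsym that])
      then have "\<bar>trace (H x)\<bar> / 2 \<le> 1" using norm_ge_zero[of "cminus (H x)"] by linarith
      then have "\<bar>trace (H x) / 2\<bar> \<le> 1" by simp
      then have "(trace (H x) / 2)\<^sup>2 \<le> 1" by (simp add: abs_square_le_1)
      then have "s\<^sup>2 * (trace (H x) / 2)\<^sup>2 \<le> s\<^sup>2 * 1" by (rule mult_left_mono) simp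
      then have "(s * (trace (H x) / 2))\<^sup>2 + b\<^sup>2 \<le> 1"
        unfolding power_mult_distrib using s(2) by linarith
      then have "cmod (cplus (A + hessian u x)) \<le> 1" unfolding pB by (simp add: cmod_def)
      then have "det (A + hessian u x) \<le> L_fun (A + hessian u x)" by (rule L_fun_ge_det)
      moreover have pB2: "(cmod (cplus (A + hessian u x)))\<^sup>2 = s\<^sup>2 * (trace (H x) / 2)\<^sup>2 + b\<^sup>2"
        by (simp only: pB cmod_power2 complex.sel power_mult_distrib)
      have "det (A + hessian u x) = s\<^sup>2 * det (H x) + b\<^sup>2"
        unfolding det_complex_coordinates[of "A + hessian u x"] pB2 mB detM[OF Hsym] power_mult_distrib
        by (simp add: right_diff_distrib)
      ultimately show ?thesis using s(1) by (simp add: f_def field_simps)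
    qed
    have LA: "L_fun A = s\<^sup>2 * det S + b\<^sup>2"
    proof -
      have "det S = (a / s)\<^sup>2 - (cmod (cminus A) / s)\<^sup>2"
      proof -
        have "(trace S / 2)\<^sup>2 = (a / s)\<^sup>2" using trS s by (metis abs_divide abs_numeral abs_of_pos power2_abs)
        then show ?thesis using detM[of S] cmS s by (simp add: S_entries norm_divide)
      qed
      then have "s\<^sup>2 * det S = a\<^sup>2 - (cmod (cminus A))\<^sup>2"
        using s(1) by (simp add: power_divide field_simps)
      then show ?thesis using lt pA by (simp add: L_fun_def mnorm_def det_complex_coordinates[of A])
    qed
    define m where "m = measure lebesgue (cball (0::real^2) R')"
    have one: "((\<lambda>x. 1) has_integral m) (cball (0::real^2) R')"
      unfolding m_def by (rule has_integral_one[OF lmeasurable_cball])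
    have fF: "f x = (1 / s\<^sup>2) * (F x + (L_fun A - b\<^sup>2) * 1)" for x by (simp add: f_def F_def)
    have fI: "(f has_integral (1 / s\<^sup>2) * ((LINT x|lborel. F x) + (L_fun A - b\<^sup>2) * m)) (cball 0 R')"
      unfolding fF by (intro has_integral_mult_right has_integral_add F_ball[OF R'(1)] one)
    then have "det S * m \<le> (1 / s\<^sup>2) * ((LINT x|lborel. F x) + (L_fun A - b\<^sup>2) * m)"
      using R'(2)[of f] f1 f2 unfolding m_def by (metis has_integral_integrable integral_unique)
    then have "s\<^sup>2 * (det S * m) \<le> (LINT x|lborel. F x) + (L_fun A - b\<^sup>2) * m"
      using s(1) by (simp add: field_simps)
    then show ?thesis unfolding LA by (simp add: algebra_simps)
  qed
  then show ?thesis unfolding F_def .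
qed

end
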